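(* Let $m, n \in \mathbb{N}$ with $m \geq 3$, $n \geq 2$, and let $K$ be a field containing a primitive $m$-th root of unity $q$. Let $\xi$ be a generator of the cyclic group $U_n(K)$ and $\nu(n)=|U_n(K)|$. For any $t \in \{0, 1,\dots, \nu(n)-1\}$ there exists an isomorphism of groups $$\mathrm{Aut}_{\mathrm{Hopf}}\big(T_{nm^{2}}^{\xi^{t}}(q)\big) \simeq K^{*}\times S^{t}_{m, n}(q),$$ where $$S^{t}_{m,n}(q)=\big\{(\overline{l},\widehat{s})\in \mathbb{Z}_m\times U(\mathbb{Z}_n) \mid \xi^{t(s-1)}=q^{l}\big\}$$ is the group with multiplication $(\overline{l},\widehat{s})(\overline{l'},\widehat{s'})=(\overline{l+sl'},\widehat{ss'})$.
   Context: All algebras, Hopf algebras and tensor products are over $K$. $U_n(K)=\{\omega\in K \mid \omega^n=1\}$ is the cyclic group of $n$-th roots of unity in $K$ (its order $\nu(n)$ divides $n$). A primitive $m$-th root of unity is a generator of $U_m(K)$ when $|U_m(K)|=m$. $K^*$ is the multiplicative group of $K$; $\mathbb{Z}_m=\mathbb{Z}/m\mathbb{Z}$, with classes written $\overline{l}$; $U(\mathbb{Z}_n)$ is the group of units of $\mathbb{Z}_n=\mathbb{Z}/n\mathbb{Z}$, with classes written $\widehat{s}$. $\mathrm{Aut}_{\mathrm{Hopf}}$ denotes the group of Hopf algebra automorphisms under composition. In $S^t_{m,n}(q)$, the multiplication is computed with any representatives $l,l',s,s'$; the unit is $(\overline{0},\widehat{1})$ and the inverse of $(\overline{l},\widehat{s})$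 is $(\overline{-ls'},\widehat{s'})$ with $\widehat{s'}=\widehat{s}^{-1}$. For $\omega\in U_n(K)$, $T_{nm^{2}}^{\omega}(q)$ (abbreviated $T_{nm^2}^{\omega}$) denotes the $nm^2$-dimensional Hopf algebra generated as an algebra by $g$, $h$, $x$ subject to $g^{n}=h^{m}=1$, $x^{m}=0$, $xh=qhx$, $hg=gh$, $gx=\omega xg$, with $\Delta(g)=g\otimes g$, $\Delta(h)=h\otimes h$, $\Delta(x)=x\otimes h+1\otimes x$, $\varepsilon(h)=\varepsilon(g)=1$, $\varepsilon(x)=0$, $S(h)=h^{m-1}$, $S(x)=-xh^{m-1}$, $S(g)=g^{n-1}$. *)

theory Defs
  imports
    "HOL-Algebra.QuotRing"
    "HOL-Algebra.Module"
    "HOL-Algebra.Bij"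
    "HOL-Library.Poly_Mapping"
    "HOL-Number_Theory.Residues"
begin

section \<open>Roots of unity\<close>

definition roots_unity :: "nat \<Rightarrow> 'k::field set"
  where "roots_unity n = {w. w ^ n = 1}"

definition generates_roots_unity :: "nat \<Rightarrow> 'k::field \<Rightarrow> bool"
  where "generates_roots_unity n \<xi> \<longleftrightarrow> roots_unity n = range (\<lambda>k::int. \<xi> powi k)"

definition primitive_root_unity :: "nat \<Rightarrow> 'k::field \<Rightarrow> bool"
  where "primitive_root_unity m q \<longleftrightarrow>
    card (roots_unity m :: 'k set) = m \<and> generates_roots_unity m q"


section \<open>Algebras over a field\<close>

text \<open>
  The base field is a type \<open>'k\<close> of class \<open>field\<close>. An associative, not necessarily
  commutative algebra over it is a record of type \<open>module\<close>, whose fields include the ring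
  multiplication and unit.
\<close>

definition ground_algebra :: "('k::field, 'k) module"
  where "ground_algebra =
    \<lparr>carrier = UNIV, monoid.mult = (*), one = 1, zero = 0, add = (+), smult = (*)\<rparr>"

definition monoid_algebra :: "('a, 'm) monoid_scheme \<Rightarrow> ('k::field, 'a \<Rightarrow>\<^sub>0 'k) module"
  where "monoid_algebra M =
    \<lparr>carrier = {p. Poly_Mapping.keys p \<subseteq> carrier M},
     monoid.mult = (\<lambda>p r. \<Sum>a\<in>Poly_Mapping.keys p. \<Sum>b\<in>Poly_Mapping.keys r.
       Poly_Mapping.single (a \<otimes>\<^bsub>M\<^esub> b) (Poly_Mapping.lookup p a * Poly_Mapping.lookup r b)),
     one = Poly_Mapping.single \<one>\<^bsub>M\<^esub> 1,
     zero = 0,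
     add = (+),
     smult = (\<lambda>c. Poly_Mapping.map ((*) c))\<rparr>"

definition quotient_algebra :: "('k, 'a, 'm) module_scheme \<Rightarrow> 'a set \<Rightarrow> ('k, 'a set) module"
  where "quotient_algebra A I =
    \<lparr>carrier = carrier (A Quot I),
     monoid.mult = monoid.mult (A Quot I),
     one = \<one>\<^bsub>A Quot I\<^esub>,
     zero = \<zero>\<^bsub>A Quot I\<^esub>,
     add = add (A Quot I),
     smult = (\<lambda>c P. \<Union>p\<in>P. I +>\<^bsub>A\<^esub> (c \<odot>\<^bsub>A\<^esub> p))\<rparr>"

text \<open>The map on cosets induced by a map \<open>f\<close> that is constant on each coset.\<close>

definition induced_map :: "('a \<Rightarrow> 'b) \<Rightarrow> 'a set \<Rightarrow> 'b"
  where "induced_map f P = the_elem (f ` P)"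

definition linear_extension ::
    "('k::field, 'b, 'm) module_scheme \<Rightarrow> ('a \<Rightarrow> 'b) \<Rightarrow> ('a \<Rightarrow>\<^sub>0 'k) \<Rightarrow> 'b"
  where "linear_extension A \<phi> p =
    (\<Oplus>\<^bsub>A\<^esub>a\<in>Poly_Mapping.keys p. Poly_Mapping.lookup p a \<odot>\<^bsub>A\<^esub> \<phi> a)"


section \<open>Tensor products of algebras\<close>

definition tensor_relations ::
    "('k::field, 'a, 'm) module_scheme \<Rightarrow> ('k, 'b, 'l) module_scheme \<Rightarrow> ('a \<times> 'b \<Rightarrow>\<^sub>0 'k) set"
  where "tensor_relations A B =
    {Poly_Mapping.single (a \<oplus>\<^bsub>A\<^esub> a', b) 1 - Poly_Mapping.single (a, b) 1
       - Poly_Mapping.single (a', b) 1 | a a' b.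
       a \<in> carrier A \<and> a' \<in> carrier A \<and> b \<in> carrier B} \<union>
    {Poly_Mapping.single (a, b \<oplus>\<^bsub>B\<^esub> b') 1 - Poly_Mapping.single (a, b) 1
       - Poly_Mapping.single (a, b') 1 | a b b'.
       a \<in> carrier A \<and> b \<in> carrier B \<and> b' \<in> carrier B} \<union>
    {Poly_Mapping.single (c \<odot>\<^bsub>A\<^esub> a, b) 1 - Poly_Mapping.single (a, b) c | c a b.
       a \<in> carrier A \<and> b \<in> carrier B} \<union>
    {Poly_Mapping.single (a, c \<odot>\<^bsub>B\<^esub> b) 1 - Poly_Mapping.single (a, b) c | c a b.
       a \<in> carrier A \<and> b \<in> carrier B}"

definition tensor_null ::
    "('k::field, 'a, 'm) module_scheme \<Rightarrow> ('k, 'b, 'l) module_scheme \<Rightarrow> ('a \<times> 'b \<Rightarrow>\<^sub>0 'k) set"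
  where "tensor_null A B =
    Modules.module.span (\<lambda>c. Poly_Mapping.map ((*) c)) (tensor_relations A B)"

text \<open>
  The vector space on \<open>carrier A \<times> carrier B\<close> modulo the bilinearity relations. It is
  built from the monoid algebra of the product of the multiplicative monoids, so that
  the quotient carries the product \<open>(a \<otimes> b)(a' \<otimes> b') = aa' \<otimes> bb'\<close>.
\<close>

definition tensor_algebra ::
    "('k::field, 'a, 'm) module_scheme \<Rightarrow> ('k, 'b, 'l) module_scheme
      \<Rightarrow> ('k, ('a \<times> 'b \<Rightarrow>\<^sub>0 'k) set) module"
  where "tensor_algebra A B = quotient_algebra (monoid_algebra (A \<times>\<times> B)) (tensor_null A B)"

definition pure_tensor ::
    "('k::field, 'a, 'm) module_scheme \<Rightarrow> ('k, 'b, 'l) module_scheme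
      \<Rightarrow> 'a \<Rightarrow> 'b \<Rightarrow> ('a \<times> 'b \<Rightarrow>\<^sub>0 'k) set"
  where "pure_tensor A B a b =
    tensor_null A B +>\<^bsub>monoid_algebra (A \<times>\<times> B)\<^esub> Poly_Mapping.single (a, b) 1"

text \<open>For linear maps \<open>f\<close> and \<open>g\<close> into \<open>C\<close> and \<open>D\<close>, the linear map
  sending \<open>a \<otimes> b\<close> to \<open>f a \<otimes> g b\<close>.\<close>

definition tensor_map ::
    "('k::field, 'c, 'm) module_scheme \<Rightarrow> ('k, 'd, 'l) module_scheme
      \<Rightarrow> ('a \<Rightarrow> 'c) \<Rightarrow> ('b \<Rightarrow> 'd) \<Rightarrow> ('a \<times> 'b \<Rightarrow>\<^sub>0 'k) set \<Rightarrow> ('c \<times> 'd \<Rightarrow>\<^sub>0 'k) set"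
  where "tensor_map C D f g =
    induced_map (linear_extension (tensor_algebra C D) (\<lambda>(a, b). pure_tensor C D (f a) (g b)))"


section \<open>Hopf algebras and their automorphisms\<close>

record (overloaded) ('k, 'a) hopf = "('k::field, 'a) module" +
  comult :: "'a \<Rightarrow> ('a \<times> 'a \<Rightarrow>\<^sub>0 'k) set"
  counit :: "'a \<Rightarrow> 'k"
  antipode :: "'a \<Rightarrow> 'a"

definition hopf_hom :: "('k::field, 'a) hopf \<Rightarrow> ('k, 'b) hopf \<Rightarrow> ('a \<Rightarrow> 'b) set"
  where "hopf_hom A B =
    {f \<in> ring_hom A B. \<forall>a\<in>carrier A.
       (\<forall>c. f (c \<odot>\<^bsub>A\<^esub> a) = c \<odot>\<^bsub>B\<^esub> f a) \<and>
       comult B (f a) = tensor_map B B f f (comult A a) \<and>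
       counit B (f a) = counit A a \<and>
       antipode B (f a) = f (antipode A a)}"

definition Aut_Hopf :: "('k::field, 'a) hopf \<Rightarrow> ('a \<Rightarrow> 'a) monoid"
  where "Aut_Hopf A = BijGroup (carrier A) \<lparr>carrier := hopf_hom A A \<inter> Bij (carrier A)\<rparr>"


section \<open>The Hopf algebra presented by \<open>g\<close>, \<open>h\<close> and \<open>x\<close>\<close>

datatype gen = gen_g | gen_h | gen_x

definition free_algebra :: "('k::field, gen list \<Rightarrow>\<^sub>0 'k) module"
  where "free_algebra = monoid_algebra \<lparr>carrier = UNIV, monoid.mult = (@), one = []\<rparr>"

definition free_gen :: "gen \<Rightarrow> (gen list \<Rightarrow>\<^sub>0 'k::field)"
  where "free_gen y = Poly_Mapping.single [y] 1"

definition word_prod :: "('a, 'm) monoid_scheme \<Rightarrow> (gen \<Rightarrow> 'a) \<Rightarrow> gen list \<Rightarrow> 'a"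
  where "word_prod M \<phi> w = foldr (\<lambda>y z. \<phi> y \<otimes>\<^bsub>M\<^esub> z) w \<one>\<^bsub>M\<^esub>"

text \<open>The algebra map and the anti-multiplicative algebra map out of the free algebra
  that have the prescribed values on the generators.\<close>

definition free_hom ::
    "('k::field, 'a, 'm) module_scheme \<Rightarrow> (gen \<Rightarrow> 'a) \<Rightarrow> (gen list \<Rightarrow>\<^sub>0 'k) \<Rightarrow> 'a"
  where "free_hom A \<phi> = linear_extension A (word_prod A \<phi>)"

definition free_antihom ::
    "('k::field, 'a, 'm) module_scheme \<Rightarrow> (gen \<Rightarrow> 'a) \<Rightarrow> (gen list \<Rightarrow>\<^sub>0 'k) \<Rightarrow> 'a"
  where "free_antihom A \<phi> = linear_extension A (\<lambda>w. word_prod A \<phi> (rev w))"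

definition T_relations :: "nat \<Rightarrow> nat \<Rightarrow> 'k::field \<Rightarrow> 'k \<Rightarrow> (gen list \<Rightarrow>\<^sub>0 'k) set"
  where "T_relations m n q \<omega> =
    (let F = free_algebra; g = free_gen gen_g; h = free_gen gen_h; x = free_gen gen_x in
     {g [^]\<^bsub>F\<^esub> n - \<one>\<^bsub>F\<^esub>,
      h [^]\<^bsub>F\<^esub> m - \<one>\<^bsub>F\<^esub>,
      x [^]\<^bsub>F\<^esub> m,
      x \<otimes>\<^bsub>F\<^esub> h - q \<odot>\<^bsub>F\<^esub> (h \<otimes>\<^bsub>F\<^esub> x),
      h \<otimes>\<^bsub>F\<^esub> g - g \<otimes>\<^bsub>F\<^esub> h,
      g \<otimes>\<^bsub>F\<^esub> x - \<omega> \<odot>\<^bsub>F\<^esub> (x \<otimes>\<^bsub>F\<^esub> g)})"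

definition T_ideal :: "nat \<Rightarrow> nat \<Rightarrow> 'k::field \<Rightarrow> 'k \<Rightarrow> (gen list \<Rightarrow>\<^sub>0 'k) set"
  where "T_ideal m n q \<omega> = Idl\<^bsub>free_algebra\<^esub> (T_relations m n q \<omega>)"

definition T_algebra ::
    "nat \<Rightarrow> nat \<Rightarrow> 'k::field \<Rightarrow> 'k \<Rightarrow> ('k, (gen list \<Rightarrow>\<^sub>0 'k) set) module"
  where "T_algebra m n q \<omega> = quotient_algebra free_algebra (T_ideal m n q \<omega>)"

definition T_gen :: "nat \<Rightarrow> nat \<Rightarrow> 'k::field \<Rightarrow> 'k \<Rightarrow> gen \<Rightarrow> (gen list \<Rightarrow>\<^sub>0 'k) set"
  where "T_gen m n q \<omega> y = T_ideal m n q \<omega> +>\<^bsub>free_algebra\<^esub> free_gen y"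

text \<open>
  When \<open>q\<close> is a primitive \<open>m\<close>-th root of unity and \<open>\<omega> ^ n = 1\<close>, the three maps on the free
  algebra respect the defining relations, so that \<open>induced_map\<close> is applied to maps constant
  on the cosets. The comultiplication and the counit are multiplicative and the antipode is
  anti-multiplicative.
\<close>

definition T_hopf ::
    "nat \<Rightarrow> nat \<Rightarrow> 'k::field \<Rightarrow> 'k \<Rightarrow> ('k, (gen list \<Rightarrow>\<^sub>0 'k) set) hopf"
  where "T_hopf m n q \<omega> =
    (let A = T_algebra m n q \<omega>;
         g = T_gen m n q \<omega> gen_g; h = T_gen m n q \<omega> gen_h; x = T_gen m n q \<omega> gen_x;
         AA = tensor_algebra A A
     in module.extend A (hopf.fields
          (induced_map (free_hom AA
             (case_gen (pure_tensor A A g g)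
                       (pure_tensor A A h h)
                       (pure_tensor A A x h \<oplus>\<^bsub>AA\<^esub> pure_tensor A A \<one>\<^bsub>A\<^esub> x))))
          (induced_map (free_hom ground_algebra (case_gen 1 1 0)))
          (induced_map (free_antihom A
             (case_gen (g [^]\<^bsub>A\<^esub> (n - 1))
                       (h [^]\<^bsub>A\<^esub> (m - 1))
                       (\<ominus>\<^bsub>A\<^esub> (x \<otimes>\<^bsub>A\<^esub> h [^]\<^bsub>A\<^esub> (m - 1))))))))"


section \<open>The group \<open>S\<close>\<close>

text \<open>
  Residue classes are represented by their least nonnegative representatives. On the given
  carrier the product does not depend on the choice of representatives, because
  \<open>q ^ l\<close> is a power of \<open>\<xi>\<close>, hence an \<open>n\<close>-th root of unity, so that \<open>m\<close> divides \<open>n * l\<close>.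
\<close>

definition S_group :: "nat \<Rightarrow> nat \<Rightarrow> 'k::field \<Rightarrow> 'k \<Rightarrow> nat \<Rightarrow> (int \<times> int) monoid"
  where "S_group m n q \<xi> t =
    \<lparr>carrier = {(l, s). l \<in> carrier (residue_ring (int m)) \<and> s \<in> Units (residue_ring (int n)) \<and>
        \<xi> powi (int t * (s - 1)) = q powi l},
     monoid.mult = (\<lambda>(l, s) (l', s'). ((l + s * l') mod int m, (s * s') mod int n)),
     one = (0, 1)\<rparr>"

end

theory Submission
  imports Defs
begin

text \<open>
  Write \<open>T\<close> for the algebra presented by \<open>g\<close>, \<open>h\<close>, \<open>x\<close>, and \<open>\<omega> = \<xi> ^ t\<close>. A Hopf automorphism is
  determined by the images of the generators, and the coalgebra structure leaves very little
  choice for them.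

  The monomials \<open>g\<^sup>i h\<^sup>j x\<^sup>k\<close> with \<open>i < n\<close> and \<open>j, k < m\<close> form a basis of \<open>T\<close>. They span because
  every word is a scalar multiple of the monomial with the same numbers of letters. They are
  independent because this normal form of words defines functionals on the free algebra whose
  common kernel is a two-sided ideal containing the relations (\<open>free_coord_ideal\<close>); so the
  functionals descend to coordinates on \<open>T\<close>, and pairs of them give functionals on \<open>T \<otimes> T\<close>.
  In \<open>T \<otimes> T\<close> the elements \<open>x \<otimes> h\<close> and \<open>1 \<otimes> x\<close> commute up to the factor \<open>q\<close>, and the q-binomial
  theorem yields at the same time that the comultiplication is well defined (the Gaussian binomial
  coefficients in row \<open>m\<close> vanish except at the ends) and its matrix in the monomial basis
  (\<open>comult_coord\<close>).

  Let \<open>f\<close> be an automorphism. Reading off coefficients, the only grouplike elements are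
  \<open>g\<^sup>a h\<^sup>b\<close> (\<open>grouplike\<close>), so \<open>f g\<close> and \<open>f h\<close> have this form. Since \<open>\<Delta> x = x \<otimes> h + 1 \<otimes> x\<close>, the
  element \<open>f x\<close> is skew-primitive for the grouplike \<open>f h\<close>, which forces \<open>f x = y + c x\<close> with \<open>y\<close> in
  the span of the grouplikes, and \<open>f h = h\<close> whenever \<open>c \<noteq> 0\<close> (\<open>skew_primitive\<close>). The relation
  \<open>x h = q h x\<close> now gives \<open>y u = q y u\<close> for the invertible element \<open>u = f h\<close>; as \<open>q \<noteq> 1\<close>, \<open>y = 0\<close>.
  Hence \<open>c \<noteq> 0\<close>, \<open>f h = h\<close>, \<open>f x = c x\<close> and \<open>f g = g\<^sup>s h\<^sup>l\<close>. The relation \<open>g x = \<omega> x g\<close> says exactly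
  that \<open>\<omega>\<^sup>s = \<omega> q\<^sup>l\<close>, and injectivity on the powers of \<open>g\<close> makes \<open>s\<close> coprime to \<open>n\<close>
  (\<open>automorphism_classification\<close>).

  Conversely every such \<open>(c, l, s)\<close> respects the relations and defines a Hopf endomorphism. The one
  for \<open>(c, l, s)\<close> after the one for \<open>(c', l', s')\<close> is the one for \<open>(c' c, l' + s' l, s' s)\<close>
  (\<open>T_auto_comp\<close>). This is the product of the triples in the opposite order, so triples act through
  an anti-isomorphism, and composing it with inversion gives the isomorphism of the theorem.
\<close>

section \<open>Algebras over a field\<close>

text \<open>
  Multiplication is not commutative here: the generators satisfy \<open>x h = q h x\<close>. The scalars form a
  whole type, so no membership condition on them appears.
\<close>

locale kalgebra = ring A for A :: "('k::field, 'a, 'm) module_scheme" (structure) +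
  assumes smult_closed [simp, intro]: "a \<in> carrier A \<Longrightarrow> c \<odot> a \<in> carrier A"
    and smult_l_distr: "a \<in> carrier A \<Longrightarrow> (c + d) \<odot> a = c \<odot> a \<oplus> d \<odot> a"
    and smult_r_distr: "a \<in> carrier A \<Longrightarrow> b \<in> carrier A \<Longrightarrow> c \<odot> (a \<oplus> b) = c \<odot> a \<oplus> c \<odot> b"
    and smult_smult: "a \<in> carrier A \<Longrightarrow> c \<odot> (d \<odot> a) = (c * d) \<odot> a"
    and smult_one [simp]: "a \<in> carrier A \<Longrightarrow> 1 \<odot> a = a"
    and smult_mult_left: "a \<in> carrier A \<Longrightarrow> b \<in> carrier A \<Longrightarrow> (c \<odot> a) \<otimes> b = c \<odot> (a \<otimes> b)"
    and smult_mult_right: "a \<in> carrier A \<Longrightarrow> b \<in> carrier A \<Longrightarrow> a \<otimes> (c \<odot> b) = c \<odot> (a \<otimes> b)"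
begin

lemma is_kalgebra: "kalgebra A" by unfold_locales

lemma smult_zero_left [simp]:
  assumes "a \<in> carrier A" shows "0 \<odot> a = \<zero>"
proof -
  have "0 \<odot> a \<oplus> 0 \<odot> a = 0 \<odot> a \<oplus> \<zero>"
    using smult_l_distr[OF assms, of 0 0] assms by simp
  then show ?thesis using assms by (simp del: r_zero)
qed

lemma smult_zero_right [simp]: "c \<odot> \<zero> = \<zero>"
proof -
  have "c \<odot> \<zero> \<oplus> c \<odot> \<zero> = c \<odot> \<zero> \<oplus> \<zero>"
    using smult_r_distr[of \<zero> \<zero> c] by simp
  then show ?thesis by (simp del: r_zero)
qed

lemma smult_minus_one:
  assumes "a \<in> carrier A" shows "(-1) \<odot> a = \<ominus> a"
proof -
  have "(-1) \<odot> a \<oplus> a = \<zero>"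
    using smult_l_distr[OF assms, of "-1" 1] assms by simp
  then show ?thesis using assms by (metis minus_equality smult_closed)
qed

lemma smult_finsum:
  "f \<in> F \<rightarrow> carrier A \<Longrightarrow> c \<odot> (\<Oplus>i\<in>F. f i) = (\<Oplus>i\<in>F. c \<odot> f i)"
  by (induction F rule: infinite_finite_induct)
    (auto simp: Pi_iff smult_r_distr)

lemma smult_pow:
  assumes "a \<in> carrier A"
  shows "(c \<odot> a) [^] (k::nat) = (c ^ k) \<odot> (a [^] k)"
  using assms
  by (induction k) (auto simp: smult_mult_left smult_mult_right smult_smult mult_ac)

end

definition linear_maps ::
    "('k::field, 'a, 'm) module_scheme \<Rightarrow> ('k, 'b, 'l) module_scheme \<Rightarrow> ('a \<Rightarrow> 'b) set"
  where "linear_maps A B = {f \<in> carrier A \<rightarrow> carrier B.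
    (\<forall>a\<in>carrier A. \<forall>b\<in>carrier A. f (a \<oplus>\<^bsub>A\<^esub> b) = f a \<oplus>\<^bsub>B\<^esub> f b) \<and>
    (\<forall>c. \<forall>a\<in>carrier A. f (c \<odot>\<^bsub>A\<^esub> a) = c \<odot>\<^bsub>B\<^esub> f a)}"

definition algebra_homs ::
    "('k::field, 'a, 'm) module_scheme \<Rightarrow> ('k, 'b, 'l) module_scheme \<Rightarrow> ('a \<Rightarrow> 'b) set"
  where "algebra_homs A B = {f \<in> linear_maps A B. f \<one>\<^bsub>A\<^esub> = \<one>\<^bsub>B\<^esub> \<and>
    (\<forall>a\<in>carrier A. \<forall>b\<in>carrier A. f (a \<otimes>\<^bsub>A\<^esub> b) = f a \<otimes>\<^bsub>B\<^esub> f b)}"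

lemma linear_mapsI:
  assumes "\<And>a. a \<in> carrier A \<Longrightarrow> f a \<in> carrier B"
    and "\<And>a b. a \<in> carrier A \<Longrightarrow> b \<in> carrier A \<Longrightarrow> f (a \<oplus>\<^bsub>A\<^esub> b) = f a \<oplus>\<^bsub>B\<^esub> f b"
    and "\<And>c a. a \<in> carrier A \<Longrightarrow> f (c \<odot>\<^bsub>A\<^esub> a) = c \<odot>\<^bsub>B\<^esub> f a"
  shows "f \<in> linear_maps A B"
  using assms by (auto simp: linear_maps_def)

lemma linear_mapsD:
  assumes "f \<in> linear_maps A B"
  shows "a \<in> carrier A \<Longrightarrow> f a \<in> carrier B"
    and "a \<in> carrier A \<Longrightarrow> b \<in> carrier A \<Longrightarrow> f (a \<oplus>\<^bsub>A\<^esub> b) = f a \<oplus>\<^bsub>B\<^esub> f b"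
    and "a \<in> carrier A \<Longrightarrow> f (c \<odot>\<^bsub>A\<^esub> a) = c \<odot>\<^bsub>B\<^esub> f a"
  using assms by (auto simp: linear_maps_def)

lemma algebra_homsI:
  assumes "f \<in> linear_maps A B" "f \<one>\<^bsub>A\<^esub> = \<one>\<^bsub>B\<^esub>"
    and "\<And>a b. a \<in> carrier A \<Longrightarrow> b \<in> carrier A \<Longrightarrow> f (a \<otimes>\<^bsub>A\<^esub> b) = f a \<otimes>\<^bsub>B\<^esub> f b"
  shows "f \<in> algebra_homs A B"
  using assms by (auto simp: algebra_homs_def)

lemma algebra_homsD:
  assumes "f \<in> algebra_homs A B"
  shows "f \<in> linear_maps A B" and "f \<one>\<^bsub>A\<^esub> = \<one>\<^bsub>B\<^esub>"
    and "a \<in> carrier A \<Longrightarrow> b \<in> carrier A \<Longrightarrow> f (a \<otimes>\<^bsub>A\<^esub> b) = f a \<otimes>\<^bsub>B\<^esub> f b"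
    and "a \<in> carrier A \<Longrightarrow> f a \<in> carrier B"
    and "a \<in> carrier A \<Longrightarrow> b \<in> carrier A \<Longrightarrow> f (a \<oplus>\<^bsub>A\<^esub> b) = f a \<oplus>\<^bsub>B\<^esub> f b"
    and "a \<in> carrier A \<Longrightarrow> f (c \<odot>\<^bsub>A\<^esub> a) = c \<odot>\<^bsub>B\<^esub> f a"
  using assms by (auto simp: algebra_homs_def linear_maps_def)

lemma linear_maps_comp:
  "f \<in> linear_maps A B \<Longrightarrow> g \<in> linear_maps B C \<Longrightarrow> (\<lambda>a. g (f a)) \<in> linear_maps A C"
  by (auto simp: linear_maps_def Pi_iff)

lemma algebra_homs_comp:
  "f \<in> algebra_homs A B \<Longrightarrow> g \<in> algebra_homs B C \<Longrightarrow> (\<lambda>a. g (f a)) \<in> algebra_homs A C"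
  by (auto simp: algebra_homs_def linear_maps_def Pi_iff)

lemma algebra_homs_restrict:
  assumes "kalgebra A" "f \<in> algebra_homs A B"
  shows "restrict f (carrier A) \<in> algebra_homs A B"
proof -
  interpret kalgebra A by fact
  show ?thesis using assms(2) by (auto simp: algebra_homs_def linear_maps_def)
qed

lemma linear_maps_zero:
  assumes "kalgebra A" "kalgebra B" "f \<in> linear_maps A B"
  shows "f \<zero>\<^bsub>A\<^esub> = \<zero>\<^bsub>B\<^esub>"
proof -
  interpret A: kalgebra A by fact
  interpret B: kalgebra B by fact
  show ?thesis
    using linear_mapsD(3)[OF assms(3), of "\<zero>\<^bsub>A\<^esub>" 0] linear_mapsD(1)[OF assms(3)]
    by simp
qed

lemma linear_maps_finsum:
  assumes "kalgebra A" "kalgebra B" "f \<in> linear_maps A B" "e \<in> F \<rightarrow> carrier A"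
  shows "f (\<Oplus>\<^bsub>A\<^esub>i\<in>F. e i) = (\<Oplus>\<^bsub>B\<^esub>i\<in>F. f (e i))"
proof -
  interpret A: kalgebra A by fact
  interpret B: kalgebra B by fact
  show ?thesis using assms(4)
    by (induction F rule: infinite_finite_induct)
      (auto simp: Pi_iff linear_mapsD[OF assms(3)] linear_maps_zero[OF assms(1-3)])
qed

lemma algebra_homs_pow:
  assumes "kalgebra A" "f \<in> algebra_homs A B" "a \<in> carrier A"
  shows "f (a [^]\<^bsub>A\<^esub> (k::nat)) = f a [^]\<^bsub>B\<^esub> k"
proof -
  interpret A: kalgebra A by fact
  show ?thesis using assms(3)
    by (induction k) (auto simp: algebra_homsD[OF assms(2)])
qed

lemma ground_algebra_simps [simp]:
  "carrier ground_algebra = UNIV" "monoid.mult ground_algebra = (*)" "\<one>\<^bsub>ground_algebra\<^esub> = 1"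
  "\<zero>\<^bsub>ground_algebra\<^esub> = 0" "add ground_algebra = (+)" "module.smult ground_algebra = (*)"
  by (simp_all add: ground_algebra_def)

lemma ground_algebra_kalgebra: "kalgebra (ground_algebra :: ('k::field, 'k) module)"
proof -
  have "ring (ground_algebra :: ('k::field, 'k) module)"
  proof (rule ringI)
    show "abelian_group (ground_algebra :: ('k, 'k) module)"
      by (rule abelian_groupI) (auto simp: add_ac intro: exI[of _ "- _"] left_minus)
    show "Group.monoid (ground_algebra :: ('k, 'k) module)"
      by (rule Group.monoidI) (auto simp: mult_ac)
  qed (auto simp: algebra_simps)
  then show ?thesis
    by (auto simp: kalgebra_def kalgebra_axioms_def algebra_simps)
qed

lemma ground_algebra_pow [simp]: "(a::'k::field) [^]\<^bsub>ground_algebra\<^esub> (k::nat) = a ^ k"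
proof -
  interpret kalgebra "ground_algebra :: ('k, 'k) module" by (rule ground_algebra_kalgebra)
  show ?thesis by (induction k) (auto simp: mult_ac)
qed

text \<open>Anti-multiplicative maps are handled as homomorphisms into the opposite algebra.\<close>

definition opposite :: "('k::field, 'a, 'm) module_scheme \<Rightarrow> ('k, 'a, 'm) module_scheme"
  where "opposite A = A\<lparr>monoid.mult := \<lambda>a b. b \<otimes>\<^bsub>A\<^esub> a\<rparr>"

lemma opposite_simps [simp]:
  "carrier (opposite A) = carrier A" "a \<otimes>\<^bsub>opposite A\<^esub> b = b \<otimes>\<^bsub>A\<^esub> a"
  "\<one>\<^bsub>opposite A\<^esub> = \<one>\<^bsub>A\<^esub>" "\<zero>\<^bsub>opposite A\<^esub> = \<zero>\<^bsub>A\<^esub>" "add (opposite A) = add A"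
  "module.smult (opposite A) = module.smult A" "finsum (opposite A) = finsum A"
  by (simp_all add: opposite_def finsum_def)

lemma opposite_kalgebra:
  assumes "kalgebra A" shows "kalgebra (opposite A)"
proof -
  interpret A: kalgebra A by fact
  have "ring (opposite A)"
  proof (rule ringI)
    show "abelian_group (opposite A)"
      by (rule abelian_groupI) (auto simp: A.a_ac intro: A.add.l_inv_ex)
    show "Group.monoid (opposite A)"
      by (rule Group.monoidI) (auto simp: A.m_assoc)
  qed (auto simp: A.l_distr A.r_distr)
  then show ?thesis
    by (auto simp: kalgebra_def kalgebra_axioms_def A.smult_l_distr A.smult_r_distr
        A.smult_smult A.smult_mult_left A.smult_mult_right)
qed

lemma opposite_pow:
  assumes "kalgebra A" "a \<in> carrier A"
  shows "a [^]\<^bsub>opposite A\<^esub> (k::nat) = a [^]\<^bsub>A\<^esub> k"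
proof -
  interpret A: kalgebra A by fact
  interpret O: kalgebra "opposite A" by (rule opposite_kalgebra) fact
  show ?thesis using assms(2)
    by (induction k) (auto simp: A.nat_pow_Suc2[symmetric] simp del: A.nat_pow_Suc)
qed


section \<open>Finitely supported functions and linear extension\<close>

abbreviation scale :: "'k::field \<Rightarrow> ('a \<Rightarrow>\<^sub>0 'k) \<Rightarrow> ('a \<Rightarrow>\<^sub>0 'k)"
  where "scale c \<equiv> Poly_Mapping.map ((*) c)"

lemma lookup_scale [simp]: "Poly_Mapping.lookup (scale c p) a = c * Poly_Mapping.lookup p a"
  by (simp add: Poly_Mapping.map.rep_eq when_def)

lemma scale_single [simp]: "scale c (Poly_Mapping.single a d) = Poly_Mapping.single a (c * d)"
  by (rule poly_mapping_eqI) (simp add: lookup_single when_def)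

lemma keys_scale: "Poly_Mapping.keys (scale c p) \<subseteq> Poly_Mapping.keys p"
  by (auto simp: in_keys_iff)

lemma scale_add: "scale c (p + r) = scale c p + scale c r"
  by (rule poly_mapping_eqI) (simp add: lookup_add algebra_simps)

lemma scale_add_left: "scale (c + d) p = scale c p + scale d p"
  by (rule poly_mapping_eqI) (simp add: lookup_add algebra_simps)

lemma scale_scale: "scale c (scale d p) = scale (c * d) p"
  by (rule poly_mapping_eqI) (simp add: mult_ac)

lemma scale_one [simp]: "scale 1 p = p"
  by (rule poly_mapping_eqI) simp

lemma scale_diff: "scale c (p - r) = scale c p - scale c r"
  by (rule poly_mapping_eqI) (simp add: lookup_minus algebra_simps)

lemma scale_zero [simp]: "scale c 0 = 0"
  by (rule poly_mapping_eqI) simp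

lemma scale_minus_one: "scale (-1) p = - p"
  by (rule poly_mapping_eqI) simp

lemma keys_add_subset:
  "Poly_Mapping.keys p \<subseteq> S \<Longrightarrow> Poly_Mapping.keys r \<subseteq> S \<Longrightarrow> Poly_Mapping.keys (p + r) \<subseteq> S"
  by (rule order_trans[OF keys_add]) simp

lemma keys_scale_subset: "Poly_Mapping.keys p \<subseteq> S \<Longrightarrow> Poly_Mapping.keys (scale c p) \<subseteq> S"
  by (rule order_trans[OF keys_scale])

lemma keys_single_subset: "a \<in> S \<Longrightarrow> Poly_Mapping.keys (Poly_Mapping.single a c) \<subseteq> S"
  by simp

lemma poly_mapping_sum_single:
  "p = (\<Sum>a\<in>Poly_Mapping.keys p. Poly_Mapping.single a (Poly_Mapping.lookup p a))"
proof (rule poly_mapping_eqI)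
  fix b
  have "(\<Sum>a\<in>Poly_Mapping.keys p. Poly_Mapping.lookup p a when a = b)
      = (\<Sum>a\<in>Poly_Mapping.keys p. if b = a then Poly_Mapping.lookup p a else 0)"
    by (rule sum.cong) (auto simp: when_def)
  then show "Poly_Mapping.lookup p b = Poly_Mapping.lookup
      (\<Sum>a\<in>Poly_Mapping.keys p. Poly_Mapping.single a (Poly_Mapping.lookup p a)) b"
    by (auto simp: lookup_sum lookup_single in_keys_iff)
qed

text \<open>
  Every identity between additive expressions in finitely supported functions is reduced by this rule
  to the case of a single basis element.
\<close>

lemma poly_mapping_on_induct [consumes 1, case_names zero single add]:
  fixes p :: "'a \<Rightarrow>\<^sub>0 'k::field"
  assumes keys: "Poly_Mapping.keys p \<subseteq> S"
    and zero: "P 0"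
    and single: "\<And>a c. a \<in> S \<Longrightarrow> P (Poly_Mapping.single a c)"
    and add: "\<And>p r. Poly_Mapping.keys p \<subseteq> S \<Longrightarrow> Poly_Mapping.keys r \<subseteq> S \<Longrightarrow> P p \<Longrightarrow> P r \<Longrightarrow> P (p + r)"
  shows "P p"
proof -
  have "Poly_Mapping.keys (\<Sum>a\<in>F. Poly_Mapping.single a (Poly_Mapping.lookup p a)) \<subseteq> S \<and>
      P (\<Sum>a\<in>F. Poly_Mapping.single a (Poly_Mapping.lookup p a))"
    if "finite F" "F \<subseteq> S" for F
    using that
  proof (induction F rule: finite_induct)
    case (insert a F)
    then show ?case
      by (simp add: keys_add_subset keys_single_subset single add)
  qed (use zero in simp)
  from this[of "Poly_Mapping.keys p"] keys show ?thesis
    using poly_mapping_sum_single[of p] by simp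
qed

context kalgebra
begin

text \<open>
  Summing over any finite set that contains the support frees the sum from the support itself. This
  is what makes additivity provable, where two supports have to be compared with a third.
\<close>

lemma linear_extension_superset:
  assumes "finite F" "Poly_Mapping.keys p \<subseteq> F" "\<phi> \<in> F \<rightarrow> carrier A"
  shows "linear_extension A \<phi> p = (\<Oplus>a\<in>F. Poly_Mapping.lookup p a \<odot> \<phi> a)"
  unfolding linear_extension_def
  by (rule add.finprod_mono_neutral_cong_left)
    (use assms in \<open>auto simp: Pi_iff in_keys_iff\<close>)

lemma linear_extension_closed:
  assumes "Poly_Mapping.keys p \<subseteq> S" "\<phi> \<in> S \<rightarrow> carrier A"
  shows "linear_extension A \<phi> p \<in> carrier A"
  unfolding linear_extension_def using assms by (intro finsum_closed) auto

lemma linear_extension_add: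
  assumes "Poly_Mapping.keys p \<subseteq> S" "Poly_Mapping.keys r \<subseteq> S" "\<phi> \<in> S \<rightarrow> carrier A"
  shows "linear_extension A \<phi> (p + r) = linear_extension A \<phi> p \<oplus> linear_extension A \<phi> r"
proof -
  define F where "F = Poly_Mapping.keys p \<union> Poly_Mapping.keys r"
  have F: "finite F" "Poly_Mapping.keys p \<subseteq> F" "Poly_Mapping.keys r \<subseteq> F" "\<phi> \<in> F \<rightarrow> carrier A"
    using assms by (auto simp: F_def)
  have "Poly_Mapping.keys (p + r) \<subseteq> F"
    using F by (simp add: keys_add_subset)
  then have "linear_extension A \<phi> (p + r) = (\<Oplus>a\<in>F. Poly_Mapping.lookup (p + r) a \<odot> \<phi> a)"
    using F by (intro linear_extension_superset)
  also have "\<dots> = (\<Oplus>a\<in>F. Poly_Mapping.lookup p a \<odot> \<phi> a \<oplus> Poly_Mapping.lookup r a \<odot> \<phi> a)"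
    using F by (intro finsum_cong') (auto simp: lookup_add smult_l_distr Pi_iff)
  also have "\<dots> = (\<Oplus>a\<in>F. Poly_Mapping.lookup p a \<odot> \<phi> a) \<oplus> (\<Oplus>a\<in>F. Poly_Mapping.lookup r a \<odot> \<phi> a)"
    using F by (intro finsum_addf) auto
  also have "\<dots> = linear_extension A \<phi> p \<oplus> linear_extension A \<phi> r"
    using F by (simp add: linear_extension_superset)
  finally show ?thesis .
qed

lemma linear_extension_zero [simp]: "linear_extension A \<phi> 0 = \<zero>"
  by (simp add: linear_extension_def)

lemma linear_extension_single:
  assumes "\<phi> a \<in> carrier A"
  shows "linear_extension A \<phi> (Poly_Mapping.single a c) = c \<odot> \<phi> a"
  using assms by (subst linear_extension_superset[of "{a}"]) auto

lemma linear_extension_scale: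
  assumes "Poly_Mapping.keys p \<subseteq> S" "\<phi> \<in> S \<rightarrow> carrier A"
  shows "linear_extension A \<phi> (scale c p) = c \<odot> linear_extension A \<phi> p"
proof -
  have K: "\<phi> \<in> Poly_Mapping.keys p \<rightarrow> carrier A" using assms by auto
  have "linear_extension A \<phi> (scale c p)
      = (\<Oplus>a\<in>Poly_Mapping.keys p. Poly_Mapping.lookup (scale c p) a \<odot> \<phi> a)"
    using K by (intro linear_extension_superset) (auto simp: keys_scale)
  also have "\<dots> = (\<Oplus>a\<in>Poly_Mapping.keys p. c \<odot> (Poly_Mapping.lookup p a \<odot> \<phi> a))"
    using K by (intro finsum_cong') (auto simp: smult_smult Pi_iff)
  also have "\<dots> = c \<odot> linear_extension A \<phi> p"
    unfolding linear_extension_def using K by (subst smult_finsum) auto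
  finally show ?thesis .
qed

lemma linear_extension_minus:
  assumes "Poly_Mapping.keys p \<subseteq> S" "Poly_Mapping.keys r \<subseteq> S" "\<phi> \<in> S \<rightarrow> carrier A"
  shows "linear_extension A \<phi> (p - r) = linear_extension A \<phi> p \<ominus> linear_extension A \<phi> r"
proof -
  have "linear_extension A \<phi> (p + scale (-1) r) = linear_extension A \<phi> p \<oplus> (-1) \<odot> linear_extension A \<phi> r"
    using assms by (simp add: linear_extension_add[of _ S] keys_scale_subset linear_extension_scale[of _ S])
  then show ?thesis
    using linear_extension_closed[OF assms(2,3)] by (simp add: scale_minus_one smult_minus_one a_minus_def)
qed

end

section \<open>Monoid algebras\<close>

lemma monoid_algebra_simps [simp]:
  "carrier (monoid_algebra M) = {p. Poly_Mapping.keys p \<subseteq> carrier M}"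
  "\<one>\<^bsub>monoid_algebra M\<^esub> = Poly_Mapping.single \<one>\<^bsub>M\<^esub> 1"
  "\<zero>\<^bsub>monoid_algebra M\<^esub> = 0"
  "add (monoid_algebra M) = (+)"
  "module.smult (monoid_algebra M) = scale"
  by (simp_all add: monoid_algebra_def)

lemma monoid_algebra_mult_superset:
  assumes "finite F" "finite G" "Poly_Mapping.keys p \<subseteq> F" "Poly_Mapping.keys r \<subseteq> G"
  shows "p \<otimes>\<^bsub>monoid_algebra M\<^esub> r = (\<Sum>a\<in>F. \<Sum>b\<in>G.
    Poly_Mapping.single (a \<otimes>\<^bsub>M\<^esub> b) (Poly_Mapping.lookup p a * Poly_Mapping.lookup r b))"
proof -
  have "(\<Sum>a\<in>Poly_Mapping.keys p. \<Sum>b\<in>Poly_Mapping.keys r.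
       Poly_Mapping.single (a \<otimes>\<^bsub>M\<^esub> b) (Poly_Mapping.lookup p a * Poly_Mapping.lookup r b))
      = (\<Sum>a\<in>Poly_Mapping.keys p. \<Sum>b\<in>G.
       Poly_Mapping.single (a \<otimes>\<^bsub>M\<^esub> b) (Poly_Mapping.lookup p a * Poly_Mapping.lookup r b))"
    using assms by (intro sum.cong sum.mono_neutral_left) (auto simp: in_keys_iff)
  also have "\<dots> = (\<Sum>a\<in>F. \<Sum>b\<in>G.
       Poly_Mapping.single (a \<otimes>\<^bsub>M\<^esub> b) (Poly_Mapping.lookup p a * Poly_Mapping.lookup r b))"
    using assms by (intro sum.mono_neutral_left) (auto simp: in_keys_iff)
  finally show ?thesis by (simp add: monoid_algebra_def)
qed

lemma monoid_algebra_mult_single [simp]: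
  "Poly_Mapping.single a c \<otimes>\<^bsub>monoid_algebra M\<^esub> Poly_Mapping.single b d
    = Poly_Mapping.single (a \<otimes>\<^bsub>M\<^esub> b) (c * d)"
  by (subst monoid_algebra_mult_superset[of "{a}" "{b}"]) auto

lemma monoid_algebra_add_left:
  "(p + p') \<otimes>\<^bsub>monoid_algebra M\<^esub> r = p \<otimes>\<^bsub>monoid_algebra M\<^esub> r + p' \<otimes>\<^bsub>monoid_algebra M\<^esub> r"
proof -
  let ?F = "Poly_Mapping.keys p \<union> Poly_Mapping.keys p'" and ?G = "Poly_Mapping.keys r"
  have "Poly_Mapping.keys (p + p') \<subseteq> ?F" by (simp add: keys_add)
  then show ?thesis
    by (simp add: monoid_algebra_mult_superset[of ?F ?G] lookup_add algebra_simps single_add sum.distrib)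
qed

lemma monoid_algebra_add_right:
  "r \<otimes>\<^bsub>monoid_algebra M\<^esub> (p + p') = r \<otimes>\<^bsub>monoid_algebra M\<^esub> p + r \<otimes>\<^bsub>monoid_algebra M\<^esub> p'"
proof -
  let ?F = "Poly_Mapping.keys p \<union> Poly_Mapping.keys p'" and ?G = "Poly_Mapping.keys r"
  have "Poly_Mapping.keys (p + p') \<subseteq> ?F" by (simp add: keys_add)
  then show ?thesis
    by (simp add: monoid_algebra_mult_superset[of ?G ?F] lookup_add algebra_simps single_add sum.distrib)
qed

lemma monoid_algebra_diff_left:
  "(p - p') \<otimes>\<^bsub>monoid_algebra M\<^esub> r = p \<otimes>\<^bsub>monoid_algebra M\<^esub> r - p' \<otimes>\<^bsub>monoid_algebra M\<^esub> r"
  using monoid_algebra_add_left[where p = "p - p'" and p' = p' and r = r and M = M] by simp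

lemma monoid_algebra_diff_right:
  "r \<otimes>\<^bsub>monoid_algebra M\<^esub> (p - p') = r \<otimes>\<^bsub>monoid_algebra M\<^esub> p - r \<otimes>\<^bsub>monoid_algebra M\<^esub> p'"
  using monoid_algebra_add_right[where p = "p - p'" and p' = p' and r = r and M = M] by simp

lemma monoid_algebra_mult_zero [simp]:
  "0 \<otimes>\<^bsub>monoid_algebra M\<^esub> r = 0" "r \<otimes>\<^bsub>monoid_algebra M\<^esub> 0 = 0"
  by (simp_all add: monoid_algebra_def)

lemma monoid_algebra_closed:
  assumes "monoid M" "Poly_Mapping.keys p \<subseteq> carrier M" "Poly_Mapping.keys r \<subseteq> carrier M"
  shows "Poly_Mapping.keys (p \<otimes>\<^bsub>monoid_algebra M\<^esub> r) \<subseteq> carrier M"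
proof -
  interpret monoid M by fact
  show ?thesis using assms(2)
  proof (induction p rule: poly_mapping_on_induct)
    case (single a c)
    show ?case using assms(3) single
      by (induction r rule: poly_mapping_on_induct)
        (auto simp: monoid_algebra_add_right keys_add_subset keys_single_subset)
  qed (auto simp: monoid_algebra_add_left keys_add_subset)
qed

lemma monoid_algebra_scale_left:
  assumes "Poly_Mapping.keys p \<subseteq> carrier M" "Poly_Mapping.keys r \<subseteq> carrier M"
  shows "scale c p \<otimes>\<^bsub>monoid_algebra M\<^esub> r = scale c (p \<otimes>\<^bsub>monoid_algebra M\<^esub> r)"
  using assms(1)
proof (induction p rule: poly_mapping_on_induct)
  case (single a d)
  show ?case using assms(2)
    by (induction r rule: poly_mapping_on_induct)
      (auto simp: monoid_algebra_add_right scale_add mult.assoc)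
qed (auto simp: monoid_algebra_add_left scale_add)

lemma monoid_algebra_scale_right:
  assumes "Poly_Mapping.keys p \<subseteq> carrier M" "Poly_Mapping.keys r \<subseteq> carrier M"
  shows "p \<otimes>\<^bsub>monoid_algebra M\<^esub> scale c r = scale c (p \<otimes>\<^bsub>monoid_algebra M\<^esub> r)"
  using assms(1)
proof (induction p rule: poly_mapping_on_induct)
  case (single a d)
  show ?case using assms(2)
    by (induction r rule: poly_mapping_on_induct)
      (auto simp: monoid_algebra_add_right scale_add mult.left_commute)
qed (auto simp: monoid_algebra_add_left scale_add)

lemma monoid_algebra_assoc:
  assumes "monoid M" "Poly_Mapping.keys p \<subseteq> carrier M" "Poly_Mapping.keys r \<subseteq> carrier M"
    "Poly_Mapping.keys s \<subseteq> carrier M"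
  shows "p \<otimes>\<^bsub>monoid_algebra M\<^esub> r \<otimes>\<^bsub>monoid_algebra M\<^esub> s
    = p \<otimes>\<^bsub>monoid_algebra M\<^esub> (r \<otimes>\<^bsub>monoid_algebra M\<^esub> s)"
proof -
  interpret monoid M by fact
  show ?thesis using assms(2)
  proof (induction p rule: poly_mapping_on_induct)
    case p: (single a c)
    show ?case using assms(3)
    proof (induction r rule: poly_mapping_on_induct)
      case r: (single b d)
      show ?case using assms(4)
        by (induction s rule: poly_mapping_on_induct)
          (use p r in \<open>auto simp: monoid_algebra_add_right m_assoc mult_ac\<close>)
    qed (auto simp: monoid_algebra_add_left monoid_algebra_add_right)
  qed (auto simp: monoid_algebra_add_left)
qed

lemma monoid_algebra_kalgebra:
  assumes "monoid M"
  shows "kalgebra (monoid_algebra M :: ('k::field, 'a \<Rightarrow>\<^sub>0 'k) module)"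
proof -
  interpret monoid M by fact
  let ?A = "monoid_algebra M :: ('k::field, 'a \<Rightarrow>\<^sub>0 'k) module"
  have one: "\<one>\<^bsub>?A\<^esub> \<otimes>\<^bsub>?A\<^esub> p = p" "p \<otimes>\<^bsub>?A\<^esub> \<one>\<^bsub>?A\<^esub> = p" if "Poly_Mapping.keys p \<subseteq> carrier M" for p
    using that by (induction p rule: poly_mapping_on_induct)
      (auto simp: monoid_algebra_add_left monoid_algebra_add_right)
  have "ring ?A"
  proof (rule ringI)
    show "abelian_group ?A"
      by (rule abelian_groupI)
        (auto simp: add_ac keys_add_subset intro!: exI[of _ "- p" for p])
    show "Group.monoid ?A"
      by (rule Group.monoidI)
        (use one in \<open>auto simp: monoid_algebra_assoc[OF assms]
          intro: subsetD[OF monoid_algebra_closed[OF assms]]\<close>)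
  qed (auto simp: monoid_algebra_add_left monoid_algebra_add_right)
  then show ?thesis
    by (auto simp: kalgebra_def kalgebra_axioms_def scale_add scale_add_left scale_scale
        monoid_algebra_scale_left monoid_algebra_scale_right subsetD[OF keys_scale])
qed

text \<open>
  The universal property of a monoid algebra. Both sides of the multiplicativity equation are
  additive in each factor, so it suffices to compare them on basis elements.
\<close>

lemma linear_extension_algebra_hom:
  assumes M: "monoid M" and B: "kalgebra B" and \<phi>: "\<phi> \<in> carrier M \<rightarrow> carrier B"
    and one: "\<phi> \<one>\<^bsub>M\<^esub> = \<one>\<^bsub>B\<^esub>"
    and mult: "\<And>a b. a \<in> carrier M \<Longrightarrow> b \<in> carrier M \<Longrightarrow> \<phi> (a \<otimes>\<^bsub>M\<^esub> b) = \<phi> a \<otimes>\<^bsub>B\<^esub> \<phi> b"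
  shows "linear_extension B \<phi> \<in> algebra_homs (monoid_algebra M) B"
proof -
  interpret M: monoid M by fact
  interpret B: kalgebra B by fact
  let ?L = "linear_extension B \<phi>"
  note add = B.linear_extension_add[OF _ _ \<phi>]
  note closed = B.linear_extension_closed[OF _ \<phi>]
  note cl = monoid_algebra_closed[OF M]
  have single: "?L (Poly_Mapping.single a c) = c \<odot>\<^bsub>B\<^esub> \<phi> a" if "a \<in> carrier M" for a c
    using that \<phi> by (intro B.linear_extension_single) auto
  have "?L (p \<otimes>\<^bsub>monoid_algebra M\<^esub> r) = ?L p \<otimes>\<^bsub>B\<^esub> ?L r"
    if p: "Poly_Mapping.keys p \<subseteq> carrier M" and r: "Poly_Mapping.keys r \<subseteq> carrier M" for p r
    using p
  proof (induction p rule: poly_mapping_on_induct)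
    case zero
    then show ?case using closed[OF r] by simp
  next
    case p: (single a c)
    show ?case using r
    proof (induction r rule: poly_mapping_on_induct)
      case zero
      then show ?case using closed[OF keys_single_subset[OF p]] by simp
    next
      case r: (single b d)
      show ?case using p r \<phi>
        by (simp add: single mult Pi_iff B.smult_mult_left B.smult_mult_right B.smult_smult mult.commute[of c d])
    next
      case (add r r')
      note K = keys_single_subset[OF p, of c]
      show ?case
        using add closed[OF K] closed[OF add(1)] closed[OF add(2)]
        by (simp add: monoid_algebra_add_right assms B.linear_extension_add[OF _ _ \<phi>] cl[OF K] B.r_distr)
    qed
  next
    case (add p p')
    show ?case
      using add closed[OF r] closed[OF add(1)] closed[OF add(2)] r
      by (simp add: monoid_algebra_add_left assms B.linear_extension_add[OF _ _ \<phi>] cl B.l_distr)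
  qed
  then show ?thesis
    using \<phi> by (intro algebra_homsI linear_mapsI)
      (auto simp: add closed single one Pi_iff B.linear_extension_scale[OF _ \<phi>])
qed

section \<open>Quotient algebras\<close>

lemma quotient_algebra_simps:
  "carrier (quotient_algebra A I) = a_rcosets\<^bsub>A\<^esub> I"
  "\<one>\<^bsub>quotient_algebra A I\<^esub> = I +>\<^bsub>A\<^esub> \<one>\<^bsub>A\<^esub>"
  "\<zero>\<^bsub>quotient_algebra A I\<^esub> = I"
  "monoid.mult (quotient_algebra A I) = rcoset_mult A I"
  "add (quotient_algebra A I) = set_add A"
  "c \<odot>\<^bsub>quotient_algebra A I\<^esub> P = (\<Union>p\<in>P. I +>\<^bsub>A\<^esub> (c \<odot>\<^bsub>A\<^esub> p))"
  by (simp_all add: quotient_algebra_def FactRing_def)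

text \<open>
  Closure under additive inverses is automatic in the presence of a unit: \<open>- a = (- 1) a\<close>.
\<close>

lemma (in kalgebra) idealI_kalgebra:
  assumes "I \<subseteq> carrier A" "\<zero> \<in> I" "\<And>a b. a \<in> I \<Longrightarrow> b \<in> I \<Longrightarrow> a \<oplus> b \<in> I"
    and l: "\<And>a b. a \<in> I \<Longrightarrow> b \<in> carrier A \<Longrightarrow> b \<otimes> a \<in> I"
    and "\<And>a b. a \<in> I \<Longrightarrow> b \<in> carrier A \<Longrightarrow> a \<otimes> b \<in> I"
  shows "ideal I A"
proof (rule idealI[OF ring_axioms])
  show "subgroup I (add_monoid A)"
  proof
    fix a assume a: "a \<in> I"
    have "\<ominus> \<one> \<otimes> a = \<ominus> a" using a assms(1) by (auto simp: l_minus)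
    then show "inv\<^bsub>add_monoid A\<^esub> a \<in> I"
      using l[OF a, of "\<ominus> \<one>"] by (simp add: a_inv_def)
  qed (use assms in auto)
qed (use assms in auto)

locale kalgebra_ideal = kalgebra A + ideal I A for A :: "('k::field, 'a, 'm) module_scheme" (structure) and I
begin

lemma carrier_quotient: "carrier (quotient_algebra A I) = (\<lambda>a. I +> a) ` carrier A"
  by (auto simp: quotient_algebra_simps A_RCOSETS_def' a_r_coset_def')

lemma coset_mem: "p \<in> I +> a \<longleftrightarrow> (\<exists>i\<in>I. p = i \<oplus> a)"
  by (auto simp: a_r_coset_def')

lemma ideal_smult: 
  assumes "i \<in> I" shows "c \<odot> i \<in> I"
proof -
  have "(c \<odot> \<one>) \<otimes> i \<in> I" using assms by (intro I_l_closed) auto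
  then show ?thesis using assms by (simp add: smult_mult_left a_Hcarr)
qed

lemma coset_eq_iff:
  assumes "a \<in> carrier A" "b \<in> carrier A"
  shows "I +> a = I +> b \<longleftrightarrow> a \<ominus> b \<in> I"
  using quotient_eq_iff_same_a_r_cos[OF is_ideal assms] by auto

lemma coset_eqI:
  assumes "a \<in> carrier A" "i \<in> I" shows "I +> (i \<oplus> a) = I +> a"
proof -
  have "(i \<oplus> a) \<ominus> a = i"
    using assms a_Hcarr[OF assms(2)] by (simp add: a_minus_def a_assoc r_neg)
  then show ?thesis
    using assms a_Hcarr[OF assms(2)] by (subst coset_eq_iff) auto
qed

text \<open>
  Scalar multiplication in the quotient is a union over all representatives; this union consists of
  a single coset because an ideal of a unital algebra is a subspace.
\<close>

lemma coset_smult: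
  assumes "a \<in> carrier A"
  shows "c \<odot>\<^bsub>quotient_algebra A I\<^esub> (I +> a) = I +> (c \<odot> a)"
proof -
  have *: "I +> (c \<odot> p) = I +> (c \<odot> a)" if "p \<in> I +> a" for p
  proof -
    from that obtain i where "i \<in> I" "p = i \<oplus> a" by (auto simp: coset_mem)
    then show ?thesis
      using assms by (simp add: smult_r_distr a_Hcarr coset_eqI ideal_smult)
  qed
  show ?thesis
    unfolding quotient_algebra_simps
    by (intro UN_constant_eq[OF a_rcos_self[OF assms]] ballI *)
qed

lemma coset_add: 
  assumes "a \<in> carrier A" "b \<in> carrier A"
  shows "(I +> a) \<oplus>\<^bsub>quotient_algebra A I\<^esub> (I +> b) = I +> (a \<oplus> b)"
  using assms by (simp add: quotient_algebra_simps a_rcos_sum)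

lemma coset_mult: 
  assumes "a \<in> carrier A" "b \<in> carrier A"
  shows "(I +> a) \<otimes>\<^bsub>quotient_algebra A I\<^esub> (I +> b) = I +> (a \<otimes> b)"
  using assms by (simp add: quotient_algebra_simps rcoset_mult_add)

lemma coset_one: "\<one>\<^bsub>quotient_algebra A I\<^esub> = I +> \<one>"
  by (simp add: quotient_algebra_simps)

lemma quotient_kalgebra: "kalgebra (quotient_algebra A I)"
proof -
  interpret Q: ring "A Quot I" by (rule quotient_is_ring)
  have abg: "abelian_group (quotient_algebra A I)"
    unfolding quotient_algebra_def
    by (rule abelian_groupI) (auto simp: Q.a_ac intro: Q.add.l_inv_ex)
  have "Group.monoid (quotient_algebra A I)"
    by (rule Group.monoidI)
      (auto simp: carrier_quotient coset_mult coset_one m_assoc)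
  then have "ring (quotient_algebra A I)"
    by (rule ringI[OF abg])
      (auto simp: carrier_quotient coset_mult coset_add l_distr r_distr)
  then show ?thesis
    by (auto simp: kalgebra_def kalgebra_axioms_def carrier_quotient coset_smult coset_add coset_mult
        smult_l_distr smult_r_distr smult_smult smult_mult_left smult_mult_right)
qed

lemma coset_hom: "(\<lambda>a. I +> a) \<in> algebra_homs A (quotient_algebra A I)"
  by (intro algebra_homsI linear_mapsI)
    (auto simp: carrier_quotient coset_smult coset_add coset_mult coset_one)

context
  fixes B :: "('k, 'b, 'l) module_scheme" and f
  assumes B: "kalgebra B" and f: "f \<in> linear_maps A B" and vanish: "\<And>i. i \<in> I \<Longrightarrow> f i = \<zero>\<^bsub>B\<^esub>"
begin

lemma induced_map_coset:
  assumes "a \<in> carrier A" shows "induced_map f (I +> a) = f a"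
proof -
  interpret B: kalgebra B by (rule B)
  have *: "f p = f a" if "p \<in> I +> a" for p
  proof -
    from that obtain i where "i \<in> I" "p = i \<oplus> a" by (auto simp: coset_mem)
    then show ?thesis
      using assms by (simp add: linear_mapsD[OF f] a_Hcarr vanish)
  qed
  have "f ` (I +> a) \<subseteq> {f a}"
    by (rule image_subsetI, unfold singleton_iff, rule *)
  moreover have "f a \<in> f ` (I +> a)" using assms by (intro imageI a_rcos_self)
  ultimately have "f ` (I +> a) = {f a}" by blast
  then show ?thesis by (simp add: induced_map_def)
qed

lemma induced_map_linear: "induced_map f \<in> linear_maps (quotient_algebra A I) B"
  by (rule linear_mapsI)
    (auto simp: carrier_quotient coset_smult coset_add induced_map_coset linear_mapsD[OF f])

lemma induced_map_hom:
  assumes "f \<in> algebra_homs A B"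
  shows "induced_map f \<in> algebra_homs (quotient_algebra A I) B"
  by (rule algebra_homsI[OF induced_map_linear])
    (auto simp: carrier_quotient coset_mult induced_map_coset algebra_homsD[OF assms]
       coset_one)

end

end


section \<open>Tensor products\<close>

interpretation scale: vector_space "scale :: 'k::field \<Rightarrow> ('a \<Rightarrow>\<^sub>0 'k) \<Rightarrow> ('a \<Rightarrow>\<^sub>0 'k)"
  by unfold_locales (simp_all add: scale_add scale_add_left scale_scale)

locale kalgebra_pair = A: kalgebra A + B: kalgebra B
  for A :: "('k::field, 'a, 'm) module_scheme" and B :: "('k, 'b, 'l) module_scheme"
begin

abbreviation "R \<equiv> monoid_algebra (A \<times>\<times> B) :: ('k, 'a \<times> 'b \<Rightarrow>\<^sub>0 'k) module"

lemma product_monoid: "monoid (A \<times>\<times> B)"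
  by (intro DirProd_monoid A.monoid_axioms B.monoid_axioms)

sublocale R: kalgebra R
  by (intro monoid_algebra_kalgebra product_monoid)

lemma tensor_nullI:
  assumes "a \<in> carrier A" "b \<in> carrier B"
  shows "a' \<in> carrier A \<Longrightarrow> Poly_Mapping.single (a \<oplus>\<^bsub>A\<^esub> a', b) 1 - Poly_Mapping.single (a, b) 1
       - Poly_Mapping.single (a', b) 1 \<in> tensor_null A B"
    and "b' \<in> carrier B \<Longrightarrow> Poly_Mapping.single (a, b \<oplus>\<^bsub>B\<^esub> b') 1 - Poly_Mapping.single (a, b) 1
       - Poly_Mapping.single (a, b') 1 \<in> tensor_null A B"
    and "Poly_Mapping.single (c \<odot>\<^bsub>A\<^esub> a, b) 1 - Poly_Mapping.single (a, b) c \<in> tensor_null A B"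
    and "Poly_Mapping.single (a, c \<odot>\<^bsub>B\<^esub> b) 1 - Poly_Mapping.single (a, b) c \<in> tensor_null A B"
  unfolding tensor_null_def
  by (rule scale.span_base; use assms in \<open>auto simp: tensor_relations_def\<close>)+

lemma tensor_relations_cases [consumes 1, case_names add_left add_right smult_left smult_right]:
  assumes "p \<in> tensor_relations A B"
    and "\<And>a a' b. a \<in> carrier A \<Longrightarrow> a' \<in> carrier A \<Longrightarrow> b \<in> carrier B \<Longrightarrow>
      p = Poly_Mapping.single (a \<oplus>\<^bsub>A\<^esub> a', b) 1 - Poly_Mapping.single (a, b) 1 - Poly_Mapping.single (a', b) 1 \<Longrightarrow> P"
    and "\<And>a b b'. a \<in> carrier A \<Longrightarrow> b \<in> carrier B \<Longrightarrow> b' \<in> carrier B \<Longrightarrow>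
      p = Poly_Mapping.single (a, b \<oplus>\<^bsub>B\<^esub> b') 1 - Poly_Mapping.single (a, b) 1 - Poly_Mapping.single (a, b') 1 \<Longrightarrow> P"
    and "\<And>c a b. a \<in> carrier A \<Longrightarrow> b \<in> carrier B \<Longrightarrow>
      p = Poly_Mapping.single (c \<odot>\<^bsub>A\<^esub> a, b) 1 - Poly_Mapping.single (a, b) c \<Longrightarrow> P"
    and "\<And>c a b. a \<in> carrier A \<Longrightarrow> b \<in> carrier B \<Longrightarrow>
      p = Poly_Mapping.single (a, c \<odot>\<^bsub>B\<^esub> b) 1 - Poly_Mapping.single (a, b) c \<Longrightarrow> P"
  shows P
  using assms(1) unfolding tensor_relations_def by (auto elim: assms(2-5))

lemma tensor_null_add: "p \<in> tensor_null A B \<Longrightarrow> r \<in> tensor_null A B \<Longrightarrow> p + r \<in> tensor_null A B"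
  unfolding tensor_null_def by (rule scale.span_add)

lemma tensor_null_scale: "p \<in> tensor_null A B \<Longrightarrow> scale c p \<in> tensor_null A B"
  unfolding tensor_null_def by (rule scale.span_scale)

lemma tensor_null_zero: "0 \<in> tensor_null A B"
  unfolding tensor_null_def by (rule scale.span_zero)

lemma tensor_null_induct [consumes 1, case_names zero relation add scale]:
  assumes "p \<in> tensor_null A B" "P 0" "\<And>p. p \<in> tensor_relations A B \<Longrightarrow> P p"
    "\<And>p r. P p \<Longrightarrow> P r \<Longrightarrow> P (p + r)" "\<And>c p. P p \<Longrightarrow> P (scale c p)"
  shows "P p"
  using assms(1) unfolding tensor_null_def
  by (rule scale.span_induct) (use assms in \<open>auto simp: scale.subspace_def\<close>)

lemma keys_diff_subset:
  "Poly_Mapping.keys p \<subseteq> S \<Longrightarrow> Poly_Mapping.keys r \<subseteq> S \<Longrightarrow> Poly_Mapping.keys (p - r) \<subseteq> S"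
  for p r :: "'c \<Rightarrow>\<^sub>0 'k"
  using keys_add_subset[of p S "scale (-1) r"] keys_scale_subset[of r S "-1"]
  by (simp add: scale_minus_one)

lemma tensor_null_carrier: "p \<in> tensor_null A B \<Longrightarrow> Poly_Mapping.keys p \<subseteq> carrier A \<times> carrier B"
proof (induction p rule: tensor_null_induct)
  case (relation p)
  then show ?case
    by (cases rule: tensor_relations_cases)
      (simp_all add: keys_diff_subset keys_single_subset)
qed (simp_all add: keys_add_subset keys_scale_subset)

text \<open>
  The null space of the tensor product is an ideal because the product of a basis element \<open>(u, v)\<close>
  with a bilinearity relation is again a bilinearity relation, up to a scalar.
\<close>

lemma tensor_null_mult_left:
  assumes "p \<in> tensor_null A B" "Poly_Mapping.keys r \<subseteq> carrier A \<times> carrier B"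
  shows "r \<otimes>\<^bsub>R\<^esub> p \<in> tensor_null A B"
  using assms(2)
proof (induction r rule: poly_mapping_on_induct)
  case (single uv d)
  obtain u v where uv: "uv = (u, v)" "u \<in> carrier A" "v \<in> carrier B" using single by auto
  have s: "Poly_Mapping.single y d = scale d (Poly_Mapping.single y 1)" for y :: "'a \<times> 'b" by simp
  have s': "Poly_Mapping.single y (d * c) = scale d (Poly_Mapping.single y c)" for c and y :: "'a \<times> 'b" by simp
  have "Poly_Mapping.keys p \<subseteq> carrier A \<times> carrier B \<and> Poly_Mapping.single uv d \<otimes>\<^bsub>R\<^esub> p \<in> tensor_null A B"
    using assms(1)
  proof (induction p rule: tensor_null_induct)
    case (relation p)
    then have "p \<in> tensor_null A B" unfolding tensor_null_def by (rule scale.span_base)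
    moreover have "Poly_Mapping.single uv d \<otimes>\<^bsub>R\<^esub> p \<in> tensor_null A B"
      using relation uv(2,3)
      by (cases rule: tensor_relations_cases;
          simp add: uv(1) monoid_algebra_diff_right A.r_distr B.r_distr A.smult_mult_right B.smult_mult_right;
          unfold s s'; unfold scale_diff[symmetric];
          intro tensor_null_scale tensor_nullI; simp)
    ultimately show ?case by (simp add: tensor_null_carrier)
  next
    case (scale c p)
    then show ?case
      using single
      by (auto simp: keys_scale_subset tensor_null_scale
          monoid_algebra_scale_right[of _ "A \<times>\<times> B", simplified])
  qed (auto simp: tensor_null_zero monoid_algebra_add_right keys_add_subset tensor_null_add)
  then show ?case ..
qed (auto simp: monoid_algebra_add_left tensor_null_add tensor_null_zero)

lemma tensor_null_mult_right:
  assumes "p \<in> tensor_null A B" "Poly_Mapping.keys r \<subseteq> carrier A \<times> carrier B"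
  shows "p \<otimes>\<^bsub>R\<^esub> r \<in> tensor_null A B"
  using assms(2)
proof (induction r rule: poly_mapping_on_induct)
  case (single uv d)
  obtain u v where uv: "uv = (u, v)" "u \<in> carrier A" "v \<in> carrier B" using single by auto
  have s: "Poly_Mapping.single y d = scale d (Poly_Mapping.single y 1)" for y :: "'a \<times> 'b" by simp
  have s': "Poly_Mapping.single y (c * d) = scale d (Poly_Mapping.single y c)" for c and y :: "'a \<times> 'b" 
    by (simp add: mult.commute[of c d])
  have "Poly_Mapping.keys p \<subseteq> carrier A \<times> carrier B \<and> p \<otimes>\<^bsub>R\<^esub> Poly_Mapping.single uv d \<in> tensor_null A B"
    using assms(1)
  proof (induction p rule: tensor_null_induct)
    case (relation p)
    then have "p \<in> tensor_null A B" unfolding tensor_null_def by (rule scale.span_base)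
    moreover have "p \<otimes>\<^bsub>R\<^esub> Poly_Mapping.single uv d \<in> tensor_null A B"
      using relation uv(2,3)
      by (cases rule: tensor_relations_cases;
          simp add: uv(1) monoid_algebra_diff_left A.l_distr B.l_distr A.smult_mult_left B.smult_mult_left;
          unfold s s'; unfold scale_diff[symmetric];
          intro tensor_null_scale tensor_nullI; simp)
    ultimately show ?case by (simp add: tensor_null_carrier)
  next
    case (scale c p)
    then show ?case
      using single
      by (auto simp: keys_scale_subset tensor_null_scale
          monoid_algebra_scale_left[of _ "A \<times>\<times> B", simplified])
  qed (auto simp: tensor_null_zero monoid_algebra_add_left keys_add_subset tensor_null_add)
  then show ?case ..
qed (auto simp: monoid_algebra_add_right tensor_null_add tensor_null_zero)

sublocale N: kalgebra_ideal R "tensor_null A B"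
proof -
  have "ideal (tensor_null A B) R"
    by (rule R.idealI_kalgebra)
      (auto simp: tensor_null_zero tensor_null_add tensor_null_mult_left tensor_null_mult_right
        dest!: tensor_null_carrier)
  then show "kalgebra_ideal R (tensor_null A B)"
    by (simp add: kalgebra_ideal_def R.is_kalgebra)
qed

lemma tensor_kalgebra: "kalgebra (tensor_algebra A B)"
  unfolding tensor_algebra_def by (rule N.quotient_kalgebra)

lemma single_carrier: "a \<in> carrier A \<Longrightarrow> b \<in> carrier B \<Longrightarrow> Poly_Mapping.single (a, b) c \<in> carrier R"
  by simp

lemma pure_tensor_closed [simp]:
  "a \<in> carrier A \<Longrightarrow> b \<in> carrier B \<Longrightarrow> pure_tensor A B a b \<in> carrier (tensor_algebra A B)"
  unfolding tensor_algebra_def pure_tensor_def N.carrier_quotient by (intro imageI single_carrier)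

lemma pure_tensor_mult:
  assumes "a \<in> carrier A" "b \<in> carrier B" "a' \<in> carrier A" "b' \<in> carrier B"
  shows "pure_tensor A B a b \<otimes>\<^bsub>tensor_algebra A B\<^esub> pure_tensor A B a' b'
    = pure_tensor A B (a \<otimes>\<^bsub>A\<^esub> a') (b \<otimes>\<^bsub>B\<^esub> b')"
  unfolding tensor_algebra_def pure_tensor_def
  by (subst N.coset_mult) (use assms in simp_all)

lemma pure_tensor_one: "\<one>\<^bsub>tensor_algebra A B\<^esub> = pure_tensor A B \<one>\<^bsub>A\<^esub> \<one>\<^bsub>B\<^esub>"
  by (simp add: tensor_algebra_def pure_tensor_def N.coset_one)

lemma minus_R: assumes "p \<in> carrier R" "r \<in> carrier R" shows "p \<ominus>\<^bsub>R\<^esub> r = p - r"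
  using R.smult_minus_one[OF assms(2)] by (simp add: a_minus_def scale_minus_one)

lemma pure_tensor_add_left:
  assumes "a \<in> carrier A" "b \<in> carrier B" "a' \<in> carrier A"
  shows "pure_tensor A B (a \<oplus>\<^bsub>A\<^esub> a') b = pure_tensor A B a b \<oplus>\<^bsub>tensor_algebra A B\<^esub> pure_tensor A B a' b"
proof -
  have "tensor_null A B +>\<^bsub>R\<^esub> Poly_Mapping.single (a \<oplus>\<^bsub>A\<^esub> a', b) 1
      = tensor_null A B +>\<^bsub>R\<^esub> (Poly_Mapping.single (a, b) 1 + Poly_Mapping.single (a', b) 1)"
    using tensor_nullI(1)[OF assms] assms
    by (subst N.coset_eq_iff; (subst minus_R)?; simp add: keys_add_subset keys_single_subset diff_diff_add)
  also have "\<dots> = (tensor_null A B +>\<^bsub>R\<^esub> Poly_Mapping.single (a, b) 1)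
      \<oplus>\<^bsub>quotient_algebra R (tensor_null A B)\<^esub> (tensor_null A B +>\<^bsub>R\<^esub> Poly_Mapping.single (a', b) 1)"
    using assms by (subst N.coset_add) simp_all
  finally show ?thesis unfolding tensor_algebra_def pure_tensor_def .
qed

lemma pure_tensor_add_right:
  assumes "a \<in> carrier A" "b \<in> carrier B" "b' \<in> carrier B"
  shows "pure_tensor A B a (b \<oplus>\<^bsub>B\<^esub> b') = pure_tensor A B a b \<oplus>\<^bsub>tensor_algebra A B\<^esub> pure_tensor A B a b'"
proof -
  have "tensor_null A B +>\<^bsub>R\<^esub> Poly_Mapping.single (a, b \<oplus>\<^bsub>B\<^esub> b') 1
      = tensor_null A B +>\<^bsub>R\<^esub> (Poly_Mapping.single (a, b) 1 + Poly_Mapping.single (a, b') 1)"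
    using tensor_nullI(2)[OF assms] assms
    by (subst N.coset_eq_iff; (subst minus_R)?; simp add: keys_add_subset keys_single_subset diff_diff_add)
  also have "\<dots> = (tensor_null A B +>\<^bsub>R\<^esub> Poly_Mapping.single (a, b) 1)
      \<oplus>\<^bsub>quotient_algebra R (tensor_null A B)\<^esub> (tensor_null A B +>\<^bsub>R\<^esub> Poly_Mapping.single (a, b') 1)"
    using assms by (subst N.coset_add) simp_all
  finally show ?thesis unfolding tensor_algebra_def pure_tensor_def .
qed

lemma pure_tensor_smult_left:
  assumes "a \<in> carrier A" "b \<in> carrier B"
  shows "pure_tensor A B (c \<odot>\<^bsub>A\<^esub> a) b = c \<odot>\<^bsub>tensor_algebra A B\<^esub> pure_tensor A B a b"
proof -
  have "tensor_null A B +>\<^bsub>R\<^esub> Poly_Mapping.single (c \<odot>\<^bsub>A\<^esub> a, b) 1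
      = tensor_null A B +>\<^bsub>R\<^esub> Poly_Mapping.single (a, b) c"
    using tensor_nullI(3)[OF assms] assms
    by (subst N.coset_eq_iff; (subst minus_R)?; simp add: keys_single_subset)
  also have "\<dots> = c \<odot>\<^bsub>quotient_algebra R (tensor_null A B)\<^esub> (tensor_null A B +>\<^bsub>R\<^esub> Poly_Mapping.single (a, b) 1)"
    using assms by (subst N.coset_smult) simp_all
  finally show ?thesis unfolding tensor_algebra_def pure_tensor_def .
qed

lemma pure_tensor_smult_right:
  assumes "a \<in> carrier A" "b \<in> carrier B"
  shows "pure_tensor A B a (c \<odot>\<^bsub>B\<^esub> b) = c \<odot>\<^bsub>tensor_algebra A B\<^esub> pure_tensor A B a b"
proof -
  have "tensor_null A B +>\<^bsub>R\<^esub> Poly_Mapping.single (a, c \<odot>\<^bsub>B\<^esub> b) 1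
      = tensor_null A B +>\<^bsub>R\<^esub> Poly_Mapping.single (a, b) c"
    using tensor_nullI(4)[OF assms] assms
    by (subst N.coset_eq_iff; (subst minus_R)?; simp add: keys_single_subset)
  also have "\<dots> = c \<odot>\<^bsub>quotient_algebra R (tensor_null A B)\<^esub> (tensor_null A B +>\<^bsub>R\<^esub> Poly_Mapping.single (a, b) 1)"
    using assms by (subst N.coset_smult) simp_all
  finally show ?thesis unfolding tensor_algebra_def pure_tensor_def .
qed

lemma pure_tensor_zero:
  shows "b \<in> carrier B \<Longrightarrow> pure_tensor A B \<zero>\<^bsub>A\<^esub> b = \<zero>\<^bsub>tensor_algebra A B\<^esub>"
    and "a \<in> carrier A \<Longrightarrow> pure_tensor A B a \<zero>\<^bsub>B\<^esub> = \<zero>\<^bsub>tensor_algebra A B\<^esub>"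
proof -
  interpret T: kalgebra "tensor_algebra A B" by (rule tensor_kalgebra)
  show "b \<in> carrier B \<Longrightarrow> pure_tensor A B \<zero>\<^bsub>A\<^esub> b = \<zero>\<^bsub>tensor_algebra A B\<^esub>"
    using pure_tensor_smult_left[of "\<zero>\<^bsub>A\<^esub>" b 0] by simp
  show "a \<in> carrier A \<Longrightarrow> pure_tensor A B a \<zero>\<^bsub>B\<^esub> = \<zero>\<^bsub>tensor_algebra A B\<^esub>"
    using pure_tensor_smult_right[of a "\<zero>\<^bsub>B\<^esub>" 0] by simp
qed

definition bilinear_to :: "('k, 'c, 'n) module_scheme \<Rightarrow> ('a \<Rightarrow> 'b \<Rightarrow> 'c) \<Rightarrow> bool"
  where "bilinear_to C \<beta> \<longleftrightarrow>
    (\<forall>b\<in>carrier B. (\<lambda>a. \<beta> a b) \<in> linear_maps A C) \<and> (\<forall>a\<in>carrier A. \<beta> a \<in> linear_maps B C)"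

context
  fixes C :: "('k, 'c, 'n) module_scheme" and \<beta>
  assumes C: "kalgebra C" and \<beta>: "bilinear_to C \<beta>"
begin

interpretation C: kalgebra C by (rule C)

lemma \<beta>_closed: "a \<in> carrier A \<Longrightarrow> b \<in> carrier B \<Longrightarrow> \<beta> a b \<in> carrier C"
  using \<beta> by (auto simp: bilinear_to_def linear_maps_def)

lemma \<beta>_fun: "(\<lambda>(a, b). \<beta> a b) \<in> carrier A \<times> carrier B \<rightarrow> carrier C"
  by (auto simp: \<beta>_closed)

lemma extension_single:
  "a \<in> carrier A \<Longrightarrow> b \<in> carrier B \<Longrightarrow>
    linear_extension C (\<lambda>(a, b). \<beta> a b) (Poly_Mapping.single (a, b) c) = c \<odot>\<^bsub>C\<^esub> \<beta> a b"
  by (subst C.linear_extension_single) (auto simp: \<beta>_closed)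

lemma extension_linear: "linear_extension C (\<lambda>(a, b). \<beta> a b) \<in> linear_maps R C"
  using \<beta>_fun
  by (intro linear_mapsI)
   (auto simp: C.linear_extension_add[OF _ _ \<beta>_fun] C.linear_extension_scale[OF _ \<beta>_fun]
     C.linear_extension_closed[OF _ \<beta>_fun])

text \<open>
  The bilinearity of \<open>\<beta>\<close> is precisely the statement that its linear extension kills the relations
  spanning the null space.
\<close>

lemma extension_null:
  "p \<in> tensor_null A B \<Longrightarrow> linear_extension C (\<lambda>(a, b). \<beta> a b) p = \<zero>\<^bsub>C\<^esub>"
proof -
  let ?L = "linear_extension C (\<lambda>(a, b). \<beta> a b)"
  assume "p \<in> tensor_null A B"
  then have "p \<in> tensor_null A B \<and> ?L p = \<zero>\<^bsub>C\<^esub>"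
  proof (induction p rule: tensor_null_induct)
    case (relation p)
    have minus: "?L (p - r) = ?L p \<ominus>\<^bsub>C\<^esub> ?L r"
      if "Poly_Mapping.keys p \<subseteq> carrier A \<times> carrier B" "Poly_Mapping.keys r \<subseteq> carrier A \<times> carrier B" for p r
      using that by (rule C.linear_extension_minus[OF _ _ \<beta>_fun])
    have *: "x \<oplus>\<^bsub>C\<^esub> y \<oplus>\<^bsub>C\<^esub> \<ominus>\<^bsub>C\<^esub> x \<oplus>\<^bsub>C\<^esub> \<ominus>\<^bsub>C\<^esub> y = \<zero>\<^bsub>C\<^esub>" if "x \<in> carrier C" "y \<in> carrier C" for x y
      using that by (simp add: C.add.m_comm[of x y] C.a_assoc C.r_neg C.r_neg2)
    have "?L p = \<zero>\<^bsub>C\<^esub>"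
      using relation
      apply (cases rule: tensor_relations_cases)
      using \<beta> unfolding bilinear_to_def 
      by (simp_all add: minus keys_diff_subset keys_single_subset extension_single \<beta>_closed *
          linear_mapsD[where A = A and B = C and f = "\<lambda>a. \<beta> a b" for b] C.minus_eq C.r_neg
          linear_mapsD[where A = B and B = C and f = "\<beta> a" for a])
    then show ?case using relation by (simp add: tensor_null_def scale.span_base)
  next
    case (add p r)
    then show ?case
      by (simp add: tensor_null_add linear_mapsD[OF extension_linear, simplified] tensor_null_carrier)
  next
    case (scale c p)
    then show ?case
      by (simp add: tensor_null_scale linear_mapsD[OF extension_linear, simplified] tensor_null_carrier)
  qed (simp add: tensor_null_zero)
  then show ?thesis ..
qed

lemma tensor_lift_linear:
  "induced_map (linear_extension C (\<lambda>(a, b). \<beta> a b)) \<in> linear_maps (tensor_algebra A B) C"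
  unfolding tensor_algebra_def
  by (rule N.induced_map_linear[OF C extension_linear extension_null])

lemma tensor_lift_pure:
  "a \<in> carrier A \<Longrightarrow> b \<in> carrier B \<Longrightarrow>
    induced_map (linear_extension C (\<lambda>(a, b). \<beta> a b)) (pure_tensor A B a b) = \<beta> a b"
  unfolding pure_tensor_def
  by (subst N.induced_map_coset[OF C extension_linear extension_null])
    (auto simp: extension_single \<beta>_closed)

lemma tensor_lift_hom:
  assumes "\<beta> \<one>\<^bsub>A\<^esub> \<one>\<^bsub>B\<^esub> = \<one>\<^bsub>C\<^esub>"
    and "\<And>a b a' b'. a \<in> carrier A \<Longrightarrow> b \<in> carrier B \<Longrightarrow> a' \<in> carrier A \<Longrightarrow> b' \<in> carrier B \<Longrightarrow>
      \<beta> (a \<otimes>\<^bsub>A\<^esub> a') (b \<otimes>\<^bsub>B\<^esub> b') = \<beta> a b \<otimes>\<^bsub>C\<^esub> \<beta> a' b'"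
  shows "induced_map (linear_extension C (\<lambda>(a, b). \<beta> a b)) \<in> algebra_homs (tensor_algebra A B) C"
  unfolding tensor_algebra_def
  by (rule N.induced_map_hom[OF C extension_linear extension_null], assumption,
      rule linear_extension_algebra_hom[OF product_monoid C])
    (use \<beta>_fun assms in auto)

end

end

lemma tensor_map_hom:
  assumes "kalgebra A" "kalgebra B" "kalgebra C" "kalgebra D"
    and f: "f \<in> algebra_homs A C" and g: "g \<in> algebra_homs B D"
  shows "tensor_map C D f g \<in> algebra_homs (tensor_algebra A B) (tensor_algebra C D)"
    and "a \<in> carrier A \<Longrightarrow> b \<in> carrier B \<Longrightarrow>
      tensor_map C D f g (pure_tensor A B a b) = pure_tensor C D (f a) (g b)"
proof -
  interpret S: kalgebra_pair A B using assms by (simp add: kalgebra_pair_def)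
  interpret T: kalgebra_pair C D using assms by (simp add: kalgebra_pair_def)
  have b: "S.bilinear_to (tensor_algebra C D) (\<lambda>a b. pure_tensor C D (f a) (g b))"
    unfolding S.bilinear_to_def using f g
    by (auto intro!: linear_mapsI simp: algebra_homsD[OF f] algebra_homsD[OF g]
        T.pure_tensor_add_left T.pure_tensor_add_right T.pure_tensor_smult_left T.pure_tensor_smult_right)
  show "tensor_map C D f g \<in> algebra_homs (tensor_algebra A B) (tensor_algebra C D)"
    unfolding tensor_map_def
    by (rule S.tensor_lift_hom[OF T.tensor_kalgebra b])
      (auto simp: T.pure_tensor_mult algebra_homsD[OF f] algebra_homsD[OF g] T.pure_tensor_one)
  show "a \<in> carrier A \<Longrightarrow> b \<in> carrier B \<Longrightarrow>
      tensor_map C D f g (pure_tensor A B a b) = pure_tensor C D (f a) (g b)"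
    unfolding tensor_map_def
    by (rule S.tensor_lift_pure[OF T.tensor_kalgebra b])
qed

text \<open>
  Functionals on a tensor product are how coefficients of a comultiplication are read off: no basis of
  the tensor product has to be exhibited.
\<close>

definition tensor_functional :: "('a \<Rightarrow> 'k::field) \<Rightarrow> ('b \<Rightarrow> 'k) \<Rightarrow> ('a \<times> 'b \<Rightarrow>\<^sub>0 'k) set \<Rightarrow> 'k"
  where "tensor_functional \<phi> \<psi> = induced_map (linear_extension ground_algebra (\<lambda>(a, b). \<phi> a * \<psi> b))"

lemma tensor_functional:
  assumes "kalgebra A" "kalgebra B"
    and f: "\<phi> \<in> linear_maps A ground_algebra" and g: "\<psi> \<in> linear_maps B ground_algebra"
  shows "tensor_functional \<phi> \<psi> \<in> linear_maps (tensor_algebra A B) ground_algebra"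
    and "a \<in> carrier A \<Longrightarrow> b \<in> carrier B \<Longrightarrow> tensor_functional \<phi> \<psi> (pure_tensor A B a b) = \<phi> a * \<psi> b"
proof -
  interpret S: kalgebra_pair A B using assms by (simp add: kalgebra_pair_def)
  have b: "S.bilinear_to ground_algebra (\<lambda>a b. \<phi> a * \<psi> b)"
    unfolding S.bilinear_to_def using f g
    by (auto intro!: linear_mapsI simp: linear_mapsD[OF f] linear_mapsD[OF g] algebra_simps)
  show "tensor_functional \<phi> \<psi> \<in> linear_maps (tensor_algebra A B) ground_algebra"
    unfolding tensor_functional_def
    by (rule S.tensor_lift_linear[OF ground_algebra_kalgebra b])
  show "a \<in> carrier A \<Longrightarrow> b \<in> carrier B \<Longrightarrow> tensor_functional \<phi> \<psi> (pure_tensor A B a b) = \<phi> a * \<psi> b"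
    unfolding tensor_functional_def
    by (rule S.tensor_lift_pure[OF ground_algebra_kalgebra b])
qed


section \<open>The free algebra\<close>

abbreviation free_monoid :: "gen list monoid"
  where "free_monoid \<equiv> \<lparr>carrier = UNIV, monoid.mult = (@), one = []\<rparr>"

lemma free_monoid: "monoid free_monoid"
  by (rule Group.monoidI) auto

lemma free_algebra_kalgebra: "kalgebra free_algebra"
  unfolding free_algebra_def by (rule monoid_algebra_kalgebra[OF free_monoid])

lemma free_algebra_simps [simp]:
  "carrier free_algebra = UNIV" "\<one>\<^bsub>free_algebra\<^esub> = Poly_Mapping.single [] 1" "\<zero>\<^bsub>free_algebra\<^esub> = 0"
  "add free_algebra = (+)" "module.smult free_algebra = scale"
  "Poly_Mapping.single u c \<otimes>\<^bsub>free_algebra\<^esub> Poly_Mapping.single w d = Poly_Mapping.single (u @ w) (c * d)"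
  by (simp_all add: free_algebra_def)

lemma free_algebra_add_left: "(p + p') \<otimes>\<^bsub>free_algebra\<^esub> r = p \<otimes>\<^bsub>free_algebra\<^esub> r + p' \<otimes>\<^bsub>free_algebra\<^esub> r"
  and free_algebra_add_right: "r \<otimes>\<^bsub>free_algebra\<^esub> (p + p') = r \<otimes>\<^bsub>free_algebra\<^esub> p + r \<otimes>\<^bsub>free_algebra\<^esub> p'"
  by (simp_all add: free_algebra_def monoid_algebra_add_left monoid_algebra_add_right)

lemma free_algebra_mult_zero [simp]: "0 \<otimes>\<^bsub>free_algebra\<^esub> r = 0" "r \<otimes>\<^bsub>free_algebra\<^esub> 0 = 0"
  by (simp_all add: free_algebra_def)

lemma free_induct [case_names zero single add]:
  fixes p :: "'a \<Rightarrow>\<^sub>0 'k::field"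
  assumes "P 0" "\<And>w c. P (Poly_Mapping.single w c)" "\<And>p r. P p \<Longrightarrow> P r \<Longrightarrow> P (p + r)"
  shows "P p"
  by (rule poly_mapping_on_induct[of p UNIV]) (use assms in auto)

lemma word_prod_simps [simp]:
  "word_prod M \<phi> [] = \<one>\<^bsub>M\<^esub>" "word_prod M \<phi> (y # w) = \<phi> y \<otimes>\<^bsub>M\<^esub> word_prod M \<phi> w"
  by (simp_all add: word_prod_def)

context kalgebra
begin

lemma word_prod_closed [simp]:
  assumes "\<And>y. \<phi> y \<in> carrier A" shows "word_prod A \<phi> w \<in> carrier A"
  by (induction w) (use assms in auto)

lemma word_prod_append:
  assumes "\<And>y. \<phi> y \<in> carrier A"
  shows "word_prod A \<phi> (u @ w) = word_prod A \<phi> u \<otimes> word_prod A \<phi> w"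
  by (induction u) (use assms in \<open>auto simp: m_assoc\<close>)

lemma free_hom_single:
  assumes "\<And>y. \<phi> y \<in> carrier A"
  shows "free_hom A \<phi> (Poly_Mapping.single w c) = c \<odot> word_prod A \<phi> w"
  unfolding free_hom_def by (subst linear_extension_single) (use assms in auto)

lemma free_hom_gen:
  assumes "\<And>y. \<phi> y \<in> carrier A"
  shows "free_hom A \<phi> (free_gen y) = \<phi> y"
  unfolding free_gen_def by (subst free_hom_single) (use assms in auto)

lemma free_hom_hom:
  assumes "\<And>y. \<phi> y \<in> carrier A"
  shows "free_hom A \<phi> \<in> algebra_homs free_algebra A"
  unfolding free_hom_def free_algebra_def
  by (rule linear_extension_algebra_hom[OF free_monoid is_kalgebra])
    (use assms in \<open>auto simp: word_prod_append\<close>)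

lemma free_hom_unique:
  assumes f: "f \<in> algebra_homs free_algebra A"
  shows "f p = free_hom A (\<lambda>y. f (free_gen y)) p"
proof -
  have c: "f (free_gen y) \<in> carrier A" for y by (simp add: algebra_homsD[OF f])
  note F = free_hom_hom[OF c]
  have w: "f (Poly_Mapping.single w 1) = word_prod A (\<lambda>y. f (free_gen y)) w" for w
  proof (induction w)
    case Nil
    then show ?case using algebra_homsD(2)[OF f] by simp
  next
    case (Cons y w)
    have "Poly_Mapping.single (y # w) (1::'k) = free_gen y \<otimes>\<^bsub>free_algebra\<^esub> Poly_Mapping.single w 1"
      by (simp add: free_gen_def)
    then show ?case using Cons by (simp add: algebra_homsD(3)[OF f])
  qed
  show ?thesis
  proof (induction p rule: free_induct)
    case zero
    show ?case
      using linear_maps_zero[OF free_algebra_kalgebra is_kalgebra algebra_homsD(1)[OF f]]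
        linear_maps_zero[OF free_algebra_kalgebra is_kalgebra algebra_homsD(1)[OF F]] by simp
  next
    case (single u d)
    have "Poly_Mapping.single u d = d \<odot>\<^bsub>free_algebra\<^esub> Poly_Mapping.single u 1" by simp
    then have "f (Poly_Mapping.single u d) = d \<odot> f (Poly_Mapping.single u 1)"
      by (metis algebra_homsD(6)[OF f] UNIV_I free_algebra_simps(1))
    then show ?case by (simp add: w free_hom_single c)
  next
    case (add p r)
    then show ?case
      using algebra_homsD(5)[OF f, of p r] algebra_homsD(5)[OF F, of p r] by simp
  qed
qed

end

lemma free_antihom_eq: 
  assumes "kalgebra A" "\<And>y. \<phi> y \<in> carrier A"
  shows "free_antihom A \<phi> = free_hom (opposite A) \<phi>"
proof -
  interpret kalgebra A by fact
  have "word_prod A \<phi> (rev w) = word_prod (opposite A) \<phi> w" for w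
    by (induction w) (use assms in \<open>auto simp: word_prod_append\<close>)
  then show ?thesis
    by (auto simp: free_antihom_def free_hom_def linear_extension_def fun_eq_iff)
qed

section \<open>The presented algebra and its universal property\<close>

definition satisfies_T_relations ::
    "('k::field, 'a, 'l) module_scheme \<Rightarrow> nat \<Rightarrow> nat \<Rightarrow> 'k \<Rightarrow> 'k \<Rightarrow> (gen \<Rightarrow> 'a) \<Rightarrow> bool"
  where "satisfies_T_relations B m n q \<omega> \<phi> \<longleftrightarrow>
    (\<forall>y. \<phi> y \<in> carrier B) \<and>
    \<phi> gen_g [^]\<^bsub>B\<^esub> n = \<one>\<^bsub>B\<^esub> \<and> \<phi> gen_h [^]\<^bsub>B\<^esub> m = \<one>\<^bsub>B\<^esub> \<and> \<phi> gen_x [^]\<^bsub>B\<^esub> m = \<zero>\<^bsub>B\<^esub> \<and>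
    \<phi> gen_x \<otimes>\<^bsub>B\<^esub> \<phi> gen_h = q \<odot>\<^bsub>B\<^esub> (\<phi> gen_h \<otimes>\<^bsub>B\<^esub> \<phi> gen_x) \<and>
    \<phi> gen_h \<otimes>\<^bsub>B\<^esub> \<phi> gen_g = \<phi> gen_g \<otimes>\<^bsub>B\<^esub> \<phi> gen_h \<and>
    \<phi> gen_g \<otimes>\<^bsub>B\<^esub> \<phi> gen_x = \<omega> \<odot>\<^bsub>B\<^esub> (\<phi> gen_x \<otimes>\<^bsub>B\<^esub> \<phi> gen_g)"

interpretation F: kalgebra free_algebra by (rule free_algebra_kalgebra)

text \<open>
  Translates the relations, which are elements of the free algebra, into equations in \<open>B\<close>.
\<close>

lemma T_relations_vanish:
  fixes f :: "(gen list \<Rightarrow>\<^sub>0 'k::field) \<Rightarrow> 'a"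
  assumes B: "kalgebra B" and f: "f \<in> algebra_homs free_algebra B"
  shows "(\<forall>p\<in>T_relations m n q \<omega>. f p = \<zero>\<^bsub>B\<^esub>) \<longleftrightarrow> satisfies_T_relations B m n q \<omega> (\<lambda>y. f (free_gen y))"
proof -
  interpret B: kalgebra B by fact
  note fD = algebra_homsD[OF f, simplified]
  have c: "f p \<in> carrier B" for p by (simp add: fD)
  have minus: "f (p - r) = \<zero>\<^bsub>B\<^esub> \<longleftrightarrow> f p = f r" for p r
  proof -
    have "f (p - r) \<oplus>\<^bsub>B\<^esub> f r = f p" using fD(5)[of "p - r" r] by simp
    then show ?thesis
      by (metis B.add.r_cancel_one' B.l_zero c)
  qed
  have mult: "f (p \<otimes>\<^bsub>free_algebra\<^esub> r) = f p \<otimes>\<^bsub>B\<^esub> f r" for p r by (simp add: fD)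
  have pow: "f (p [^]\<^bsub>free_algebra\<^esub> (k::nat)) = f p [^]\<^bsub>B\<^esub> k" for p k
    using algebra_homs_pow[OF free_algebra_kalgebra f] by simp
  show ?thesis
    unfolding T_relations_def satisfies_T_relations_def Let_def
    by (simp only: ball_simps minus mult pow c fD(2) fD(6)[where ?c = q] fD(6)[where ?c = \<omega>]
        free_algebra_simps(2) free_algebra_simps(5) simp_thms)
qed

definition T_proj :: "nat \<Rightarrow> nat \<Rightarrow> 'k::field \<Rightarrow> 'k \<Rightarrow> (gen list \<Rightarrow>\<^sub>0 'k) \<Rightarrow> (gen list \<Rightarrow>\<^sub>0 'k) set"
  where "T_proj m n q \<omega> p = T_ideal m n q \<omega> +>\<^bsub>free_algebra\<^esub> p"

lemma T_ideal: "kalgebra_ideal free_algebra (T_ideal m n q \<omega>)"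
  unfolding kalgebra_ideal_def T_ideal_def
  by (intro conjI free_algebra_kalgebra F.genideal_ideal) simp

lemma T_algebra_kalgebra: "kalgebra (T_algebra m n q \<omega>)"
  unfolding T_algebra_def by (rule kalgebra_ideal.quotient_kalgebra[OF T_ideal])

lemma T_proj_hom: "T_proj m n q \<omega> \<in> algebra_homs free_algebra (T_algebra m n q \<omega>)"
  unfolding T_proj_def[abs_def] T_algebra_def by (rule kalgebra_ideal.coset_hom[OF T_ideal])

lemma T_carrier: "carrier (T_algebra m n q \<omega>) = range (T_proj m n q \<omega>)"
  unfolding T_proj_def[abs_def] T_algebra_def by (subst kalgebra_ideal.carrier_quotient[OF T_ideal]) simp

lemma T_gen_proj: "T_gen m n q \<omega> y = T_proj m n q \<omega> (free_gen y)"
  by (simp add: T_gen_def T_proj_def)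

lemma T_gen_relations: "satisfies_T_relations (T_algebra m n q \<omega>) m n q \<omega> (T_gen m n q \<omega>)"
proof -
  interpret I: kalgebra_ideal free_algebra "T_ideal m n q \<omega>" by (rule T_ideal)
  have "T_proj m n q \<omega> p = \<zero>\<^bsub>T_algebra m n q \<omega>\<^esub>" if "p \<in> T_relations m n q \<omega>" for p
  proof -
    have "p \<in> T_ideal m n q \<omega>"
      unfolding T_ideal_def using that F.genideal_self[of "T_relations m n q \<omega>"] by auto
    then have "T_proj m n q \<omega> p = T_proj m n q \<omega> 0"
      using I.coset_eqI[of 0 p] by (simp add: T_proj_def)
    then show ?thesis
      using linear_maps_zero[OF free_algebra_kalgebra T_algebra_kalgebra algebra_homsD(1)[OF T_proj_hom]]
      by simp
  qed
  then show ?thesis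
    using T_relations_vanish[OF T_algebra_kalgebra[of m n q \<omega>] T_proj_hom[of m n q \<omega>], of m n q \<omega>] by (simp add: T_gen_proj[abs_def])
qed

context
  fixes m n :: nat and q \<omega> :: "'k::field" and B :: "('k, 'b, 'l) module_scheme" and \<phi>
  assumes B: "kalgebra B" and \<phi>: "satisfies_T_relations B m n q \<omega> \<phi>"
begin

interpretation B: kalgebra B by (rule B)

lemma relations_closed: "\<phi> y \<in> carrier B"
  using \<phi> by (simp add: satisfies_T_relations_def)

lemma free_hom_relations: "free_hom B \<phi> \<in> algebra_homs free_algebra B"
  by (rule B.free_hom_hom) (rule relations_closed)

lemma free_gen_relations: "free_hom B \<phi> (free_gen y) = \<phi> y"
  by (rule B.free_hom_gen) (rule relations_closed)

text \<open>
  The kernel of the homomorphism is an ideal containing the relations, hence contains the ideal that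
  they generate. Consequently a triple in \<open>B\<close> satisfying the relations is the same as a homomorphism
  \<open>T \<rightarrow> B\<close>.
\<close>

lemma free_hom_T_ideal: "p \<in> T_ideal m n q \<omega> \<Longrightarrow> free_hom B \<phi> p = \<zero>\<^bsub>B\<^esub>"
proof -
  let ?f = "free_hom B \<phi>"
  assume p: "p \<in> T_ideal m n q \<omega>"
  note f = free_hom_relations
  note fD = algebra_homsD[OF f, simplified]
  have "?f 0 = \<zero>\<^bsub>B\<^esub>" using linear_maps_zero[OF free_algebra_kalgebra B algebra_homsD(1)[OF f]] by simp
  then have "ideal {p. ?f p = \<zero>\<^bsub>B\<^esub>} free_algebra"
    by (intro F.idealI_kalgebra) (auto simp: fD)
  moreover have "T_relations m n q \<omega> \<subseteq> {p. ?f p = \<zero>\<^bsub>B\<^esub>}"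
    using T_relations_vanish[OF B f, of m n q \<omega>] \<phi> by (auto simp: free_gen_relations)
  ultimately have "T_ideal m n q \<omega> \<subseteq> {p. ?f p = \<zero>\<^bsub>B\<^esub>}"
    unfolding T_ideal_def by (rule F.genideal_minimal)
  then show ?thesis using p by auto
qed

lemma T_lift_proj: "induced_map (free_hom B \<phi>) (T_proj m n q \<omega> p) = free_hom B \<phi> p"
  unfolding T_proj_def
  by (rule kalgebra_ideal.induced_map_coset[OF T_ideal B algebra_homsD(1)[OF free_hom_relations] free_hom_T_ideal])
    auto

lemma T_lift_hom: "induced_map (free_hom B \<phi>) \<in> algebra_homs (T_algebra m n q \<omega>) B"
  unfolding T_algebra_def
  by (rule kalgebra_ideal.induced_map_hom[OF T_ideal B algebra_homsD(1)[OF free_hom_relations] free_hom_T_ideal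
     free_hom_relations])

lemma T_lift_gen: "induced_map (free_hom B \<phi>) (T_gen m n q \<omega> y) = \<phi> y"
  by (simp add: T_gen_proj T_lift_proj free_gen_relations)

end

text \<open>
  Compatibility of an automorphism with the coalgebra structure and the antipode, and the composition
  of automorphisms, are checked on the generators by this rule.
\<close>

lemma T_hom_eqI:
  assumes B: "kalgebra B" and f: "f \<in> algebra_homs (T_algebra m n q \<omega>) B"
    and f': "f' \<in> algebra_homs (T_algebra m n q \<omega>) B"
    and eq: "\<And>y. f (T_gen m n q \<omega> y) = f' (T_gen m n q \<omega> y)"
    and v: "v \<in> carrier (T_algebra m n q \<omega>)"
  shows "f v = f' v"
proof -
  interpret B: kalgebra B by (rule B)
  obtain p where p: "v = T_proj m n q \<omega> p" using v by (auto simp: T_carrier)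
  show ?thesis
    using B.free_hom_unique[OF algebra_homs_comp[OF T_proj_hom f], of p]
      B.free_hom_unique[OF algebra_homs_comp[OF T_proj_hom f'], of p]
    by (simp add: p eq flip: T_gen_proj)
qed


section \<open>Monomials in a triple satisfying the relations\<close>

context kalgebra
begin

lemma skew_commute_pow_left:
  assumes "a \<in> carrier A" "b \<in> carrier A" "a \<otimes> b = c \<odot> (b \<otimes> a)"
  shows "a [^] (k::nat) \<otimes> b = c ^ k \<odot> (b \<otimes> a [^] k)"
proof (induction k)
  case (Suc k)
  have "a [^] Suc k \<otimes> b = a [^] k \<otimes> (a \<otimes> b)" using assms by (simp add: m_assoc)
  also have "\<dots> = c \<odot> ((a [^] k \<otimes> b) \<otimes> a)" using assms by (simp add: smult_mult_right m_assoc)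
  also have "\<dots> = c ^ Suc k \<odot> (b \<otimes> a [^] Suc k)"
    using assms Suc by (simp add: smult_mult_left smult_smult m_assoc)
  finally show ?case .
qed (use assms in simp)

lemma skew_commute_pow_right:
  assumes "a \<in> carrier A" "b \<in> carrier A" "a \<otimes> b = c \<odot> (b \<otimes> a)"
  shows "a \<otimes> b [^] (k::nat) = c ^ k \<odot> (b [^] k \<otimes> a)"
proof (induction k)
  case (Suc k)
  have "a \<otimes> b [^] Suc k = (a \<otimes> b [^] k) \<otimes> b" using assms by (simp add: m_assoc)
  also have "\<dots> = c ^ k \<odot> (b [^] k \<otimes> (a \<otimes> b))" using assms Suc by (simp add: smult_mult_left m_assoc)
  also have "\<dots> = c ^ Suc k \<odot> (b [^] Suc k \<otimes> a)"
    using assms by (simp add: smult_mult_right smult_smult m_assoc mult.commute)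
  finally show ?case .
qed (use assms in simp)

lemma skew_commute_pow:
  assumes "a \<in> carrier A" "b \<in> carrier A" "a \<otimes> b = c \<odot> (b \<otimes> a)"
  shows "a [^] (k::nat) \<otimes> b [^] (l::nat) = c ^ (k * l) \<odot> (b [^] l \<otimes> a [^] k)"
  using skew_commute_pow_left[OF _ _ skew_commute_pow_right[OF assms, of l], of k] assms
  by (simp add: power_mult mult.commute flip: power_mult)

lemma triple_product:
  assumes c: "G \<in> carrier A" "H \<in> carrier A" "X \<in> carrier A" "G' \<in> carrier A" "H' \<in> carrier A" "X' \<in> carrier A"
    and XG: "X \<otimes> G' = a \<odot> (G' \<otimes> X)" and XH: "X \<otimes> H' = b \<odot> (H' \<otimes> X)" and HG: "H \<otimes> G' = G' \<otimes> H"
  shows "(G \<otimes> H \<otimes> X) \<otimes> (G' \<otimes> H' \<otimes> X') = (a * b) \<odot> ((G \<otimes> G') \<otimes> (H \<otimes> H') \<otimes> (X \<otimes> X'))"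
proof -
  have XG': "X \<otimes> (G' \<otimes> Y) = a \<odot> (G' \<otimes> (X \<otimes> Y))" if "Y \<in> carrier A" for Y
    using XG c that by (metis m_assoc m_closed smult_mult_left)
  have XH': "X \<otimes> (H' \<otimes> Y) = b \<odot> (H' \<otimes> (X \<otimes> Y))" if "Y \<in> carrier A" for Y
    using XH c that by (metis m_assoc m_closed smult_mult_left)
  have HG': "H \<otimes> (G' \<otimes> Y) = G' \<otimes> (H \<otimes> Y)" if "Y \<in> carrier A" for Y
    using HG c that by (metis m_assoc)
  show ?thesis using c
    by (simp add: m_assoc XG' XH' HG' smult_mult_right smult_smult)
qed

end

locale quantum_triple = kalgebra B for B :: "('k::field, 'b, 'l) module_scheme" (structure) +
  fixes m n :: nat and q \<omega> :: 'k and \<phi> :: "gen \<Rightarrow> 'b"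
  assumes relations: "satisfies_T_relations B m n q \<omega> \<phi>"
    and m_pos: "0 < m" and n_pos: "0 < n" and q_pow: "q ^ m = 1" and \<omega>_pow: "\<omega> ^ n = 1"
begin

abbreviation "g \<equiv> \<phi> gen_g"
abbreviation "h \<equiv> \<phi> gen_h"
abbreviation "x \<equiv> \<phi> gen_x"

lemma \<phi>_closed [simp]: "\<phi> y \<in> carrier B"
  using relations by (simp add: satisfies_T_relations_def)

lemma g_pow: "g [^] n = \<one>" and h_pow: "h [^] m = \<one>" and x_pow: "x [^] m = \<zero>"
  and xh: "x \<otimes> h = q \<odot> (h \<otimes> x)" and hg: "h \<otimes> g = g \<otimes> h" and gx: "g \<otimes> x = \<omega> \<odot> (x \<otimes> g)"
  using relations by (simp_all add: satisfies_T_relations_def)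

lemma \<omega>_nonzero: "\<omega> \<noteq> 0" using \<omega>_pow n_pos by (metis power_0_left less_not_refl zero_neq_one)
lemma q_nonzero: "q \<noteq> 0" using q_pow m_pos by (metis power_0_left less_not_refl zero_neq_one)

lemma xg: "x \<otimes> g = inverse \<omega> \<odot> (g \<otimes> x)"
  by (simp add: gx smult_smult \<omega>_nonzero)

definition mono :: "nat \<times> nat \<times> nat \<Rightarrow> 'b"
  where "mono = (\<lambda>(i, j, k). g [^] i \<otimes> h [^] j \<otimes> x [^] k)"

lemma mono_closed [simp]: "mono p \<in> carrier B"
  by (cases p) (simp add: mono_def)

lemma mono_zero: "mono (0, 0, 0) = \<one>"
  by (simp add: mono_def)

lemma mono_gen: "mono (1, 0, 0) = g" "mono (0, 1, 0) = h" "mono (0, 0, 1) = x"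
  by (simp_all add: mono_def)

text \<open>
  Moving \<open>x\<^sup>k\<close> to the right past \<open>g\<^sup>a\<close> costs \<open>\<omega> ^ (- k a)\<close>, past \<open>h\<^sup>b\<close> it costs \<open>q ^ (k b)\<close>.
\<close>

lemma mono_mult:
  "mono (i, j, k) \<otimes> mono (a, b, c) = (inverse \<omega> ^ (k * a) * q ^ (k * b)) \<odot> mono (i + a, j + b, k + c)"
proof -
  have "h [^] j \<otimes> g [^] a = 1 ^ (j * a) \<odot> (g [^] a \<otimes> h [^] j)"
    by (rule skew_commute_pow) (simp_all add: hg)
  then have "h [^] j \<otimes> g [^] a = g [^] a \<otimes> h [^] j" by simp
  moreover have "x [^] k \<otimes> g [^] a = inverse \<omega> ^ (k * a) \<odot> (g [^] a \<otimes> x [^] k)"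
    by (rule skew_commute_pow) (simp_all add: xg)
  moreover have "x [^] k \<otimes> h [^] b = q ^ (k * b) \<odot> (h [^] b \<otimes> x [^] k)"
    by (rule skew_commute_pow) (simp_all add: xh)
  ultimately show ?thesis
    unfolding mono_def prod.case by (subst triple_product) (auto simp: nat_pow_mult)
qed

lemma pow_mod:
  assumes "a \<in> carrier B" "a [^] (N::nat) = \<one>"
  shows "a [^] (i mod N) = a [^] i"
proof -
  have "a [^] i = a [^] (N * (i div N) + i mod N)" by simp
  also have "\<dots> = (a [^] N) [^] (i div N) \<otimes> a [^] (i mod N)"
    using assms(1) by (simp only: nat_pow_mult[symmetric] nat_pow_pow)
  finally show ?thesis using assms by simp
qed

lemma mono_mod: "mono (i mod n, j mod m, k) = mono (i, j, k)"
  by (simp add: mono_def pow_mod g_pow h_pow)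

lemma mono_high: 
  assumes "m \<le> k" shows "mono (i, j, k) = \<zero>"
proof -
  have "x [^] (m + (k - m)) = \<zero>"
    unfolding nat_pow_mult[OF \<phi>_closed, symmetric] by (simp add: x_pow)
  then show ?thesis using assms by (simp add: mono_def)
qed

end

text \<open>
  The scalar produced when the letters of a word are sorted into the order \<open>g\<close>, \<open>h\<close>, \<open>x\<close>: each \<open>x\<close> has to
  pass the letters \<open>g\<close> and \<open>h\<close> on its right.
\<close>

fun reorder_scalar :: "'k::field \<Rightarrow> 'k \<Rightarrow> gen list \<Rightarrow> 'k" where
  "reorder_scalar q \<omega> [] = 1"
| "reorder_scalar q \<omega> (y # w) =
    (if y = gen_x then inverse \<omega> ^ count_list w gen_g * q ^ count_list w gen_h else 1) * reorder_scalar q \<omega> w"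

lemma reorder_scalar_append:
  "reorder_scalar q \<omega> (u @ w) = reorder_scalar q \<omega> u * reorder_scalar q \<omega> w *
    (inverse \<omega> ^ (count_list u gen_x * count_list w gen_g) * q ^ (count_list u gen_x * count_list w gen_h))"
  by (induction u) (auto simp: power_add algebra_simps)

lemma (in quantum_triple) word_prod_mono:
  "word_prod B \<phi> w =
    reorder_scalar q \<omega> w \<odot> mono (count_list w gen_g, count_list w gen_h, count_list w gen_x)"
proof (induction w)
  case Nil
  then show ?case by (simp add: mono_zero)
next
  case (Cons y w)
  have "\<phi> y = mono (if y = gen_g then 1 else 0, if y = gen_h then 1 else 0, if y = gen_x then 1 else 0)"
    by (cases y) (simp_all add: mono_gen[simplified])
  then show ?case
    by (simp add: Cons smult_mult_right mono_mult smult_smult mult.commute)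
qed

section \<open>A basis\<close>

text \<open>
  A primitive root of unity enters only through the two conditions on the powers of \<open>q\<close>. They give
  that \<open>1 + q + \<dots> + q ^ (k - 1)\<close> vanishes for \<open>k = m\<close> but for no positive \<open>k < m\<close>.
\<close>

locale T_parameters =
  fixes m n :: nat and q \<omega> :: "'k::field"
  assumes m_ge: "2 \<le> m" and n_ge: "1 \<le> n"
    and q_power: "q ^ m = 1" and q_primitive: "\<And>k. 0 < k \<Longrightarrow> k < m \<Longrightarrow> q ^ k \<noteq> 1"
    and \<omega>_power: "\<omega> ^ n = 1"
begin

abbreviation "T \<equiv> T_algebra m n q \<omega>"

sublocale T: quantum_triple T m n q \<omega> "T_gen m n q \<omega>"
  using m_ge n_ge q_power \<omega>_power
  by (simp add: quantum_triple_def quantum_triple_axioms_def T_algebra_kalgebra T_gen_relations)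

text \<open>
  The coefficient of \<open>g\<^sup>i h\<^sup>j x\<^sup>k\<close> in the normal form of a word. The exponents of \<open>g\<close> and \<open>h\<close> are
  compared modulo \<open>n\<close> and \<open>m\<close>. The exponent of \<open>x\<close> is compared exactly, and \<open>x\<^sup>m = 0\<close> is taken into
  account by using these functions for \<open>k < m\<close> only.
\<close>

definition word_coord :: "nat \<times> nat \<times> nat \<Rightarrow> gen list \<Rightarrow> 'k"
  where "word_coord = (\<lambda>(i, j, k) w.
    if count_list w gen_g mod n = i mod n \<and> count_list w gen_h mod m = j mod m \<and> count_list w gen_x = k
    then reorder_scalar q \<omega> w else 0)"

definition free_coord :: "nat \<times> nat \<times> nat \<Rightarrow> (gen list \<Rightarrow>\<^sub>0 'k) \<Rightarrow> 'k"
  where "free_coord p = linear_extension ground_algebra (word_coord p)"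

lemma free_coord_add: "free_coord p (a + b) = free_coord p a + free_coord p b"
proof -
  interpret K: kalgebra "ground_algebra :: ('k, 'k) module" by (rule ground_algebra_kalgebra)
  show ?thesis unfolding free_coord_def using K.linear_extension_add[of a UNIV b] by simp
qed

lemma free_coord_scale: "free_coord p (scale c a) = c * free_coord p a"
proof -
  interpret K: kalgebra "ground_algebra :: ('k, 'k) module" by (rule ground_algebra_kalgebra)
  show ?thesis unfolding free_coord_def using K.linear_extension_scale[of a UNIV] by simp
qed

lemma free_coord_single: "free_coord p (Poly_Mapping.single w c) = c * word_coord p w"
proof -
  interpret K: kalgebra "ground_algebra :: ('k, 'k) module" by (rule ground_algebra_kalgebra)
  show ?thesis unfolding free_coord_def using K.linear_extension_single by simp
qed

lemma free_coord_zero [simp]: "free_coord p 0 = 0"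
  using free_coord_scale[of p 0 0] by simp

lemma free_coord_diff: "free_coord p (a - b) = free_coord p a - free_coord p b"
  using free_coord_add[of p "a - b" b] by simp

text \<open>
  Solving \<open>a + b \<equiv> i\<close> for \<open>b\<close> within the natural numbers: \<open>(N - 1) a\<close> serves as \<open>- a\<close> modulo \<open>N\<close>.
\<close>

lemma shift_mod: 
  fixes N :: nat
  assumes "1 \<le> N"
  shows "(a + b) mod N = i mod N \<longleftrightarrow> b mod N = (i + (N - 1) * a) mod N"
proof -
  obtain N' where N: "N = Suc N'" using assms by (cases N) auto
  have "[a + b = i] (mod N) \<longleftrightarrow> [N' * a + (a + b) = N' * a + i] (mod N)"
    by (simp add: cong_add_lcancel_nat)
  also have "N' * a + (a + b) = N * a + b" by (simp add: N)
  also have "[N * a + b = N' * a + i] (mod N) \<longleftrightarrow> [b = N' * a + i] (mod N)"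
    by (simp add: cong_def)
  finally show ?thesis by (simp add: cong_def N add.commute)
qed

lemma power_mod_cong:
  fixes z :: 'k
  assumes "z ^ N = 1" "a mod N = b mod N"
  shows "z ^ (c * a) = z ^ (c * b)"
proof -
  have "z ^ a = z ^ (a mod N)" for a
  proof -
    have "z ^ (N * (a div N) + a mod N) = z ^ (a mod N)"
      by (simp only: power_add power_mult assms(1)) simp
    then show ?thesis by simp
  qed
  then have "z ^ a = z ^ b" using assms(2) by metis
  then show ?thesis by (simp add: mult.commute[of c] power_mult)
qed

lemma inverse_\<omega>_power: "inverse \<omega> ^ n = 1"
  by (simp add: power_inverse \<omega>_power)

text \<open>
  Multiplication by a word on either side carries a coordinate to a scalar multiple of another one.
  The scalar is a constant because it depends on \<open>w\<close> only through the numbers of its letters, and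
  wherever the coordinate is nonzero these are prescribed as far as powers of \<open>\<omega>\<close> and \<open>q\<close> can tell.
\<close>

lemma word_coord_append_left:
  fixes u
  defines "a \<equiv> count_list u gen_g" and "b \<equiv> count_list u gen_h" and "c \<equiv> count_list u gen_x"
  shows "word_coord (i, j, k) (u @ w) =
    (if c \<le> k then reorder_scalar q \<omega> u * (inverse \<omega> ^ (c * (i + (n - 1) * a)) * q ^ (c * (j + (m - 1) * b))) else 0)
    * word_coord (i + (n - 1) * a, j + (m - 1) * b, k - c) w"
proof -
  have i: "(a + count_list w gen_g) mod n = i mod n \<longleftrightarrow> count_list w gen_g mod n = (i + (n - 1) * a) mod n"
    using n_ge by (rule shift_mod)
  have j: "(b + count_list w gen_h) mod m = j mod m \<longleftrightarrow> count_list w gen_h mod m = (j + (m - 1) * b) mod m"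
    using m_ge by (intro shift_mod) simp
  have k: "c + count_list w gen_x = k \<longleftrightarrow> c \<le> k \<and> count_list w gen_x = k - c" by auto
  show ?thesis
    unfolding word_coord_def prod.case count_list_append a_def[symmetric] b_def[symmetric] c_def[symmetric] i j k
    using power_mod_cong[OF inverse_\<omega>_power, of "count_list w gen_g" "i + (n - 1) * a" c]
      power_mod_cong[OF q_power, of "count_list w gen_h" "j + (m - 1) * b" c]
    by (auto simp: reorder_scalar_append c_def[symmetric])
qed

lemma word_coord_append_right:
  fixes u
  defines "a \<equiv> count_list u gen_g" and "b \<equiv> count_list u gen_h" and "c \<equiv> count_list u gen_x"
  shows "word_coord (i, j, k) (w @ u) =
    (if c \<le> k then reorder_scalar q \<omega> u * (inverse \<omega> ^ ((k - c) * a) * q ^ ((k - c) * b)) else 0)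
    * word_coord (i + (n - 1) * a, j + (m - 1) * b, k - c) w"
proof -
  have i: "(count_list w gen_g + a) mod n = i mod n \<longleftrightarrow> count_list w gen_g mod n = (i + (n - 1) * a) mod n"
    using shift_mod[OF n_ge, of a "count_list w gen_g" i] by (simp add: add.commute)
  have j: "(count_list w gen_h + b) mod m = j mod m \<longleftrightarrow> count_list w gen_h mod m = (j + (m - 1) * b) mod m"
    using shift_mod[of m b "count_list w gen_h" j] m_ge by (simp add: add.commute)
  have k: "count_list w gen_x + c = k \<longleftrightarrow> c \<le> k \<and> count_list w gen_x = k - c" by auto
  show ?thesis
    unfolding word_coord_def prod.case count_list_append a_def[symmetric] b_def[symmetric] c_def[symmetric] i j k
    by (auto simp: reorder_scalar_append a_def[symmetric] b_def[symmetric])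
qed

lemma free_coord_mult_left: "\<exists>C i' j' k'. k' \<le> k \<and> (\<forall>p. free_coord (i, j, k) (Poly_Mapping.single u d \<otimes>\<^bsub>free_algebra\<^esub> p)
    = C * free_coord (i', j', k') p)"
proof -
  define c where "c = count_list u gen_x"
  \<comment> \<open>The exponents \<open>i'\<close> and \<open>j'\<close> represent \<open>i\<close> and \<open>j\<close> minus the numbers of letters in \<open>u\<close>.\<close>
  define i' where "i' = i + (n - 1) * count_list u gen_g"
  define j' where "j' = j + (m - 1) * count_list u gen_h"
  define C where "C = d * (if c \<le> k then reorder_scalar q \<omega> u * (inverse \<omega> ^ (c * i') * q ^ (c * j')) else 0)"
  have "free_coord (i, j, k) (Poly_Mapping.single u d \<otimes>\<^bsub>free_algebra\<^esub> p) = C * free_coord (i', j', k - c) p" for p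
  proof (induction p rule: free_induct)
    case (single w e)
    show ?case
      by (simp only: free_algebra_simps free_coord_single word_coord_append_left C_def i'_def j'_def c_def mult_ac)
  next
    case (add p r)
    then show ?case by (simp add: free_algebra_add_right free_coord_add algebra_simps)
  qed simp
  then show ?thesis by (intro exI[of _ C] exI[of _ i'] exI[of _ j'] exI[of _ "k - c"]) auto
qed

lemma free_coord_mult_right: "\<exists>C i' j' k'. k' \<le> k \<and> (\<forall>p. free_coord (i, j, k) (p \<otimes>\<^bsub>free_algebra\<^esub> Poly_Mapping.single u d)
    = C * free_coord (i', j', k') p)"
proof -
  define c where "c = count_list u gen_x"
  define i' where "i' = i + (n - 1) * count_list u gen_g"
  define j' where "j' = j + (m - 1) * count_list u gen_h"
  define C where "C = d * (if c \<le> k then reorder_scalar q \<omega> u *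
    (inverse \<omega> ^ ((k - c) * count_list u gen_g) * q ^ ((k - c) * count_list u gen_h)) else 0)"
  have "free_coord (i, j, k) (p \<otimes>\<^bsub>free_algebra\<^esub> Poly_Mapping.single u d) = C * free_coord (i', j', k - c) p" for p
  proof (induction p rule: free_induct)
    case (single w e)
    show ?case
      by (simp only: free_algebra_simps free_coord_single word_coord_append_right C_def i'_def j'_def c_def mult_ac)
  next
    case (add p r)
    then show ?case by (simp add: free_algebra_add_left free_coord_add algebra_simps)
  qed simp
  then show ?thesis by (intro exI[of _ C] exI[of _ i'] exI[of _ j'] exI[of _ "k - c"]) auto
qed

lemma free_gen_pow: "(free_gen y :: gen list \<Rightarrow>\<^sub>0 'k) [^]\<^bsub>free_algebra\<^esub> (l::nat) = Poly_Mapping.single (replicate l y) 1"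
  by (induction l) (simp_all add: free_gen_def replicate_append_same)

lemma count_list_replicate: "count_list (replicate l y) z = (if y = z then l else 0)"
  by (induction l) auto

lemma reorder_scalar_replicate: "reorder_scalar q \<omega> (replicate l y) = 1"
  by (induction l) (auto simp: count_list_replicate)

lemma word_coord_proportional:
  assumes "\<And>y. count_list u y = count_list w y" "reorder_scalar q \<omega> u = c * reorder_scalar q \<omega> w"
  shows "word_coord p u = c * word_coord p w"
proof -
  have if_mult: "(if P then c * d else 0) = c * (if P then d else 0)" for P and d :: 'k by simp
  show ?thesis
    by (cases p) (simp only: word_coord_def prod.case assms if_mult)
qed

lemma free_coord_relations:
  assumes "p \<in> T_relations m n q \<omega>" "k < m"
  shows "free_coord (i, j, k) p = 0"
proof -
  let ?s = "\<lambda>w. Poly_Mapping.single w (1::'k)"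
  note eval = free_coord_diff free_coord_single free_coord_scale word_coord_def
      count_list_replicate reorder_scalar_replicate
  note eval' = free_coord_diff free_coord_single free_coord_scale mult_1
  have "free_coord (i, j, k) (?s (replicate n gen_g) - ?s []) = 0" by (simp add: eval)
  moreover have "free_coord (i, j, k) (?s (replicate m gen_h) - ?s []) = 0" by (simp add: eval)
  moreover have "free_coord (i, j, k) (?s (replicate m gen_x)) = 0" using assms(2) by (simp add: eval)
  moreover have "free_coord (i, j, k) (?s [gen_x, gen_h] - scale q (?s [gen_h, gen_x])) = 0"
    unfolding eval' right_minus_eq by (rule word_coord_proportional) simp_all
  moreover have "free_coord (i, j, k) (?s [gen_h, gen_g] - ?s [gen_g, gen_h]) = 0"
    using word_coord_proportional[of "[gen_h, gen_g]" "[gen_g, gen_h]" 1] unfolding eval' right_minus_eq by simp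
  moreover have "free_coord (i, j, k) (?s [gen_g, gen_x] - scale \<omega> (?s [gen_x, gen_g])) = 0"
    unfolding eval' right_minus_eq by (rule word_coord_proportional) (simp_all add: T.\<omega>_nonzero)
  ultimately show ?thesis
    using assms(1) unfolding T_relations_def Let_def free_gen_pow
    unfolding free_gen_def free_algebra_simps append.simps mult_1
    by (elim insertE emptyE) (simp_all only:)
qed

text \<open>
  Since multiplication by a word carries each coordinate to a multiple of another one, never raising
  the index \<open>k\<close>, the elements on which all coordinates with \<open>k < m\<close> vanish form a two-sided ideal. The relations
  lie in it, hence so does the ideal that they generate. This is the linear independence of the
  monomials.
\<close>

lemma free_coord_ideal:
  assumes "p \<in> T_ideal m n q \<omega>" "k < m"
  shows "free_coord (i, j, k) p = 0"
proof -
  let ?I = "{p. \<forall>i j k. k < m \<longrightarrow> free_coord (i, j, k) p = 0}"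
  have "ideal ?I free_algebra"
  proof (rule F.idealI_kalgebra)
    fix a b :: "gen list \<Rightarrow>\<^sub>0 'k" assume a: "a \<in> ?I"
    have "\<forall>i j k. k < m \<longrightarrow> free_coord (i, j, k) (b \<otimes>\<^bsub>free_algebra\<^esub> a) = 0"
    proof (induction b rule: free_induct)
      case (single u d)
      show ?case
      proof (intro allI impI)
        fix i j k assume "k < m"
        then show "free_coord (i, j, k) (Poly_Mapping.single u d \<otimes>\<^bsub>free_algebra\<^esub> a) = 0"
          using free_coord_mult_left[of k i j u d] a by fastforce
      qed
    qed (simp_all add: free_algebra_add_left free_coord_add)
    then show "b \<otimes>\<^bsub>free_algebra\<^esub> a \<in> ?I" by simp
    have "\<forall>i j k. k < m \<longrightarrow> free_coord (i, j, k) (a \<otimes>\<^bsub>free_algebra\<^esub> b) = 0"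
    proof (induction b rule: free_induct)
      case (single u d)
      show ?case
      proof (intro allI impI)
        fix i j k assume "k < m"
        then show "free_coord (i, j, k) (a \<otimes>\<^bsub>free_algebra\<^esub> Poly_Mapping.single u d) = 0"
          using free_coord_mult_right[of k i j u d] a by fastforce
      qed
    qed (simp_all add: free_algebra_add_right free_coord_add)
    then show "a \<otimes>\<^bsub>free_algebra\<^esub> b \<in> ?I" by simp
  qed (auto simp: free_coord_add)
  then have "T_ideal m n q \<omega> \<subseteq> ?I"
    unfolding T_ideal_def by (rule F.genideal_minimal) (auto simp: free_coord_relations)
  then show ?thesis using assms by auto
qed

definition coord :: "nat \<times> nat \<times> nat \<Rightarrow> (gen list \<Rightarrow>\<^sub>0 'k) set \<Rightarrow> 'k"
  where "coord p = induced_map (free_coord p)"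

lemma free_coord_linear: "free_coord p \<in> linear_maps free_algebra ground_algebra"
  by (rule linear_mapsI) (simp_all add: free_coord_add free_coord_scale)

lemma coord_linear: 
  assumes "k < m" shows "coord (i, j, k) \<in> linear_maps T ground_algebra"
  unfolding coord_def T_algebra_def
  by (rule kalgebra_ideal.induced_map_linear[OF T_ideal ground_algebra_kalgebra free_coord_linear])
    (simp add: free_coord_ideal assms)

lemma coord_proj: 
  assumes "k < m" shows "coord (i, j, k) (T_proj m n q \<omega> p) = free_coord (i, j, k) p"
  unfolding coord_def T_proj_def
  by (rule kalgebra_ideal.induced_map_coset[OF T_ideal ground_algebra_kalgebra free_coord_linear])
    (simp_all add: free_coord_ideal assms)

lemma T_proj_word:
  "T_proj m n q \<omega> (Poly_Mapping.single w c) =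
    (c * reorder_scalar q \<omega> w) \<odot>\<^bsub>T\<^esub> T.mono (count_list w gen_g, count_list w gen_h, count_list w gen_x)"
  using T.free_hom_unique[OF T_proj_hom, of "Poly_Mapping.single w c"]
  by (simp add: T_gen_proj[symmetric] T.free_hom_single T.word_prod_mono T.smult_smult)

lemma coord_mono:
  assumes "k < m"
  shows "coord (i, j, k) (T.mono (a, b, c)) = (if a mod n = i mod n \<and> b mod m = j mod m \<and> c = k then 1 else 0)"
proof -
  let ?w = "replicate a gen_g @ replicate b gen_h @ replicate c gen_x"
  have "T.mono (a, b, c) = T_proj m n q \<omega> (Poly_Mapping.single ?w 1)"
    and "word_coord (i, j, k) ?w = (if a mod n = i mod n \<and> b mod m = j mod m \<and> c = k then 1 else 0)"
    by (simp_all add: T_proj_word count_list_replicate word_coord_def reorder_scalar_append reorder_scalar_replicate)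
  then show ?thesis using assms by (simp add: coord_proj free_coord_single)
qed

abbreviation box :: "(nat \<times> nat \<times> nat) set"
  where "box \<equiv> {..<n} \<times> {..<m} \<times> {..<m}"

text \<open>
  The monomials span: by linearity it is enough to look at a word, which is a multiple of one
  monomial, and that monomial either lies in the box after reduction of its exponents or is zero.
\<close>

lemma expand:
  assumes "v \<in> carrier T"
  shows "v = (\<Oplus>\<^bsub>T\<^esub>p\<in>box. coord p v \<odot>\<^bsub>T\<^esub> T.mono p)"
proof -
  obtain f where f: "v = T_proj m n q \<omega> f" using assms by (auto simp: T_carrier)
  note P = algebra_homsD[OF T_proj_hom[of m n q \<omega>], simplified]
  have "T_proj m n q \<omega> f = (\<Oplus>\<^bsub>T\<^esub>p\<in>box. free_coord p f \<odot>\<^bsub>T\<^esub> T.mono p)"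
  proof (induction f rule: free_induct)
    case zero
    have "T_proj m n q \<omega> 0 = \<zero>\<^bsub>T\<^esub>"
      using linear_maps_zero[OF free_algebra_kalgebra T_algebra_kalgebra algebra_homsD(1)[OF T_proj_hom]]
      by simp
    then show ?case by simp
  next
    case (single w c)
    let ?a = "count_list w gen_g" and ?b = "count_list w gen_h" and ?k = "count_list w gen_x"
    let ?p = "(?a mod n, ?b mod m, ?k)"
    have eq: "free_coord p (Poly_Mapping.single w c) \<odot>\<^bsub>T\<^esub> T.mono p =
        (if ?p = p then (c * reorder_scalar q \<omega> w) \<odot>\<^bsub>T\<^esub> T.mono p else \<zero>\<^bsub>T\<^esub>)" if "p \<in> box" for p
    proof -
      have "word_coord p w = (if ?p = p then reorder_scalar q \<omega> w else 0)"
        using that by (auto simp: word_coord_def split: if_splits)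
      then show ?thesis by (simp add: free_coord_single)
    qed
    have "(\<Oplus>\<^bsub>T\<^esub>p\<in>box. free_coord p (Poly_Mapping.single w c) \<odot>\<^bsub>T\<^esub> T.mono p)
        = (\<Oplus>\<^bsub>T\<^esub>p\<in>box. if ?p = p then (c * reorder_scalar q \<omega> w) \<odot>\<^bsub>T\<^esub> T.mono p else \<zero>\<^bsub>T\<^esub>)"
      by (rule T.finsum_cong') (simp_all only: eq, auto)
    also have "\<dots> = (c * reorder_scalar q \<omega> w) \<odot>\<^bsub>T\<^esub> T.mono ?p"
    proof (cases "?k < m")
      case True
      then have "?p \<in> box" using m_ge n_ge by simp
      then show ?thesis by (subst T.finsum_singleton) auto
    next
      case False
      then have "(\<Oplus>\<^bsub>T\<^esub>p\<in>box. if ?p = p then (c * reorder_scalar q \<omega> w) \<odot>\<^bsub>T\<^esub> T.mono p else \<zero>\<^bsub>T\<^esub>)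
          = (\<Oplus>\<^bsub>T\<^esub>p\<in>box. \<zero>\<^bsub>T\<^esub>)"
        by (intro T.finsum_cong') auto
      then show ?thesis using False by (simp add: T.mono_high)
    qed
    finally show ?case by (simp add: T_proj_word T.mono_mod)
  next
    case (add f f')
    have "(\<Oplus>\<^bsub>T\<^esub>p\<in>box. free_coord p (f + f') \<odot>\<^bsub>T\<^esub> T.mono p)
        = (\<Oplus>\<^bsub>T\<^esub>p\<in>box. free_coord p f \<odot>\<^bsub>T\<^esub> T.mono p \<oplus>\<^bsub>T\<^esub> free_coord p f' \<odot>\<^bsub>T\<^esub> T.mono p)"
      by (rule T.finsum_cong') (auto simp: free_coord_add T.smult_l_distr)
    also have "\<dots> = (\<Oplus>\<^bsub>T\<^esub>p\<in>box. free_coord p f \<odot>\<^bsub>T\<^esub> T.mono p) \<oplus>\<^bsub>T\<^esub> (\<Oplus>\<^bsub>T\<^esub>p\<in>box. free_coord p f' \<odot>\<^bsub>T\<^esub> T.mono p)"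
      by (rule T.finsum_addf) auto
    finally show ?case using add P(5)[of f f'] by simp
  qed
  also have "\<dots> = (\<Oplus>\<^bsub>T\<^esub>p\<in>box. coord p v \<odot>\<^bsub>T\<^esub> T.mono p)"
    by (rule T.finsum_cong') (auto simp: f coord_proj)
  finally show ?thesis using f by simp
qed

lemma finsum_ground: "finsum (ground_algebra :: ('k, 'k) module) f S = sum f S"
proof -
  interpret K: kalgebra "ground_algebra :: ('k, 'k) module" by (rule ground_algebra_kalgebra)
  show ?thesis by (induction S rule: infinite_finite_induct) auto
qed

lemma functional_expand:
  assumes "f \<in> linear_maps T ground_algebra" "v \<in> carrier T"
  shows "f v = (\<Sum>p\<in>box. coord p v * f (T.mono p))"
proof -
  have "f v = f (\<Oplus>\<^bsub>T\<^esub>p\<in>box. coord p v \<odot>\<^bsub>T\<^esub> T.mono p)" using expand[OF assms(2)] by simp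
  also have "\<dots> = (\<Oplus>\<^bsub>ground_algebra\<^esub>p\<in>box. f (coord p v \<odot>\<^bsub>T\<^esub> T.mono p))"
    by (rule linear_maps_finsum[OF T_algebra_kalgebra ground_algebra_kalgebra assms(1)]) auto
  also have "\<dots> = (\<Sum>p\<in>box. coord p v * f (T.mono p))"
    by (simp add: finsum_ground linear_mapsD(3)[OF assms(1)])
  finally show ?thesis .
qed

lemma coord_eqI:
  assumes "v \<in> carrier T" "w \<in> carrier T" "\<And>p. p \<in> box \<Longrightarrow> coord p v = coord p w"
  shows "v = w"
proof -
  have "v = (\<Oplus>\<^bsub>T\<^esub>p\<in>box. coord p v \<odot>\<^bsub>T\<^esub> T.mono p)" by (rule expand[OF assms(1)])
  also have "\<dots> = (\<Oplus>\<^bsub>T\<^esub>p\<in>box. coord p w \<odot>\<^bsub>T\<^esub> T.mono p)"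
    by (rule T.finsum_cong') (use assms in auto)
  also have "\<dots> = w" by (rule expand[OF assms(2), symmetric])
  finally show ?thesis .
qed

end


section \<open>Gaussian binomial coefficients\<close>

text \<open>
  The Gaussian binomial coefficients. The recursion is the one obtained by multiplying an expansion
  of \<open>(a + b) ^ N\<close> by \<open>a + b\<close> on the right when \<open>b a = q a b\<close>.
\<close>

fun qbinom :: "'k::field \<Rightarrow> nat \<Rightarrow> nat \<Rightarrow> 'k" where
  "qbinom q N 0 = 1"
| "qbinom q 0 (Suc r) = 0"
| "qbinom q (Suc N) (Suc r) = q ^ (N - r) * qbinom q N r + qbinom q N (Suc r)"

lemma qbinom_eq_0: "N < r \<Longrightarrow> qbinom q N r = 0"
  by (induction q N r rule: qbinom.induct) auto

lemma qbinom_self [simp]: "qbinom q N N = 1"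
  by (induction N) (auto simp: qbinom_eq_0)

text \<open>
  The identity \<open>[r + 1] [N + 1 choose r + 1] = [N + 1] [N choose r]\<close>, where \<open>[k] = 1 + q + \<dots> + q ^ (k - 1)\<close>.
  It avoids Gaussian factorials, by which one could not divide in general.
\<close>

lemma qbinom_absorption:
  "(\<Sum>i<Suc r. q ^ i) * qbinom q (Suc N) (Suc r) = (\<Sum>i<Suc N. q ^ i) * qbinom q N r"
proof (induction N arbitrary: r)
  case 0
  then show ?case by (cases r) auto
next
  case (Suc N)
  show ?case
  proof (cases r)
    case 0
    then show ?thesis using Suc.IH[of 0] by (simp add: algebra_simps)
  next
    case (Suc r')
    show ?thesis
    proof (cases "r \<le> Suc N")
      case False
      then show ?thesis by (simp add: qbinom_eq_0)
    next
      case True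
      let ?I = "\<lambda>k. \<Sum>i<k. q ^ i" and ?B = "qbinom q"
      have e: "q ^ (Suc N - r) * q ^ r = q ^ Suc N" using True by (simp flip: power_add)
      have rec: "?B (Suc N) r = q ^ (Suc N - r) * ?B N r' + ?B N r"
        using Suc by simp
      have "?I (Suc r) * ?B (Suc (Suc N)) (Suc r)
          = q ^ (Suc N - r) * (?I (Suc r) * ?B (Suc N) r) + ?I (Suc r) * ?B (Suc N) (Suc r)"
        by (simp add: algebra_simps)
      also have "?I (Suc r) * ?B (Suc N) r = ?I (Suc N) * ?B N r' + q ^ r * ?B (Suc N) r"
        using Suc.IH[of r'] Suc by (simp add: algebra_simps)
      also have "?I (Suc r) * ?B (Suc N) (Suc r) = ?I (Suc N) * ?B N r"
        by (rule Suc.IH)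
      also have "q ^ (Suc N - r) * (?I (Suc N) * ?B N r' + q ^ r * ?B (Suc N) r) + ?I (Suc N) * ?B N r
          = ?I (Suc N) * (q ^ (Suc N - r) * ?B N r' + ?B N r) + (q ^ (Suc N - r) * q ^ r) * ?B (Suc N) r"
        by (simp only: algebra_simps)
      also have "\<dots> = ?I (Suc (Suc N)) * ?B (Suc N) r"
        unfolding rec[symmetric] e by (simp add: algebra_simps)
      finally show ?thesis .
    qed
  qed
qed

context kalgebra
begin

theorem q_binomial:
  assumes a: "a \<in> carrier A" and b: "b \<in> carrier A" and ba: "b \<otimes> a = q \<odot> (a \<otimes> b)"
  shows "(a \<oplus> b) [^] N = (\<Oplus>r\<in>{..N}. qbinom q N r \<odot> (a [^] r \<otimes> b [^] (N - r)))"
proof (induction N)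
  case 0
  then show ?case by simp
next
  case (Suc N)
  let ?t = "\<lambda>(N::nat) (r::nat). a [^] r \<otimes> b [^] (N - r)"
  have t: "?t N r \<in> carrier A" for N r using a b by simp
  have ta: "?t N r \<otimes> a = q ^ (N - r) \<odot> ?t (Suc N) (Suc r)" if "r \<le> N" for r
  proof -
    have "b [^] (N - r) \<otimes> a = q ^ (N - r) \<odot> (a \<otimes> b [^] (N - r))"
      using ba by (rule skew_commute_pow_left[OF b a])
    then show ?thesis using a b by (simp add: m_assoc smult_mult_right)
  qed
  have tb: "?t N r \<otimes> b = ?t (Suc N) r" if "r \<le> N" for r
    using that a b by (simp add: m_assoc Suc_diff_le)
  have "(a \<oplus> b) [^] Suc N = (\<Oplus>r\<in>{..N}. qbinom q N r \<odot> ?t N r) \<otimes> a \<oplus> (\<Oplus>r\<in>{..N}. qbinom q N r \<odot> ?t N r) \<otimes> b"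
    using a b t by (simp add: Suc r_distr)
  also have "(\<Oplus>r\<in>{..N}. qbinom q N r \<odot> ?t N r) \<otimes> a
      = (\<Oplus>r\<in>{..N}. (q ^ (N - r) * qbinom q N r) \<odot> ?t (Suc N) (Suc r))"
    using a b t by (subst finsum_ldistr) (auto simp: smult_mult_left ta smult_smult mult.commute intro!: finsum_cong')
  also have "(\<Oplus>r\<in>{..N}. qbinom q N r \<odot> ?t N r) \<otimes> b = (\<Oplus>r\<in>{..N}. qbinom q N r \<odot> ?t (Suc N) r)"
    using a b t by (subst finsum_ldistr) (auto simp: smult_mult_left tb intro!: finsum_cong')
  also have "\<dots> = (\<Oplus>r\<in>{..Suc N}. qbinom q N r \<odot> ?t (Suc N) r)"
    using a b t by (subst finsum_Suc) (auto simp: qbinom_eq_0)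
  also have "\<dots> = (\<Oplus>r\<in>{..N}. qbinom q N (Suc r) \<odot> ?t (Suc N) (Suc r)) \<oplus> ?t (Suc N) 0"
    using a b t by (subst finsum_Suc2) auto
  also have "(\<Oplus>r\<in>{..N}. (q ^ (N - r) * qbinom q N r) \<odot> ?t (Suc N) (Suc r)) \<oplus> \<dots>
      = (\<Oplus>r\<in>{..N}. qbinom q (Suc N) (Suc r) \<odot> ?t (Suc N) (Suc r)) \<oplus> ?t (Suc N) 0"
  proof -
    have "(\<Oplus>r\<in>{..N}. qbinom q (Suc N) (Suc r) \<odot> ?t (Suc N) (Suc r))
        = (\<Oplus>r\<in>{..N}. (q ^ (N - r) * qbinom q N r) \<odot> ?t (Suc N) (Suc r) \<oplus> qbinom q N (Suc r) \<odot> ?t (Suc N) (Suc r))"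
      using a b t by (intro finsum_cong') (auto simp: smult_l_distr)
    also have "\<dots> = (\<Oplus>r\<in>{..N}. (q ^ (N - r) * qbinom q N r) \<odot> ?t (Suc N) (Suc r))
        \<oplus> (\<Oplus>r\<in>{..N}. qbinom q N (Suc r) \<odot> ?t (Suc N) (Suc r))"
      using a b t by (intro finsum_addf) auto
    finally show ?thesis using a b t by (simp add: a_assoc Pi_iff)
  qed
  also have "\<dots> = (\<Oplus>r\<in>{..Suc N}. qbinom q (Suc N) r \<odot> ?t (Suc N) r)"
    using a b t by (subst finsum_Suc2) auto
  finally show ?case .
qed

end

context T_parameters
begin

lemma q_int_nonzero: "0 < k \<Longrightarrow> k < m \<Longrightarrow> (\<Sum>i<k. q ^ i) \<noteq> 0"
  using q_primitive[of k] power_diff_1_eq[of q k] by auto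

lemma q_int_zero: "(\<Sum>i<m. q ^ i) = 0"
  using q_primitive[of 1] power_diff_1_eq[of q m] q_power m_ge by simp

lemma qbinom_m: assumes "0 < r" "r < m" shows "qbinom q m r = 0"
proof -
  obtain m' r' where "m = Suc m'" "r = Suc r'" using assms by (metis Suc_pred less_trans)
  then show ?thesis
    using qbinom_absorption[of q r' m'] q_int_nonzero[OF assms] q_int_zero by simp
qed

lemma qbinom_1_nonzero: assumes "0 < k" "k < m" shows "qbinom q k 1 \<noteq> 0"
proof -
  obtain k' where "k = Suc k'" using assms by (metis Suc_pred)
  then show ?thesis
    using qbinom_absorption[of q 0 k'] q_int_nonzero[OF assms] by (simp add: add.commute)
qed

text \<open>
  For a primitive \<open>m\<close>-th root of unity, \<open>[m] = 0\<close> while \<open>[r]\<close> is invertible for \<open>0 < r < m\<close>, so the inner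
  coefficients in row \<open>m\<close> vanish and \<open>(a + b) ^ m = a ^ m + b ^ m\<close>.
\<close>

lemma skew_power_sum_zero:
  assumes "kalgebra B" "a \<in> carrier B" "b \<in> carrier B" "b \<otimes>\<^bsub>B\<^esub> a = q \<odot>\<^bsub>B\<^esub> (a \<otimes>\<^bsub>B\<^esub> b)"
    and "a [^]\<^bsub>B\<^esub> m = \<zero>\<^bsub>B\<^esub>" "b [^]\<^bsub>B\<^esub> m = \<zero>\<^bsub>B\<^esub>"
  shows "(a \<oplus>\<^bsub>B\<^esub> b) [^]\<^bsub>B\<^esub> m = \<zero>\<^bsub>B\<^esub>"
proof -
  interpret B: kalgebra B by fact
  have "qbinom q m r \<odot>\<^bsub>B\<^esub> (a [^]\<^bsub>B\<^esub> r \<otimes>\<^bsub>B\<^esub> b [^]\<^bsub>B\<^esub> (m - r)) = \<zero>\<^bsub>B\<^esub>" if "r \<le> m" for r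
  proof (cases "r = 0 \<or> r = m")
    case True
    then show ?thesis using assms by auto
  next
    case False
    then show ?thesis using assms that by (simp add: qbinom_m)
  qed
  then have "(\<Oplus>\<^bsub>B\<^esub>r\<in>{..m}. qbinom q m r \<odot>\<^bsub>B\<^esub> (a [^]\<^bsub>B\<^esub> r \<otimes>\<^bsub>B\<^esub> b [^]\<^bsub>B\<^esub> (m - r))) = (\<Oplus>\<^bsub>B\<^esub>r\<in>{..m}. \<zero>\<^bsub>B\<^esub>)"
    by (intro B.finsum_cong') auto
  then show ?thesis by (simp add: B.q_binomial[OF assms(2-4)])
qed

section \<open>The Hopf algebra structure\<close>

sublocale TT: kalgebra_pair T T
  by (simp add: kalgebra_pair_def T_algebra_kalgebra)

abbreviation "TT \<equiv> tensor_algebra T T"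
abbreviation "P \<equiv> pure_tensor T T"

sublocale TT: kalgebra TT
  by (rule TT.tensor_kalgebra)

lemma pure_pow:
  assumes "a \<in> carrier T" "b \<in> carrier T"
  shows "P a b [^]\<^bsub>TT\<^esub> (k::nat) = P (a [^]\<^bsub>T\<^esub> k) (b [^]\<^bsub>T\<^esub> k)"
  using assms by (induction k) (simp_all add: TT.pure_tensor_one TT.pure_tensor_mult)

definition comult_gen :: "gen \<Rightarrow> ((gen list \<Rightarrow>\<^sub>0 'k) set \<times> (gen list \<Rightarrow>\<^sub>0 'k) set \<Rightarrow>\<^sub>0 'k) set"
  where "comult_gen = case_gen (P T.g T.g) (P T.h T.h) (P T.x T.h \<oplus>\<^bsub>TT\<^esub> P \<one>\<^bsub>T\<^esub> T.x)"

text \<open>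
  The only relation that needs more than commuting tensor factors is \<open>(x \<otimes> h + 1 \<otimes> x) ^ m = 0\<close>. Here
  \<open>(1 \<otimes> x) (x \<otimes> h) = x \<otimes> x h = q (x \<otimes> h x) = q (x \<otimes> h) (1 \<otimes> x)\<close>.
\<close>

lemma comult_relations: "satisfies_T_relations TT m n q \<omega> comult_gen"
proof -
  have "comult_gen y \<in> carrier TT" for y
    by (cases y) (simp_all add: comult_gen_def)
  moreover have "P T.g T.g [^]\<^bsub>TT\<^esub> n = \<one>\<^bsub>TT\<^esub>" "P T.h T.h [^]\<^bsub>TT\<^esub> m = \<one>\<^bsub>TT\<^esub>"
    by (simp_all add: pure_pow T.g_pow T.h_pow TT.pure_tensor_one)
  moreover have "(P T.x T.h \<oplus>\<^bsub>TT\<^esub> P \<one>\<^bsub>T\<^esub> T.x) [^]\<^bsub>TT\<^esub> m = \<zero>\<^bsub>TT\<^esub>"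
    by (rule skew_power_sum_zero[OF TT.tensor_kalgebra])
      (simp_all add: TT.pure_tensor_mult T.xh TT.pure_tensor_smult_right pure_pow T.x_pow TT.pure_tensor_zero)
  moreover have "(P T.x T.h \<oplus>\<^bsub>TT\<^esub> P \<one>\<^bsub>T\<^esub> T.x) \<otimes>\<^bsub>TT\<^esub> P T.h T.h
      = q \<odot>\<^bsub>TT\<^esub> (P T.h T.h \<otimes>\<^bsub>TT\<^esub> (P T.x T.h \<oplus>\<^bsub>TT\<^esub> P \<one>\<^bsub>T\<^esub> T.x))"
    by (simp add: TT.l_distr TT.r_distr TT.pure_tensor_mult T.xh TT.pure_tensor_smult_right
        TT.pure_tensor_smult_left TT.smult_r_distr)
  moreover have "P T.h T.h \<otimes>\<^bsub>TT\<^esub> P T.g T.g = P T.g T.g \<otimes>\<^bsub>TT\<^esub> P T.h T.h"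
    by (simp add: TT.pure_tensor_mult T.hg)
  moreover have "P T.g T.g \<otimes>\<^bsub>TT\<^esub> (P T.x T.h \<oplus>\<^bsub>TT\<^esub> P \<one>\<^bsub>T\<^esub> T.x)
      = \<omega> \<odot>\<^bsub>TT\<^esub> ((P T.x T.h \<oplus>\<^bsub>TT\<^esub> P \<one>\<^bsub>T\<^esub> T.x) \<otimes>\<^bsub>TT\<^esub> P T.g T.g)"
    by (simp add: TT.l_distr TT.r_distr TT.pure_tensor_mult T.gx T.hg TT.pure_tensor_smult_right
        TT.pure_tensor_smult_left TT.smult_r_distr)
  ultimately show ?thesis
    unfolding satisfies_T_relations_def comult_gen_def by simp
qed

definition "Delta = induced_map (free_hom TT comult_gen)"

lemma Delta_hom: "Delta \<in> algebra_homs T TT"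
  unfolding Delta_def by (rule T_lift_hom[OF TT.tensor_kalgebra comult_relations])

lemma Delta_gen: "Delta (T_gen m n q \<omega> y) = comult_gen y"
  unfolding Delta_def by (rule T_lift_gen[OF TT.tensor_kalgebra comult_relations])

lemma Delta_mono:
  "Delta (T.mono (i, j, k)) =
    (\<Oplus>\<^bsub>TT\<^esub>r\<in>{..k}. qbinom q k r \<odot>\<^bsub>TT\<^esub> P (T.mono (i, j, r)) (T.mono (i, j + r, k - r)))"
proof -
  let ?u = "T.g [^]\<^bsub>T\<^esub> i \<otimes>\<^bsub>T\<^esub> T.h [^]\<^bsub>T\<^esub> j"
  have "Delta (T.mono (i, j, k)) = P ?u ?u \<otimes>\<^bsub>TT\<^esub> (P T.x T.h \<oplus>\<^bsub>TT\<^esub> P \<one>\<^bsub>T\<^esub> T.x) [^]\<^bsub>TT\<^esub> k"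
    by (simp add: T.mono_def algebra_homsD[OF Delta_hom] algebra_homs_pow[OF T_algebra_kalgebra Delta_hom]
        Delta_gen comult_gen_def pure_pow TT.pure_tensor_mult)
  also have "(P T.x T.h \<oplus>\<^bsub>TT\<^esub> P \<one>\<^bsub>T\<^esub> T.x) [^]\<^bsub>TT\<^esub> k
      = (\<Oplus>\<^bsub>TT\<^esub>r\<in>{..k}. qbinom q k r \<odot>\<^bsub>TT\<^esub> (P T.x T.h [^]\<^bsub>TT\<^esub> r \<otimes>\<^bsub>TT\<^esub> P \<one>\<^bsub>T\<^esub> T.x [^]\<^bsub>TT\<^esub> (k - r)))"
    by (rule TT.q_binomial) (simp_all add: TT.pure_tensor_mult T.xh TT.pure_tensor_smult_right)
  also have "\<dots> = (\<Oplus>\<^bsub>TT\<^esub>r\<in>{..k}. qbinom q k r \<odot>\<^bsub>TT\<^esub> P (T.x [^]\<^bsub>T\<^esub> r) (T.h [^]\<^bsub>T\<^esub> r \<otimes>\<^bsub>T\<^esub> T.x [^]\<^bsub>T\<^esub> (k - r)))"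
    by (rule TT.finsum_cong') (auto simp: pure_pow TT.pure_tensor_mult)
  also have "P ?u ?u \<otimes>\<^bsub>TT\<^esub> \<dots>
      = (\<Oplus>\<^bsub>TT\<^esub>r\<in>{..k}. P ?u ?u \<otimes>\<^bsub>TT\<^esub> (qbinom q k r \<odot>\<^bsub>TT\<^esub> P (T.x [^]\<^bsub>T\<^esub> r) (T.h [^]\<^bsub>T\<^esub> r \<otimes>\<^bsub>T\<^esub> T.x [^]\<^bsub>T\<^esub> (k - r))))"
    by (rule TT.finsum_rdistr) auto
  also have "\<dots> = (\<Oplus>\<^bsub>TT\<^esub>r\<in>{..k}. qbinom q k r \<odot>\<^bsub>TT\<^esub> P (T.mono (i, j, r)) (T.mono (i, j + r, k - r)))"
    by (rule TT.finsum_cong')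
      (auto simp: TT.smult_mult_right TT.pure_tensor_mult T.mono_def T.m_assoc T.nat_pow_mult[symmetric])
  finally show ?thesis .
qed

text \<open>
  The coefficient of \<open>g\<^sup>a h\<^sup>b x\<^sup>c \<otimes> g ^ a' h ^ b' x ^ c'\<close> in the comultiplication of \<open>v\<close>. Only the monomial
  \<open>g\<^sup>a h\<^sup>b x ^ (c + c')\<close> of \<open>v\<close> contributes to it.
\<close>

lemma comult_coord:
  assumes v: "v \<in> carrier T" and abc: "(a, b, c) \<in> box" and abc': "(a', b', c') \<in> box"
  shows "tensor_functional (coord (a, b, c)) (coord (a', b', c')) (Delta v) =
    (if a' = a \<and> b' = (b + c) mod m \<and> c + c' < m then coord (a, b, c + c') v * qbinom q (c + c') c else 0)"
proof -
  have cc: "coord (a, b, c) \<in> linear_maps T ground_algebra" "coord (a', b', c') \<in> linear_maps T ground_algebra"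
    using abc abc' by (auto intro: coord_linear)
  let ?F = "tensor_functional (coord (a, b, c)) (coord (a', b', c'))"
  have F: "?F \<in> linear_maps TT ground_algebra"
    by (rule tensor_functional(1)[OF T_algebra_kalgebra T_algebra_kalgebra cc])
  have FP: "?F (P u w) = coord (a, b, c) u * coord (a', b', c') w" if "u \<in> carrier T" "w \<in> carrier T" for u w
    by (rule tensor_functional(2)[OF T_algebra_kalgebra T_algebra_kalgebra cc that])
  let ?e = "\<lambda>i j k. if i = a \<and> j = b \<and> a' = a \<and> b' = (b + c) mod m \<and> k = c + c' then qbinom q k c else 0"
  have mono: "?F (Delta (T.mono (i, j, k))) = ?e i j k" if p: "(i, j, k) \<in> box" for i j k
  proof -
    have "?F (Delta (T.mono (i, j, k)))
        = (\<Sum>r\<le>k. ?F (qbinom q k r \<odot>\<^bsub>TT\<^esub> P (T.mono (i, j, r)) (T.mono (i, j + r, k - r))))"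
      unfolding Delta_mono
      by (subst linear_maps_finsum[OF TT.tensor_kalgebra ground_algebra_kalgebra F]) (auto simp: finsum_ground)
    also have "\<dots> = (\<Sum>r\<le>k. if r = c then
        (if i = a \<and> j = b \<and> i = a' \<and> (j + c) mod m = b' \<and> k - c = c' then qbinom q k c else 0) else 0)"
      using p abc abc' by (intro sum.cong) (auto simp: linear_mapsD[OF F] FP coord_mono)
    also have "\<dots> = ?e i j k"
      by (auto simp: qbinom_eq_0)
    finally show ?thesis .
  qed
  have "?F (Delta v) = (\<Sum>p\<in>box. coord p v * ?F (Delta (T.mono p)))"
    using functional_expand[OF linear_maps_comp[OF algebra_homsD(1)[OF Delta_hom] F] v] .
  also have "\<dots> = (\<Sum>p\<in>box. if p = (a, b, c + c') then
      (if a' = a \<and> b' = (b + c) mod m then coord p v * qbinom q (c + c') c else 0) else 0)"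
  proof (rule sum.cong)
    fix p assume "p \<in> box"
    then show "coord p v * ?F (Delta (T.mono p)) = (if p = (a, b, c + c') then
      (if a' = a \<and> b' = (b + c) mod m then coord p v * qbinom q (c + c') c else 0) else 0)"
      by (cases p) (simp add: mono)
  qed simp
  also have "\<dots> = (if a' = a \<and> b' = (b + c) mod m \<and> c + c' < m then coord (a, b, c + c') v * qbinom q (c + c') c else 0)"
    using abc by (subst sum.delta) auto
  finally show ?thesis .
qed

definition "epsilon = induced_map (free_hom ground_algebra (case_gen 1 1 (0::'k)))"

lemma counit_relations: "satisfies_T_relations ground_algebra m n q \<omega> (case_gen 1 1 (0::'k))"
  using m_ge by (simp add: satisfies_T_relations_def)

lemma epsilon_hom: "epsilon \<in> algebra_homs T ground_algebra"
  unfolding epsilon_def by (rule T_lift_hom[OF ground_algebra_kalgebra counit_relations])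

lemma epsilon_gen: "epsilon (T_gen m n q \<omega> y) = case_gen 1 1 0 y"
  unfolding epsilon_def by (rule T_lift_gen[OF ground_algebra_kalgebra counit_relations])

definition antipode_gen :: "gen \<Rightarrow> (gen list \<Rightarrow>\<^sub>0 'k) set"
  where "antipode_gen = case_gen (T.g [^]\<^bsub>T\<^esub> (n - 1)) (T.h [^]\<^bsub>T\<^esub> (m - 1))
    (\<ominus>\<^bsub>T\<^esub> (T.x \<otimes>\<^bsub>T\<^esub> T.h [^]\<^bsub>T\<^esub> (m - 1)))"

definition "antip = induced_map (free_antihom T antipode_gen)"

lemma antipode_gen_closed: "antipode_gen y \<in> carrier T"
  by (cases y) (simp_all add: antipode_gen_def)

lemma mono_g_pow: "T.g [^]\<^bsub>T\<^esub> k = T.mono (k, 0, 0)" and mono_h_pow: "T.h [^]\<^bsub>T\<^esub> k = T.mono (0, k, 0)"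
  by (simp_all add: T.mono_def)

lemma mono_pow: "\<exists>C. T.mono (i, j, k) [^]\<^bsub>T\<^esub> (r::nat) = C \<odot>\<^bsub>T\<^esub> T.mono (r * i, r * j, r * k)"
proof (induction r)
  case 0
  then show ?case by (auto simp: T.mono_zero intro!: exI[of _ 1])
next
  case (Suc r)
  then obtain C where "T.mono (i, j, k) [^]\<^bsub>T\<^esub> r = C \<odot>\<^bsub>T\<^esub> T.mono (r * i, r * j, r * k)" by auto
  then show ?case
    by (auto simp: T.mono_mult T.smult_mult_left T.smult_smult add.commute)
qed

lemma antipode_x: "antipode_gen gen_x = (- (q ^ (m - 1))) \<odot>\<^bsub>T\<^esub> T.mono (0, m - 1, 1)"
proof -
  have "T.x \<otimes>\<^bsub>T\<^esub> T.h [^]\<^bsub>T\<^esub> (m - 1) = T.mono (0, 0, 1) \<otimes>\<^bsub>T\<^esub> T.mono (0, m - 1, 0)"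
    by (simp only: T.mono_gen mono_h_pow)
  also have "\<dots> = q ^ (m - 1) \<odot>\<^bsub>T\<^esub> T.mono (0, m - 1, 1)" by (simp add: T.mono_mult)
  finally show ?thesis
    by (simp add: antipode_gen_def T.smult_smult flip: T.smult_minus_one)
qed

text \<open>
  With \<open>S g = g\<^sup>-\<^sup>1\<close>, \<open>S h = h\<^sup>-\<^sup>1\<close> and \<open>S x = - x h\<^sup>-\<^sup>1\<close>, everything is a multiple of a monomial, and the
  relations of the opposite algebra become comparisons of scalars.
\<close>

lemma antipode_relations: "satisfies_T_relations (opposite T) m n q \<omega> antipode_gen"
proof -
  have g: "antipode_gen gen_g = T.mono (n - 1, 0, 0)" and h: "antipode_gen gen_h = T.mono (0, m - 1, 0)"
    by (simp_all add: antipode_gen_def mono_g_pow mono_h_pow)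
  have q1: "q * q ^ (m - 1) = 1" using q_power m_ge by (metis Suc_diff_1 T.m_pos power_Suc)
  have w1: "inverse \<omega> ^ (n - 1) = \<omega>"
  proof -
    have "inverse \<omega> * inverse \<omega> ^ (n - 1) = 1"
      using inverse_\<omega>_power n_ge by (metis Suc_diff_1 T.n_pos power_Suc)
    then show ?thesis using T.\<omega>_nonzero by (metis inverse_inverse_eq inverse_unique)
  qed
  have gp: "T.mono (n - 1, 0, 0) [^]\<^bsub>T\<^esub> n = \<one>\<^bsub>T\<^esub>"
    by (metis T.\<phi>_closed T.g_pow T.nat_pow_one T.nat_pow_pow mono_g_pow mult.commute)
  have hp: "T.mono (0, m - 1, 0) [^]\<^bsub>T\<^esub> m = \<one>\<^bsub>T\<^esub>"
    by (metis T.\<phi>_closed T.h_pow T.nat_pow_one T.nat_pow_pow mono_h_pow mult.commute)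
  have xp: "(c \<odot>\<^bsub>T\<^esub> T.mono (0, m - 1, 1)) [^]\<^bsub>T\<^esub> m = \<zero>\<^bsub>T\<^esub>" for c
    using mono_pow[of 0 "m - 1" 1 m] by (auto simp: T.smult_pow T.mono_high)
  show ?thesis
    unfolding satisfies_T_relations_def antipode_x g h
    using antipode_gen_closed q1 w1
    by (simp add: opposite_pow[OF T_algebra_kalgebra] gp[unfolded One_nat_def] hp[unfolded One_nat_def] xp[unfolded One_nat_def] T.smult_mult_left T.smult_mult_right
        T.mono_mult T.smult_smult mult.assoc[symmetric] mult.commute mult.left_commute add.commute)
qed

lemma antip_eq: "antip = induced_map (free_hom (opposite T) antipode_gen)"
  unfolding antip_def by (subst free_antihom_eq[OF T_algebra_kalgebra]) (simp_all add: antipode_gen_closed)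

lemma antip_hom: "antip \<in> algebra_homs T (opposite T)"
  unfolding antip_eq by (rule T_lift_hom[OF opposite_kalgebra[OF T_algebra_kalgebra] antipode_relations])

lemma antip_gen: "antip (T_gen m n q \<omega> y) = antipode_gen y"
  unfolding antip_eq by (rule T_lift_gen[OF opposite_kalgebra[OF T_algebra_kalgebra] antipode_relations])

abbreviation "H \<equiv> T_hopf m n q \<omega>"

lemma T_hopf_simps [simp]:
  "carrier H = carrier T" "monoid.mult H = monoid.mult T" "\<one>\<^bsub>H\<^esub> = \<one>\<^bsub>T\<^esub>" "add H = add T" "\<zero>\<^bsub>H\<^esub> = \<zero>\<^bsub>T\<^esub>"
  "module.smult H = module.smult T"
  "comult H = Delta" "counit H = epsilon" "antipode H = antip"
  by (simp_all add: T_hopf_def Let_def module.extend_def hopf.fields_def Delta_def comult_gen_def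
      epsilon_def antip_def antipode_gen_def)

text \<open>
  The tensor square refers only to the underlying algebra of the Hopf algebra.
\<close>

lemma tensor_H: "tensor_null H H = tensor_null T T" "tensor_algebra H H = TT" "pure_tensor H H = P"
proof -
  show 0: "tensor_null H H = tensor_null T T"
    by (simp add: tensor_null_def tensor_relations_def)
  show "tensor_algebra H H = TT"
    by (simp add: tensor_algebra_def 0 DirProd_def)
  show "pure_tensor H H = P"
    by (simp add: pure_tensor_def[abs_def] 0 DirProd_def)
qed

lemma tensor_map_H: "tensor_map H H = tensor_map T T"
  by (simp add: tensor_map_def[abs_def] tensor_H)

lemma hopf_hom_iff:
  "f \<in> hopf_hom H H \<longleftrightarrow> f \<in> algebra_homs T T \<and> (\<forall>a\<in>carrier T.
    Delta (f a) = tensor_map T T f f (Delta a) \<and> epsilon (f a) = epsilon a \<and> antip (f a) = f (antip a))"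
  by (auto simp: hopf_hom_def ring_hom_def algebra_homs_def linear_maps_def tensor_map_H)

end


context T_parameters
begin

section \<open>Grouplike and skew-primitive elements\<close>

lemma box_linear: "p \<in> box \<Longrightarrow> coord p \<in> linear_maps T ground_algebra"
  by (cases p) (auto intro: coord_linear)

lemma coord_zero: "p \<in> box \<Longrightarrow> coord p \<zero>\<^bsub>T\<^esub> = 0"
  using linear_maps_zero[OF T_algebra_kalgebra ground_algebra_kalgebra box_linear] by simp

lemma coord_mono_box:
  assumes "p \<in> box" "p' \<in> box"
  shows "coord p (T.mono p') = (if p = p' then 1 else 0)"
  using assms by (cases p; cases p') (auto simp: coord_mono)

lemma functional_pure:
  assumes "p \<in> box" "p' \<in> box" "u \<in> carrier T" "w \<in> carrier T"
  shows "tensor_functional (coord p) (coord p') (P u w) = coord p u * coord p' w"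
  by (rule tensor_functional(2)[OF T_algebra_kalgebra T_algebra_kalgebra
        box_linear[OF assms(1)] box_linear[OF assms(2)] assms(3,4)])

lemma functional_linear:
  assumes "p \<in> box" "p' \<in> box"
  shows "tensor_functional (coord p) (coord p') \<in> linear_maps TT ground_algebra"
  by (rule tensor_functional(1)[OF T_algebra_kalgebra T_algebra_kalgebra
        box_linear[OF assms(1)] box_linear[OF assms(2)]])

text \<open>
  Let \<open>v_p\<close> be the coordinates of \<open>v\<close>, so that \<open>v_p v_p'\<close> are the coefficients of \<open>\<Delta> v = v \<otimes> v\<close>. Taking
  \<open>p = p' = (a, b, c)\<close> with \<open>0 < c < m\<close>, the coefficient formula gives \<open>v_p ^ 2 = 0\<close>, because the two tensor
  factors of a comultiplication differ there by \<open>h\<^sup>c\<close>. What remains lies in a group algebra, where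
  \<open>v_p v_p' = 0\<close> for \<open>p \<noteq> p'\<close> and \<open>v_p ^ 2 = v_p\<close>.
\<close>

lemma grouplike:
  assumes v: "v \<in> carrier T" "v \<noteq> \<zero>\<^bsub>T\<^esub>" and grouplike: "Delta v = P v v"
  obtains a b where "a < n" "b < m" "v = T.mono (a, b, 0)"
proof -
  have key: "coord (a, b, c) v * coord (a', b', c') v =
      (if a' = a \<and> b' = (b + c) mod m \<and> c + c' < m then coord (a, b, c + c') v * qbinom q (c + c') c else 0)"
    if "(a, b, c) \<in> box" "(a', b', c') \<in> box" for a b c a' b' c'
    using comult_coord[OF v(1) that] by (simp only: grouplike functional_pure[OF that v(1) v(1)])
  have high: "coord (a, b, c) v = 0" if "(a, b, c) \<in> box" "0 < c" for a b c
  proof -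
    have "(b + c) mod m \<noteq> b"
    proof
      assume "(b + c) mod m = b"
      then have "[b + c = b + 0] (mod m)" using that by (simp add: cong_def)
      then have "[c = 0] (mod m)" by (simp only: cong_add_lcancel_nat)
      then show False using that by (simp add: cong_def)
    qed
    then show ?thesis using key[OF that(1) that(1)] by simp
  qed
  have "\<exists>p\<in>box. coord p v \<noteq> 0"
  proof (rule ccontr)
    assume "\<not> ?thesis"
    then have "v = \<zero>\<^bsub>T\<^esub>" using v by (intro coord_eqI) (auto simp: coord_zero)
    then show False using v by simp
  qed
  then obtain a b c where abc: "(a, b, c) \<in> box" "coord (a, b, c) v \<noteq> 0" by auto
  then have c: "c = 0" using high by blast
  have one: "coord (a, b, 0) v = 1"
    using key[of a b 0 a b 0] abc c by simp
  have other: "coord (a', b', c') v = 0" if "(a', b', c') \<in> box" "(a', b', c') \<noteq> (a, b, 0)" for a' b' c'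
  proof (cases "c' = 0")
    case True
    then show ?thesis using key[of a b 0 a' b' 0] abc c that one by (auto split: if_splits)
  qed (use high that in auto)
  have "v = T.mono (a, b, 0)"
  proof (rule coord_eqI[OF v(1)])
    fix p assume p: "p \<in> box"
    then show "coord p v = coord p (T.mono (a, b, 0))"
      using coord_mono_box[OF p, of "(a, b, 0)"] abc c one other by (cases p) auto
  qed simp
  then show ?thesis using that abc by auto
qed

text \<open>
  Both facts compare one coefficient of the two sides. For \<open>k \<ge> 2\<close> the coefficient at
  \<open>g\<^sup>a h\<^sup>b x \<otimes> g\<^sup>a h ^ (b + 1) x ^ (k - 1)\<close> is \<open>[k]\<close> times that of \<open>y\<close> at \<open>(a, b, k)\<close> on the left and zero on
  the right, and \<open>[k] \<noteq> 0\<close>. For \<open>k = 1\<close> the coefficient at \<open>g\<^sup>a h\<^sup>b \<otimes> g\<^sup>a h\<^sup>b x\<close> is used, and for the second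
  fact that at \<open>x \<otimes> h\<close>.
\<close>

lemma skew_primitive:
  assumes y: "y \<in> carrier T" and s: "s1 < n" "s2 < m"
    and skew: "Delta y = P y (T.mono (s1, s2, 0)) \<oplus>\<^bsub>TT\<^esub> P \<one>\<^bsub>T\<^esub> y"
  shows "\<And>a b k. (a, b, k) \<in> box \<Longrightarrow> 0 < k \<Longrightarrow> (a, b, k) \<noteq> (0, 0, 1) \<Longrightarrow> coord (a, b, k) y = 0"
    and "coord (0, 0, 1) y \<noteq> 0 \<Longrightarrow> s1 = 0 \<and> s2 = 1"
proof -
  let ?u = "T.mono (s1, s2, 0)"
  have key: "coord p y * coord p' ?u + coord p (T.mono (0, 0, 0)) * coord p' y =
      tensor_functional (coord p) (coord p') (Delta y)" if "p \<in> box" "p' \<in> box" for p p'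
    unfolding skew using linear_mapsD(2)[OF functional_linear[OF that], of "P y ?u" "P \<one>\<^bsub>T\<^esub> y"] y that
    by (simp add: functional_pure T.mono_zero)
  have u_box: "(s1, s2, 0) \<in> box" and one_box: "(0, 0, 0) \<in> box" using s m_ge n_ge by auto
  note ev = coord_mono_box[OF _ u_box] coord_mono_box[OF _ one_box]
  show "coord (a, b, k) y = 0" if k: "(a, b, k) \<in> box" "0 < k" "(a, b, k) \<noteq> (0, 0, 1)" for a b k
  proof (cases "k = 1")
    case True
    then have box: "(a, b, 0) \<in> box" "(a, b, 1) \<in> box" using k by auto
    show ?thesis
      using key[OF box] comult_coord[OF y box] box k True by (auto simp: ev)
  next
    case False
    then have box: "(a, b, 1) \<in> box" "(a, (b + 1) mod m, k - 1) \<in> box" using k m_ge by auto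
    have kk: "1 + (k - 1) = k" "k < m" using k by auto
    have "coord (a, b, k) y * qbinom q k 1 = 0"
      using key[OF box] comult_coord[OF y box, unfolded kk(1)] box k False kk(2)
      by (simp add: ev del: mem_Sigma_iff)
    then show ?thesis using qbinom_1_nonzero k by auto
  qed
  assume nz: "coord (0, 0, 1) y \<noteq> 0"
  have box: "(0, 0, 1) \<in> box" "(0, 1, 0) \<in> box" using m_ge n_ge by auto
  have "coord (0, 0, 1) y * coord (0, 1, 0) ?u = coord (0, 0, 1) y"
    using key[OF box] comult_coord[OF y box] box m_ge by (simp add: ev del: mem_Sigma_iff)
  then have "coord (0, 1, 0) ?u = 1" using nz by simp
  then show "s1 = 0 \<and> s2 = 1" using ev(1)[OF box(2)] by (auto split: if_splits)
qed

lemma degree_zero_commute: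
  assumes v: "v \<in> carrier T" and deg: "\<And>i j k. (i, j, k) \<in> box \<Longrightarrow> 0 < k \<Longrightarrow> coord (i, j, k) v = 0"
  shows "v \<otimes>\<^bsub>T\<^esub> T.mono (a, b, 0) = T.mono (a, b, 0) \<otimes>\<^bsub>T\<^esub> v"
proof -
  let ?u = "T.mono (a, b, 0)" and ?t = "\<lambda>p. coord p v \<odot>\<^bsub>T\<^esub> T.mono p"
  have comm: "?t p \<otimes>\<^bsub>T\<^esub> ?u = ?u \<otimes>\<^bsub>T\<^esub> ?t p" if p: "p \<in> box" for p
  proof -
    obtain i j k where ijk: "p = (i, j, k)" by (cases p)
    show ?thesis
    proof (cases "k = 0")
      case True
      then show ?thesis
        by (simp add: ijk T.smult_mult_left T.smult_mult_right T.mono_mult add.commute)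
    next
      case False
      then show ?thesis using deg[of i j k] p by (simp add: ijk)
    qed
  qed
  have "v \<otimes>\<^bsub>T\<^esub> ?u = (\<Oplus>\<^bsub>T\<^esub>p\<in>box. ?t p) \<otimes>\<^bsub>T\<^esub> ?u" using expand[OF v] by simp
  also have "\<dots> = (\<Oplus>\<^bsub>T\<^esub>p\<in>box. ?t p \<otimes>\<^bsub>T\<^esub> ?u)" by (rule T.finsum_ldistr) auto
  also have "\<dots> = (\<Oplus>\<^bsub>T\<^esub>p\<in>box. ?u \<otimes>\<^bsub>T\<^esub> ?t p)" 
    by (rule T.finsum_cong') (simp_all only: comm, auto)
  also have "\<dots> = ?u \<otimes>\<^bsub>T\<^esub> (\<Oplus>\<^bsub>T\<^esub>p\<in>box. ?t p)" by (rule T.finsum_rdistr[symmetric]) auto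
  also have "\<dots> = ?u \<otimes>\<^bsub>T\<^esub> v" using expand[OF v] by simp
  finally show ?thesis .
qed

lemma mono_invertible: "T.mono (a, b, 0) \<otimes>\<^bsub>T\<^esub> T.mono ((n - 1) * a, (m - 1) * b, 0) = \<one>\<^bsub>T\<^esub>"
proof -
  obtain n' m' where nm: "n = Suc n'" "m = Suc m'" using T.n_pos T.m_pos by (metis Suc_pred)
  have "a + (n - 1) * a = n * a" "b + (m - 1) * b = m * b" by (simp_all add: nm)
  then show ?thesis
    using T.mono_mod[of "n * a" "m * b" 0] by (simp add: T.mono_mult T.mono_zero)
qed

text \<open>
  The element \<open>v u\<close> is annihilated by \<open>1 - q \<noteq> 0\<close>, and \<open>u = g\<^sup>a h\<^sup>b\<close> is invertible.
\<close>

lemma skew_self_zero: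
  assumes v: "v \<in> carrier T" and eq: "v \<otimes>\<^bsub>T\<^esub> T.mono (a, b, 0) = q \<odot>\<^bsub>T\<^esub> (v \<otimes>\<^bsub>T\<^esub> T.mono (a, b, 0))"
  shows "v = \<zero>\<^bsub>T\<^esub>"
proof -
  let ?u = "T.mono (a, b, 0)" and ?w = "T.mono ((n - 1) * a, (m - 1) * b, 0)"
  have q1: "1 - q \<noteq> 0" using q_primitive[of 1] m_ge by simp
  define w where "w = v \<otimes>\<^bsub>T\<^esub> ?u"
  have w: "w \<in> carrier T" "w = q \<odot>\<^bsub>T\<^esub> w" using v eq by (simp_all add: w_def)
  have "(1 - q) \<odot>\<^bsub>T\<^esub> w \<oplus>\<^bsub>T\<^esub> q \<odot>\<^bsub>T\<^esub> w = w"
    using T.smult_l_distr[OF w(1), of "1 - q" q] w(1) by simp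
  then have "(1 - q) \<odot>\<^bsub>T\<^esub> w \<oplus>\<^bsub>T\<^esub> w = w" by (simp only: w(2)[symmetric])
  then have "(1 - q) \<odot>\<^bsub>T\<^esub> w = \<zero>\<^bsub>T\<^esub>"
    using w(1) by (simp only: T.add.r_cancel_one T.smult_closed)
  then have "(1 - q) \<odot>\<^bsub>T\<^esub> (v \<otimes>\<^bsub>T\<^esub> ?u) = \<zero>\<^bsub>T\<^esub>" by (simp only: w_def)
  then have "inverse (1 - q) \<odot>\<^bsub>T\<^esub> ((1 - q) \<odot>\<^bsub>T\<^esub> (v \<otimes>\<^bsub>T\<^esub> ?u)) = \<zero>\<^bsub>T\<^esub>" by simp
  then have "v \<otimes>\<^bsub>T\<^esub> ?u = \<zero>\<^bsub>T\<^esub>" using v q1 by (simp add: T.smult_smult)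
  then have "v \<otimes>\<^bsub>T\<^esub> (?u \<otimes>\<^bsub>T\<^esub> ?w) = \<zero>\<^bsub>T\<^esub>" using v by (simp flip: T.m_assoc)
  then show ?thesis using v by (simp only: mono_invertible T.r_one)
qed

section \<open>Classification of the automorphisms\<close>

lemma mono_degree_zero_pow: "T.mono (a, b, 0) [^]\<^bsub>T\<^esub> (k::nat) = T.mono (a * k, b * k, 0)"
  by (induction k) (simp_all add: T.mono_zero T.mono_mult add.commute)

lemma hom_mono:
  assumes f: "f \<in> algebra_homs T T" and fg: "f T.g = T.mono (s, l, 0)" and fh: "f T.h = T.h"
  shows "f (T.mono (i, j, 0)) = T.mono (s * i, l * i + j, 0)"
proof -
  have "T.mono (i, j, 0) = T.g [^]\<^bsub>T\<^esub> i \<otimes>\<^bsub>T\<^esub> T.h [^]\<^bsub>T\<^esub> j" by (simp add: T.mono_def)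
  then have "f (T.mono (i, j, 0)) = T.mono (s, l, 0) [^]\<^bsub>T\<^esub> i \<otimes>\<^bsub>T\<^esub> T.h [^]\<^bsub>T\<^esub> j"
    by (simp add: algebra_homsD[OF f] algebra_homs_pow[OF T_algebra_kalgebra f] fg fh)
  then show ?thesis by (simp add: mono_degree_zero_pow mono_h_pow T.mono_mult)
qed

text \<open>
  The element \<open>y0\<close> below is \<open>f x - c x\<close>, where \<open>c\<close> is the coefficient of \<open>x\<close> in \<open>f x\<close>. It commutes with
  \<open>f h\<close>, being a combination of grouplikes, and up to the factor \<open>q\<close> by the image of \<open>x h = q h x\<close>;
  so it is zero.
\<close>

theorem automorphism_classification:
  assumes f: "f \<in> hopf_hom H H" and bij: "bij_betw f (carrier T) (carrier T)"
  obtains c l s where "c \<noteq> 0" "l < m" "s < n" "coprime s n" "\<omega> ^ s = \<omega> * q ^ l"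
    "f T.g = T.mono (s, l, 0)" "f T.h = T.h" "f T.x = c \<odot>\<^bsub>T\<^esub> T.x"
proof -
  have fa: "f \<in> algebra_homs T T" and fD: "\<And>a. a \<in> carrier T \<Longrightarrow> Delta (f a) = tensor_map T T f f (Delta a)"
    using f by (auto simp: hopf_hom_iff)
  note fh = algebra_homsD[OF fa]
  note TK = T_algebra_kalgebra[of m n q \<omega>]
  note tm = tensor_map_hom[OF TK TK TK TK fa fa]
  have inj: "a = b" if "a \<in> carrier T" "b \<in> carrier T" "f a = f b" for a b
    using bij that by (auto simp: bij_betw_def inj_on_def)
  have f0: "f \<zero>\<^bsub>T\<^esub> = \<zero>\<^bsub>T\<^esub>" by (rule linear_maps_zero[OF TK TK fh(1)])
  have nz: "T.mono p \<noteq> \<zero>\<^bsub>T\<^esub>" if "p \<in> box" for p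
    using coord_mono_box[OF that that] coord_zero[OF that] by auto
  have fnz: "f (T.mono p) \<noteq> \<zero>\<^bsub>T\<^esub>" if "p \<in> box" for p
    using inj[of "T.mono p" "\<zero>\<^bsub>T\<^esub>"] f0 nz[OF that] by auto
  \<comment> \<open>The exponent \<open>1 mod n\<close> keeps \<open>g\<close> inside the box of basis indices even for \<open>n = 1\<close>.\<close>
  have gens: "T.mono (1 mod n, 0, 0) = T.g" "T.mono (0, 1, 0) = T.h" "T.mono (0, 0, 1) = T.x"
    using T.mono_mod[of 1 0 0] T.mono_gen by auto
  have gbox: "(1 mod n, 0, 0) \<in> box" "(0, 1, 0) \<in> box" "(0, 0, 1) \<in> box" using m_ge n_ge by auto
  have "Delta (f T.g) = P (f T.g) (f T.g)" "Delta (f T.h) = P (f T.h) (f T.h)"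
    by (simp_all add: fD Delta_gen comult_gen_def tm(2))
  \<comment> \<open>The exponents of the images of \<open>g\<close> and \<open>h\<close>; that \<open>f h = h\<close> is not known yet.\<close>
  then obtain s l u1 u2 where sl: "s < n" "l < m" "f T.g = T.mono (s, l, 0)"
    and u: "u1 < n" "u2 < m" "f T.h = T.mono (u1, u2, 0)"
    using grouplike[of "f T.g"] grouplike[of "f T.h"] fnz[OF gbox(1)] fnz[OF gbox(2)] fh(4) gens
    by (metis T.\<phi>_closed)
  define y where "y = f T.x"
  define c where "c = coord (0, 0, 1) y"
  define y0 where "y0 = y \<oplus>\<^bsub>T\<^esub> (- c) \<odot>\<^bsub>T\<^esub> T.x"
  have y: "y \<in> carrier T" by (simp add: y_def fh)
  have y0: "y0 \<in> carrier T" using y by (simp add: y0_def)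
  have y_eq: "y = y0 \<oplus>\<^bsub>T\<^esub> c \<odot>\<^bsub>T\<^esub> T.x"
    using y by (simp add: y0_def T.a_assoc flip: T.smult_l_distr)
  have "Delta y = P y (T.mono (u1, u2, 0)) \<oplus>\<^bsub>TT\<^esub> P \<one>\<^bsub>T\<^esub> y"
    by (simp add: y_def fD Delta_gen comult_gen_def algebra_homsD[OF tm(1)] tm(2) fh u(3))
  note skew = skew_primitive[OF y u(1,2) this]
  have "coord (i, j, k) y0 = 0" if p: "(i, j, k) \<in> box" "0 < k" for i j k
    using skew(1)[OF p] coord_mono_box[OF p(1) gbox(3)] y linear_mapsD[OF box_linear[OF p(1)]]
    unfolding y0_def c_def gens(3)[symmetric] by auto
  note comm = degree_zero_commute[OF y0 this]
  have yh: "y \<otimes>\<^bsub>T\<^esub> T.mono (u1, u2, 0) = q \<odot>\<^bsub>T\<^esub> (T.mono (u1, u2, 0) \<otimes>\<^bsub>T\<^esub> y)"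
    using arg_cong[OF T.xh, of f] by (simp add: fh y_def u(3))
  have "y0 \<otimes>\<^bsub>T\<^esub> T.mono (u1, u2, 0) = q \<odot>\<^bsub>T\<^esub> (y0 \<otimes>\<^bsub>T\<^esub> T.mono (u1, u2, 0))"
  proof (cases "c = 0")
    case True
    then have "y = y0" using y_eq y0 by simp
    then show ?thesis using yh comm by simp
  next
    case False
    then have h: "T.mono (u1, u2, 0) = T.h" using skew(2) gens(2) by (simp add: c_def)
    have "y0 \<otimes>\<^bsub>T\<^esub> T.h \<oplus>\<^bsub>T\<^esub> (q * c) \<odot>\<^bsub>T\<^esub> (T.h \<otimes>\<^bsub>T\<^esub> T.x)
        = q \<odot>\<^bsub>T\<^esub> (T.h \<otimes>\<^bsub>T\<^esub> y0) \<oplus>\<^bsub>T\<^esub> (q * c) \<odot>\<^bsub>T\<^esub> (T.h \<otimes>\<^bsub>T\<^esub> T.x)"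
      using yh y0 unfolding h y_eq
      by (simp add: T.l_distr T.r_distr T.smult_mult_left T.smult_mult_right T.xh T.smult_smult
          T.smult_r_distr mult.commute)
    then show ?thesis using y0 comm[of u1 u2] by (simp add: h)
  qed
  then have "y0 = \<zero>\<^bsub>T\<^esub>" by (rule skew_self_zero[OF y0])
  then have yx: "y = c \<odot>\<^bsub>T\<^esub> T.x" using y_eq by simp
  have c: "c \<noteq> 0"
  proof
    assume "c = 0"
    then have "f T.x = \<zero>\<^bsub>T\<^esub>" using yx by (simp add: y_def)
    then show False using fnz[OF gbox(3), unfolded gens(3)] by contradiction
  qed
  then have h: "f T.h = T.h" using skew(2) gens(2) u(3) by (simp add: c_def)
  have "\<omega> ^ s = \<omega> * q ^ l"
  proof -
    have "f T.g \<otimes>\<^bsub>T\<^esub> y = \<omega> \<odot>\<^bsub>T\<^esub> (y \<otimes>\<^bsub>T\<^esub> f T.g)"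
      using arg_cong[OF T.gx, of f] by (simp add: fh y_def)
    then have "T.mono (s, l, 0) \<otimes>\<^bsub>T\<^esub> (c \<odot>\<^bsub>T\<^esub> T.mono (0, 0, 1)) = \<omega> \<odot>\<^bsub>T\<^esub> ((c \<odot>\<^bsub>T\<^esub> T.mono (0, 0, 1)) \<otimes>\<^bsub>T\<^esub> T.mono (s, l, 0))"
      by (simp only: yx sl(3) gens(3))
    then have e: "c \<odot>\<^bsub>T\<^esub> T.mono (s, l, 1) = (\<omega> * (c * (inverse \<omega> ^ s * q ^ l))) \<odot>\<^bsub>T\<^esub> T.mono (s, l, 1)"
      by (simp add: T.smult_mult_right T.smult_mult_left T.mono_mult T.smult_smult)
    have b: "(s, l, 1) \<in> box" using sl m_ge by auto
    have "c = \<omega> * (c * (inverse \<omega> ^ s * q ^ l))"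
      using arg_cong[OF e, of "coord (s, l, 1)"] coord_mono_box[OF b b] linear_mapsD(3)[OF box_linear[OF b]]
      by simp
    then show ?thesis using c T.\<omega>_nonzero by (simp add: field_simps power_inverse)
  qed
  moreover have "coprime s n"
  proof -
    define d where "d = gcd s n"
    have "d dvd n" "d dvd s" by (simp_all add: d_def)
    then obtain k s' where k: "n = d * k" "s = d * s'" unfolding dvd_def by blast
    have pos: "0 < k" "0 < d" using k n_ge by (auto intro!: Nat.gr0I)
    \<comment> \<open>With \<open>k = n / d\<close>, the power \<open>g\<^sup>k\<close> is sent to a power of \<open>h\<close>, which is the image of itself.\<close>
    have "(s * k) mod n = 0" by (simp add: k mult.assoc mult.left_commute[of s' d k])
    then have "f (T.mono (k, 0, 0)) = f (T.mono (0, l * k, 0))"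
      using T.mono_mod[of "s * k" "l * k" 0] T.mono_mod[of 0 "l * k" 0]
      by (simp add: hom_mono[OF fa sl(3) h])
    then have "T.mono (k, 0, 0) = T.mono (0, l * k, 0)"
      by (rule inj[OF T.mono_closed T.mono_closed])
    then have "k mod n = 0"
      using coord_mono[of 0 0 "l * k" 0 "l * k" 0] coord_mono[of 0 0 "l * k" k 0 0] m_ge
      by (auto split: if_splits)
    then have "n \<le> k" using pos by (intro dvd_imp_le) auto
    then have "d * k \<le> 1 * k" using k by simp
    then have "d = 1" using pos by (simp only: mult_le_cancel2) auto
    then show ?thesis by (simp add: d_def coprime_iff_gcd_eq_1)
  qed
  ultimately show ?thesis using that[of c l s] c sl h yx by (simp add: y_def)
qed

end


section \<open>Construction of the automorphisms\<close>

lemma algebra_homs_opposite: "f \<in> algebra_homs A B \<Longrightarrow> f \<in> algebra_homs (opposite A) (opposite B)"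
  by (auto simp: algebra_homs_def linear_maps_def)

context T_parameters
begin

definition auto_gen :: "'k \<Rightarrow> nat \<Rightarrow> nat \<Rightarrow> gen \<Rightarrow> (gen list \<Rightarrow>\<^sub>0 'k) set"
  where "auto_gen c l s = case_gen (T.mono (s, l, 0)) T.h (c \<odot>\<^bsub>T\<^esub> T.x)"

definition T_auto :: "'k \<Rightarrow> nat \<Rightarrow> nat \<Rightarrow> (gen list \<Rightarrow>\<^sub>0 'k) set \<Rightarrow> (gen list \<Rightarrow>\<^sub>0 'k) set"
  where "T_auto c l s = restrict (induced_map (free_hom T (auto_gen c l s))) (carrier T)"

lemma q_power_eq_1: "q ^ k = 1 \<Longrightarrow> m dvd k"
proof -
  assume "q ^ k = 1"
  then have "q ^ (k mod m) = 1"
    using power_mod_cong[OF q_power, of k "k mod m" 1] by simp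
  then have "k mod m = 0"
    using q_primitive[of "k mod m"] T.m_pos by (metis mod_less_divisor neq0_conv)
  then show ?thesis by auto
qed

text \<open>
  The condition says that \<open>q\<^sup>l\<close> is a quotient of powers of \<open>\<omega>\<close>, hence an \<open>n\<close>-th root of unity. This is the
  reason why exponents of \<open>h\<close> may be multiplied by residues modulo \<open>n\<close>.
\<close>

lemma compatible_dvd:
  assumes "\<omega> ^ s = \<omega> * q ^ l" shows "m dvd n * l"
proof (rule q_power_eq_1)
  have "(\<omega> ^ s) ^ n = 1" by (metis \<omega>_power mult.commute power_mult power_one)
  then show "q ^ (n * l) = 1"
    using assms by (simp add: power_mult_distrib \<omega>_power power_mult[symmetric] mult.commute)
qed

text \<open>
  The relation \<open>g\<^sup>n = 1\<close> holds for \<open>g\<^sup>s h\<^sup>l\<close> because \<open>m\<close> divides \<open>n l\<close>; the relation \<open>g x = \<omega> x g\<close> is the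
  compatibility condition between \<open>l\<close> and \<open>s\<close>.
\<close>

lemma auto_relations:
  assumes "\<omega> ^ s = \<omega> * q ^ l"
  shows "satisfies_T_relations T m n q \<omega> (auto_gen c l s)"
proof -
  have "auto_gen c l s y \<in> carrier T" for y by (cases y) (simp_all add: auto_gen_def)
  moreover have "T.mono (s, l, 0) [^]\<^bsub>T\<^esub> n = \<one>\<^bsub>T\<^esub>"
    using T.mono_mod[of "s * n" "l * n" 0] compatible_dvd[OF assms]
    by (simp add: mono_degree_zero_pow T.mono_zero mult.commute)
  moreover have "(c \<odot>\<^bsub>T\<^esub> T.x) [^]\<^bsub>T\<^esub> m = \<zero>\<^bsub>T\<^esub>" by (simp add: T.smult_pow T.x_pow)
  moreover have "(c \<odot>\<^bsub>T\<^esub> T.x) \<otimes>\<^bsub>T\<^esub> T.h = q \<odot>\<^bsub>T\<^esub> (T.h \<otimes>\<^bsub>T\<^esub> (c \<odot>\<^bsub>T\<^esub> T.x))"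
    by (simp add: T.smult_mult_left T.smult_mult_right T.xh T.smult_smult mult.commute)
  moreover have "T.mono (0, 1, 0) \<otimes>\<^bsub>T\<^esub> T.mono (s, l, 0) = T.mono (s, l, 0) \<otimes>\<^bsub>T\<^esub> T.mono (0, 1, 0)"
    by (simp add: T.mono_mult)
  moreover have "T.mono (s, l, 0) \<otimes>\<^bsub>T\<^esub> (c \<odot>\<^bsub>T\<^esub> T.mono (0, 0, 1))
      = \<omega> \<odot>\<^bsub>T\<^esub> ((c \<odot>\<^bsub>T\<^esub> T.mono (0, 0, 1)) \<otimes>\<^bsub>T\<^esub> T.mono (s, l, 0))"
  proof -
    have e: "\<omega> * (c * (inverse \<omega> ^ s * q ^ l)) = c"
      using assms T.\<omega>_nonzero T.q_nonzero by (simp add: power_inverse field_simps)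
    have "T.mono (s, l, 0) \<otimes>\<^bsub>T\<^esub> (c \<odot>\<^bsub>T\<^esub> T.mono (0, 0, 1)) = c \<odot>\<^bsub>T\<^esub> T.mono (s, l, 1)"
      by (simp add: T.smult_mult_right T.mono_mult)
    moreover have "\<omega> \<odot>\<^bsub>T\<^esub> ((c \<odot>\<^bsub>T\<^esub> T.mono (0, 0, 1)) \<otimes>\<^bsub>T\<^esub> T.mono (s, l, 0))
        = (\<omega> * (c * (inverse \<omega> ^ s * q ^ l))) \<odot>\<^bsub>T\<^esub> T.mono (s, l, 1)"
      by (simp add: T.smult_mult_left T.mono_mult T.smult_smult)
    ultimately show ?thesis by (simp only: e)
  qed
  ultimately show ?thesis
    unfolding satisfies_T_relations_def auto_gen_def by (simp add: T.h_pow T.mono_gen[unfolded One_nat_def])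
qed

context
  fixes c :: 'k and l s :: nat
  assumes compatible: "\<omega> ^ s = \<omega> * q ^ l"
begin

lemma T_auto_hom: "T_auto c l s \<in> algebra_homs T T"
  unfolding T_auto_def
  by (rule algebra_homs_restrict[OF T_algebra_kalgebra T_lift_hom[OF T_algebra_kalgebra auto_relations[OF compatible]]])

lemma T_auto_gen: "T_auto c l s (T_gen m n q \<omega> y) = auto_gen c l s y"
  unfolding T_auto_def by (simp add: T_lift_gen[OF T_algebra_kalgebra auto_relations[OF compatible]])

lemma T_auto_gens:
  "T_auto c l s T.g = T.mono (s, l, 0)" "T_auto c l s T.h = T.h" "T_auto c l s T.x = c \<odot>\<^bsub>T\<^esub> T.x"
  by (simp_all add: T_auto_gen auto_gen_def)

lemma T_auto_comult: 
  assumes "v \<in> carrier T"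
  shows "Delta (T_auto c l s v) = tensor_map T T (T_auto c l s) (T_auto c l s) (Delta v)"
proof -
  note TK = T_algebra_kalgebra[of m n q \<omega>]
  note tm = tensor_map_hom[OF TK TK TK TK T_auto_hom T_auto_hom]
  show ?thesis
  proof (rule T_hom_eqI[OF TT.tensor_kalgebra algebra_homs_comp[OF T_auto_hom Delta_hom]
        algebra_homs_comp[OF Delta_hom tm(1)] _ assms])
    fix y
    have "Delta (T.mono (s, l, 0)) = P (T.mono (s, l, 0)) (T.mono (s, l, 0))"
      by (simp add: Delta_mono)
    then show "Delta (T_auto c l s (T_gen m n q \<omega> y))
        = tensor_map T T (T_auto c l s) (T_auto c l s) (Delta (T_gen m n q \<omega> y))"
      by (cases y) (simp_all add: T_auto_gens Delta_gen comult_gen_def algebra_homsD[OF tm(1)] tm(2)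
          algebra_homsD[OF T_auto_hom] algebra_homsD[OF Delta_hom]
          TT.pure_tensor_smult_left TT.pure_tensor_smult_right TT.smult_r_distr)
  qed
qed

lemma T_auto_counit:
  assumes "v \<in> carrier T"
  shows "epsilon (T_auto c l s v) = epsilon v"
proof (rule T_hom_eqI[OF ground_algebra_kalgebra algebra_homs_comp[OF T_auto_hom epsilon_hom] epsilon_hom _ assms])
  fix y
  show "epsilon (T_auto c l s (T_gen m n q \<omega> y)) = epsilon (T_gen m n q \<omega> y)"
    by (cases y) (simp_all add: T_auto_gens T.mono_def algebra_homsD[OF epsilon_hom]
        algebra_homs_pow[OF T_algebra_kalgebra epsilon_hom] epsilon_gen)
qed

text \<open>
  On \<open>g\<close> the claim is that \<open>h ^ (l (m - 1))\<close> and \<open>h ^ (l (n - 1))\<close> agree. Both are \<open>h ^ (- l)\<close>, since \<open>m\<close>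
  divides \<open>n l\<close>.
\<close>

lemma T_auto_antipode:
  assumes "v \<in> carrier T"
  shows "antip (T_auto c l s v) = T_auto c l s (antip v)"
proof (rule T_hom_eqI[OF opposite_kalgebra[OF T_algebra_kalgebra] algebra_homs_comp[OF T_auto_hom antip_hom]
      algebra_homs_comp[OF antip_hom algebra_homs_opposite[OF T_auto_hom]] _ assms])
  fix y
  note TK = T_algebra_kalgebra[of m n q \<omega>]
  note S = algebra_homsD[OF antip_hom, simplified] and f = algebra_homsD[OF T_auto_hom]
  show "antip (T_auto c l s (T_gen m n q \<omega> y)) = T_auto c l s (antip (T_gen m n q \<omega> y))"
  proof (cases y)
    case gen_g
    have "antip (T.mono (s, l, 0)) = antip (T.h [^]\<^bsub>T\<^esub> l) \<otimes>\<^bsub>T\<^esub> antip (T.g [^]\<^bsub>T\<^esub> s)"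
      by (simp add: T.mono_def S)
    also have "\<dots> = T.mono (0, (m - 1) * l, 0) \<otimes>\<^bsub>T\<^esub> T.mono ((n - 1) * s, 0, 0)"
      by (simp add: algebra_homs_pow[OF TK antip_hom] opposite_pow[OF TK] antip_gen antipode_gen_closed)
        (simp add: antipode_gen_def mono_g_pow mono_h_pow mono_degree_zero_pow)
    also have "\<dots> = T.mono ((n - 1) * s, (m - 1) * l, 0)" by (simp add: T.mono_mult)
    also have "\<dots> = T.mono (s * (n - 1), l * (n - 1), 0)"
    proof -
      have "[l + (m - 1) * l = l + l * (n - 1)] (mod m)"
      proof -
        have e: "l + (m - 1) * l = m * l" "l + l * (n - 1) = n * l"
          using T.m_pos T.n_pos by (metis Suc_pred' mult.commute mult_Suc_right)+
        show ?thesis unfolding e using compatible_dvd[OF compatible] by (simp add: cong_def)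
      qed
      then have "((m - 1) * l) mod m = (l * (n - 1)) mod m"
        by (simp add: cong_add_lcancel_nat cong_def[symmetric])
      then show ?thesis
        using T.mono_mod[of "(n - 1) * s" "(m - 1) * l" 0] T.mono_mod[of "s * (n - 1)" "l * (n - 1)" 0]
        by (simp add: mult.commute)
    qed
    also have "\<dots> = T_auto c l s (T.mono (n - 1, 0, 0))"
      using hom_mono[OF T_auto_hom T_auto_gens(1,2), of "n - 1" 0] by simp
    finally show ?thesis
      by (simp add: gen_g T_auto_gens antip_gen antipode_gen_def mono_g_pow)
  next
    case gen_h
    show ?thesis
      by (simp add: gen_h T_auto_gens antip_gen)
        (simp add: antipode_gen_def algebra_homs_pow[OF TK T_auto_hom] T_auto_gens)
  next
    case gen_x
    have "T_auto c l s (T.x \<otimes>\<^bsub>T\<^esub> T.h [^]\<^bsub>T\<^esub> (m - 1)) = c \<odot>\<^bsub>T\<^esub> (T.x \<otimes>\<^bsub>T\<^esub> T.h [^]\<^bsub>T\<^esub> (m - 1))"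
      by (simp add: f algebra_homs_pow[OF TK T_auto_hom] T_auto_gens T.smult_mult_left)
    then have "T_auto c l s (antipode_gen gen_x) = c \<odot>\<^bsub>T\<^esub> antipode_gen gen_x"
      by (simp add: antipode_gen_def f T.smult_smult mult.commute flip: T.smult_minus_one)
    then show ?thesis by (simp add: gen_x T_auto_gens antip_gen S)
  qed
qed

lemma T_auto_hopf_hom: "T_auto c l s \<in> hopf_hom H H"
  by (simp add: hopf_hom_iff T_auto_hom T_auto_comult T_auto_counit T_auto_antipode)

end

lemma compatible_comp:
  assumes "\<omega> ^ s = \<omega> * q ^ l" "\<omega> ^ s' = \<omega> * q ^ l'"
  shows "\<omega> ^ (s' * s) = \<omega> * q ^ (l' + s' * l)"
proof -
  have "\<omega> ^ (s' * s) = (\<omega> ^ s) ^ s'" by (simp add: power_mult[symmetric] mult.commute)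
  also have "\<dots> = \<omega> ^ s' * q ^ (l * s')" by (simp add: assms(1) power_mult_distrib power_mult)
  also have "\<dots> = \<omega> * q ^ (l' + s' * l)" by (simp add: assms(2) power_add mult.commute mult.left_commute)
  finally show ?thesis .
qed

text \<open>
  On \<open>g\<close>, the first map gives \<open>g ^ s' h ^ l'\<close>, and the second sends this to \<open>(g\<^sup>s h\<^sup>l) ^ s' h ^ l'\<close>.
\<close>

lemma T_auto_comp:
  assumes "\<omega> ^ s = \<omega> * q ^ l" "\<omega> ^ s' = \<omega> * q ^ l'" "v \<in> carrier T"
  shows "T_auto c l s (T_auto c' l' s' v) = T_auto (c' * c) (l' + s' * l) (s' * s) v"
proof (rule T_hom_eqI[OF T_algebra_kalgebra algebra_homs_comp[OF T_auto_hom[OF assms(2)] T_auto_hom[OF assms(1)]]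
      T_auto_hom[OF compatible_comp[OF assms(1,2)]] _ assms(3)])
  fix y
  note f = T_auto_gens[OF assms(1)] and f' = T_auto_gens[OF assms(2)]
    and ff' = T_auto_gens[OF compatible_comp[OF assms(1,2)]]
  have "T.mono (s * s', l * s' + l', 0) = T.mono (s' * s, l' + s' * l, 0)"
    by (simp add: mult.commute add.commute)
  then have "T_auto c l s (T.mono (s', l', 0)) = T.mono (s' * s, l' + s' * l, 0)"
    using hom_mono[OF T_auto_hom[OF assms(1)] f(1,2), of c s' l'] by simp
  then show "T_auto c l s (T_auto c' l' s' (T_gen m n q \<omega> y)) = T_auto (c' * c) (l' + s' * l) (s' * s) (T_gen m n q \<omega> y)"
    by (cases y) (simp_all add: f f' ff' algebra_homsD[OF T_auto_hom[OF assms(1)]] T.smult_smult)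
qed

lemma T_auto_id: "T_auto 1 0 1 = (\<lambda>v\<in>carrier T. v)"
proof
  fix v
  have c: "\<omega> ^ 1 = \<omega> * q ^ 0" by simp
  have i: "(\<lambda>v. v) \<in> algebra_homs T T" by (auto simp: algebra_homs_def linear_maps_def)
  show "T_auto 1 0 1 v = (\<lambda>v\<in>carrier T. v) v"
  proof (cases "v \<in> carrier T")
    case True
    have "T_auto 1 0 1 v = v"
    proof (rule T_hom_eqI[OF T_algebra_kalgebra T_auto_hom[OF c] i _ True])
      fix y show "T_auto 1 0 1 (T_gen m n q \<omega> y) = T_gen m n q \<omega> y"
        using T.mono_gen T_auto_gens[OF c] by (cases y) simp_all
    qed
    then show ?thesis using True by simp
  qed (simp add: T_auto_def)
qed

lemma T_auto_mod: "T_auto c (l mod m) (s mod n) = T_auto c l s"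
  unfolding T_auto_def auto_gen_def by (simp add: T.mono_mod)

lemma T_auto_inj:
  assumes "\<omega> ^ s = \<omega> * q ^ l" "\<omega> ^ s' = \<omega> * q ^ l'" "T_auto c l s = T_auto c' l' s'"
    and "s < n" "s' < n" "l < m" "l' < m"
  shows "c = c'" "l = l'" "s = s'"
proof -
  have box: "(s, l, 0) \<in> box" "(s', l', 0) \<in> box" "(0, 0, 1) \<in> box" using assms m_ge by auto
  have "T.mono (s, l, 0) = T.mono (s', l', 0)"
    using T_auto_gens(1)[OF assms(1), of c] T_auto_gens(1)[OF assms(2), of c'] assms(3) by simp
  then show "l = l'" "s = s'"
    using coord_mono_box[OF box(1) box(1)] coord_mono_box[OF box(1) box(2)] by (auto split: if_splits)
  have "c \<odot>\<^bsub>T\<^esub> T.mono (0, 0, 1) = c' \<odot>\<^bsub>T\<^esub> T.mono (0, 0, 1)"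
    using T_auto_gens(3)[OF assms(1), of c] T_auto_gens(3)[OF assms(2), of c'] assms(3)
    unfolding T.mono_gen by simp
  then have "coord (0, 0, 1) (c \<odot>\<^bsub>T\<^esub> T.mono (0, 0, 1)) = coord (0, 0, 1) (c' \<odot>\<^bsub>T\<^esub> T.mono (0, 0, 1))"
    by simp
  then show "c = c'"
    using coord_mono_box[OF box(3) box(3)] linear_mapsD(3)[OF box_linear[OF box(3)], of "T.mono (0, 0, 1)"]
    by simp
qed

lemma automorphism_is_T_auto:
  assumes f: "f \<in> hopf_hom H H" and bij: "f \<in> Bij (carrier T)"
  obtains c l s where "c \<noteq> 0" "l < m" "s < n" "coprime s n" "\<omega> ^ s = \<omega> * q ^ l" "f = T_auto c l s"
proof -
  have "bij_betw f (carrier T) (carrier T)" using bij by (simp add: Bij_def)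
  from automorphism_classification[OF f this] obtain c l s where
    c: "c \<noteq> 0" "l < m" "s < n" "coprime s n" "\<omega> ^ s = \<omega> * q ^ l"
    and gens: "f T.g = T.mono (s, l, 0)" "f T.h = T.h" "f T.x = c \<odot>\<^bsub>T\<^esub> T.x" .
  have fa: "f \<in> algebra_homs T T" using f by (simp add: hopf_hom_iff)
  have "f v = T_auto c l s v" if "v \<in> carrier T" for v
  proof (rule T_hom_eqI[OF T_algebra_kalgebra fa T_auto_hom[OF c(5)] _ that])
    fix y show "f (T_gen m n q \<omega> y) = T_auto c l s (T_gen m n q \<omega> y)"
      by (cases y) (simp_all add: gens T_auto_gens[OF c(5)])
  qed
  moreover have "f v = T_auto c l s v" if "v \<notin> carrier T" for v
    using bij that by (simp add: Bij_def extensional_def T_auto_def)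
  ultimately have "f = T_auto c l s" by blast
  then show ?thesis using that c by blast
qed

end

section \<open>The group of pairs\<close>

locale T_isomorphism = T_parameters m n q \<omega> for m n :: nat and q \<omega> :: "'k::field" +
  fixes \<xi> :: 'k and t :: nat
  assumes n_ge_2: "2 \<le> n" and \<xi>_nonzero: "\<xi> \<noteq> 0" and \<omega>_eq: "\<omega> = \<xi> ^ t"
begin

abbreviation "S \<equiv> S_group m n q \<xi> t"

lemma S_carrier:
  "carrier S = {(int l, int s) | l s. l < m \<and> s < n \<and> coprime s n \<and> \<omega> ^ s = \<omega> * q ^ l}"
proof -
  interpret Rn: residues "int n" "residue_ring (int n)"
    using n_ge_2 by unfold_locales simp_all
  interpret Rm: residues "int m" "residue_ring (int m)"
    using m_ge by unfold_locales simp_all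
  have cond: "\<xi> powi (int t * (int s - 1)) = q ^ l \<longleftrightarrow> \<omega> ^ s = \<omega> * q ^ l" for l s
  proof -
    have "\<xi> powi (int t * (int s - 1)) = (\<xi> powi int t) powi (int s - 1)" by (simp add: power_int_mult)
    also have "\<dots> = \<omega> ^ s / \<omega>" using T.\<omega>_nonzero by (simp add: \<omega>_eq power_int_diff)
    finally show ?thesis using T.\<omega>_nonzero by (auto simp: field_simps)
  qed
  have "z \<in> carrier S \<longleftrightarrow> (\<exists>l s. z = (int l, int s) \<and> l < m \<and> s < n \<and> coprime s n \<and> \<omega> ^ s = \<omega> * q ^ l)" for z
  proof
    assume "z \<in> carrier S"
    then obtain a b where z: "z = (a, b)" "0 \<le> a" "a < int m" "0 < b" "b < int n" "coprime b (int n)"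
      "\<xi> powi (int t * (b - 1)) = q powi a"
      by (auto simp: S_group_def Rm.res_carrier_eq Rn.res_units_eq)
    then obtain l s where "a = int l" "b = int s" by (metis less_imp_le nonneg_int_cases)
    then show "\<exists>l s. z = (int l, int s) \<and> l < m \<and> s < n \<and> coprime s n \<and> \<omega> ^ s = \<omega> * q ^ l"
      using z by (auto simp: cond)
  next
    assume "\<exists>l s. z = (int l, int s) \<and> l < m \<and> s < n \<and> coprime s n \<and> \<omega> ^ s = \<omega> * q ^ l"
    then obtain l s where z: "z = (int l, int s)" "l < m" "s < n" "coprime s n" "\<omega> ^ s = \<omega> * q ^ l" by auto
    have "s \<noteq> 0" using z(4) n_ge_2 by (intro notI) simp
    then show "z \<in> carrier S"
      using z by (auto simp: S_group_def Rm.res_carrier_eq Rn.res_units_eq cond)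
  qed
  then show ?thesis by auto
qed

lemma S_mult:
  "(int l, int s) \<otimes>\<^bsub>S\<^esub> (int l', int s') = (int ((l + s * l') mod m), int ((s * s') mod n))"
  by (simp add: S_group_def zmod_int)

lemma S_one: "\<one>\<^bsub>S\<^esub> = (int 0, int 1)"
  by (simp add: S_group_def)

lemma power_q_mod: "q ^ (k mod m) = q ^ k"
  using power_mod_cong[OF q_power, of k "k mod m" 1] by simp

lemma power_\<omega>_mod: "\<omega> ^ (k mod n) = \<omega> ^ k"
  using power_mod_cong[OF \<omega>_power, of k "k mod n" 1] by simp

lemma S_memI: "l < m \<Longrightarrow> s < n \<Longrightarrow> coprime s n \<Longrightarrow> \<omega> ^ s = \<omega> * q ^ l \<Longrightarrow> (int l, int s) \<in> carrier S"
  by (auto simp: S_carrier)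

text \<open>
  Although \<open>a\<close> matters only modulo \<open>n\<close> and \<open>l\<close> only modulo \<open>m\<close>, the product \<open>a l\<close> is well defined modulo
  \<open>m\<close>. Associativity of the group of pairs rests on this.
\<close>

lemma mod_product_absorb:
  assumes "m dvd n * l" shows "((a mod n) * l) mod m = (a * l) mod m"
proof -
  have "a * l = (n * l) * (a div n) + (a mod n) * l"
    by (metis mult.assoc mult.commute distrib_right mult_div_mod_eq)
  moreover have "((n * l) * (a div n)) mod m = 0" using assms by auto
  ultimately show ?thesis by (metis add_0 mod_add_left_eq)
qed

lemma S_group: "group S"
proof (rule groupI)
  show "\<one>\<^bsub>S\<^esub> \<in> carrier S"
    unfolding S_one using m_ge n_ge_2 by (intro S_memI) auto
next
  fix x y assume "x \<in> carrier S" "y \<in> carrier S"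
  then obtain l s l' s' where x: "x = (int l, int s)" "coprime s n" "\<omega> ^ s = \<omega> * q ^ l"
    and y: "y = (int l', int s')" "coprime s' n" "\<omega> ^ s' = \<omega> * q ^ l'" by (auto simp: S_carrier)
  show "x \<otimes>\<^bsub>S\<^esub> y \<in> carrier S"
    unfolding x y S_mult
    using T.m_pos T.n_pos x(2) y(2) compatible_comp[OF y(3) x(3)]
    by (intro S_memI) (auto simp: power_q_mod power_\<omega>_mod)
next
  fix x y z assume "x \<in> carrier S" "y \<in> carrier S" "z \<in> carrier S"
  then obtain l s l' s' l'' s'' where x: "x = (int l, int s)"
    and y: "y = (int l', int s')" and z: "z = (int l'', int s'')" "\<omega> ^ s'' = \<omega> * q ^ l''"
    by (auto simp: S_carrier)
  have "((l + s * l') mod m + ((s * s') mod n) * l'') mod m = (l + s * l' + s * s' * l'') mod m"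
    using mod_product_absorb[OF compatible_dvd[OF z(2)], of "s * s'"] by (metis mod_add_cong mod_mod_trivial)
  moreover have "(l + s * ((l' + s' * l'') mod m)) mod m = (l + s * l' + s * s' * l'') mod m"
    by (metis (no_types) mod_add_right_eq mod_mult_right_eq distrib_left add.assoc mult.assoc)
  ultimately show "x \<otimes>\<^bsub>S\<^esub> y \<otimes>\<^bsub>S\<^esub> z = x \<otimes>\<^bsub>S\<^esub> (y \<otimes>\<^bsub>S\<^esub> z)"
    unfolding x y z S_mult by (simp add: mod_simps mult.assoc)
next
  fix x assume "x \<in> carrier S"
  then obtain l s where x: "x = (int l, int s)" "l < m" "s < n" by (auto simp: S_carrier)
  show "\<one>\<^bsub>S\<^esub> \<otimes>\<^bsub>S\<^esub> x = x" unfolding x S_one S_mult using x by simp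
next
  fix x assume "x \<in> carrier S"
  then obtain l s where x: "x = (int l, int s)" "l < m" "s < n" "coprime s n" "\<omega> ^ s = \<omega> * q ^ l" by (auto simp: S_carrier)
  obtain r where r: "[s * r = 1] (mod n)" using x(4) cong_solve_coprime_nat by auto
  define s' where "s' = r mod n"
  have s': "(s' * s) mod n = 1" "s' < n"
    using r n_ge_2 by (auto simp: s'_def cong_def mod_simps mult.commute)
  then have cop: "coprime s' n" 
    by (metis coprime_1_left coprime_mod_left_iff coprime_mult_left_iff gr_implies_not0)
  \<comment> \<open>A natural number representing \<open>- s' l\<close> modulo \<open>m\<close>.\<close>
  define l' where "l' = ((m - 1) * (s' * l)) mod m"
  have qz: "q ^ (s' * l) * q ^ ((m - 1) * (s' * l)) = 1"
  proof -
    have "s' * l + (m - 1) * (s' * l) = m * (s' * l)" using T.m_pos by (metis Suc_pred' mult_Suc)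
    then show ?thesis by (metis power_add power_mult power_one q_power)
  qed
  have "\<omega> = \<omega> ^ (s' * s)" using power_\<omega>_mod[of "s' * s"] s' by simp
  also have "\<dots> = (\<omega> ^ s) ^ s'" by (simp add: mult.commute power_mult[symmetric])
  also have "\<dots> = \<omega> ^ s' * q ^ (s' * l)"
    by (simp add: x(5) power_mult_distrib power_mult[symmetric] mult.commute)
  finally have "\<omega> * q ^ ((m - 1) * (s' * l)) = \<omega> ^ s' * (q ^ (s' * l) * q ^ ((m - 1) * (s' * l)))"
    by (metis mult.assoc)
  then have "\<omega> ^ s' = \<omega> * q ^ l'" unfolding qz by (simp add: l'_def power_q_mod)
  then have mem: "(int l', int s') \<in> carrier S"
    using cop s' T.m_pos by (intro S_memI) (auto simp: l'_def)
  have "(l' + s' * l) mod m = 0"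
  proof -
    have "(l' + s' * l) mod m = ((m - 1) * (s' * l) + s' * l) mod m" by (simp add: l'_def mod_simps)
    also have "(m - 1) * (s' * l) + s' * l = m * (s' * l)"
      using T.m_pos by (metis Suc_pred' add.commute mult_Suc)
    finally show ?thesis by simp
  qed
  then have "(int l', int s') \<otimes>\<^bsub>S\<^esub> x = \<one>\<^bsub>S\<^esub>"
    unfolding x S_mult S_one using s' by simp
  then show "\<exists>y\<in>carrier S. y \<otimes>\<^bsub>S\<^esub> x = \<one>\<^bsub>S\<^esub>" using mem by blast
qed

section \<open>The isomorphism\<close>

abbreviation "KS \<equiv> units_of (ground_algebra :: ('k, 'k) module) \<times>\<times> S"

lemma units_ground: "units_of (ground_algebra :: ('k, 'k) module) = \<lparr>carrier = {c. c \<noteq> 0}, monoid.mult = (*), one = 1\<rparr>"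
proof -
  have "Units (ground_algebra :: ('k, 'k) module) = {c. c \<noteq> 0}"
  proof -
    have "\<exists>d. d * c = 1 \<and> c * d = 1" if "c \<noteq> 0" for c :: 'k
      using that by (intro exI[of _ "inverse c"]) simp
    then show ?thesis by (auto simp: Units_def)
  qed
  then show ?thesis by (simp add: units_of_def)
qed

lemma KS_group: "group KS"
proof -
  interpret K: kalgebra "ground_algebra :: ('k, 'k) module" by (rule ground_algebra_kalgebra)
  show ?thesis by (intro DirProd_group K.units_group S_group)
qed

sublocale KS: group KS by (rule KS_group)

lemma KS_cases:
  assumes "a \<in> carrier KS"
  obtains c l s where "a = (c, int l, int s)" "c \<noteq> 0" "l < m" "s < n" "coprime s n" "\<omega> ^ s = \<omega> * q ^ l"
  using assms by (auto simp: units_ground S_carrier)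

lemma KS_mult: "(c, int l, int s) \<otimes>\<^bsub>KS\<^esub> (c', int l', int s')
    = (c * c', int ((l + s * l') mod m), int ((s * s') mod n))"
  by (simp add: units_ground S_mult)

lemma KS_one: "\<one>\<^bsub>KS\<^esub> = (1, int 0, int 1)"
  by (simp only: one_DirProd S_one) (simp add: units_ground)

definition pair_auto :: "'k \<times> int \<times> int \<Rightarrow> (gen list \<Rightarrow>\<^sub>0 'k) set \<Rightarrow> (gen list \<Rightarrow>\<^sub>0 'k) set"
  where "pair_auto = (\<lambda>(c, l, s). T_auto c (nat l) (nat s))"

lemma pair_auto_one: "pair_auto \<one>\<^bsub>KS\<^esub> = (\<lambda>v\<in>carrier T. v)"
  unfolding KS_one pair_auto_def using T_auto_id by simp

lemma pair_auto_comp: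
  assumes "a \<in> carrier KS" "b \<in> carrier KS" "v \<in> carrier T"
  shows "pair_auto a (pair_auto b v) = pair_auto (b \<otimes>\<^bsub>KS\<^esub> a) v"
proof -
  obtain c l s where a: "a = (c, int l, int s)" "\<omega> ^ s = \<omega> * q ^ l" using assms(1) by (rule KS_cases)
  obtain c' l' s' where b: "b = (c', int l', int s')" "\<omega> ^ s' = \<omega> * q ^ l'" using assms(2) by (rule KS_cases)
  show ?thesis
    unfolding a b KS_mult by (simp add: pair_auto_def T_auto_comp[OF a(2) b(2) assms(3)] T_auto_mod)
qed

lemma pair_auto_hopf: "a \<in> carrier KS \<Longrightarrow> pair_auto a \<in> hopf_hom H H"
  by (erule KS_cases) (simp add: pair_auto_def T_auto_hopf_hom)

lemma pair_auto_closed: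
  assumes "a \<in> carrier KS" "v \<in> carrier T" shows "pair_auto a v \<in> carrier T"
proof -
  have "pair_auto a \<in> algebra_homs T T" using pair_auto_hopf[OF assms(1)] by (simp add: hopf_hom_iff)
  then show ?thesis using assms(2) by (rule algebra_homsD(4))
qed

text \<open>
  The inverse of the map attached to \<open>a\<close> is the map attached to the inverse of \<open>a\<close>.
\<close>

lemma pair_auto_Bij:
  assumes "a \<in> carrier KS" shows "pair_auto a \<in> Bij (carrier T)"
proof -
  let ?b = "inv\<^bsub>KS\<^esub> a"
  have b: "?b \<in> carrier KS" using assms by (rule KS.inv_closed)
  have "bij_betw (pair_auto a) (carrier T) (carrier T)"
  proof (rule bij_betw_byWitness[where f' = "pair_auto ?b"])
    show "\<forall>v\<in>carrier T. pair_auto ?b (pair_auto a v) = v"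
      using pair_auto_comp[OF b assms] KS.r_inv[OF assms] pair_auto_one by simp
    show "\<forall>v\<in>carrier T. pair_auto a (pair_auto ?b v) = v"
      using pair_auto_comp[OF assms b] KS.l_inv[OF assms] pair_auto_one by simp
  qed (use pair_auto_closed[OF assms] pair_auto_closed[OF b] in blast)+
  moreover have "pair_auto a \<in> extensional (carrier T)"
    by (cases a) (simp add: pair_auto_def T_auto_def)
  ultimately show ?thesis by (simp add: Bij_def)
qed

lemma Aut_simps:
  "carrier (Aut_Hopf H) = hopf_hom H H \<inter> Bij (carrier T)"
  "\<one>\<^bsub>Aut_Hopf H\<^esub> = (\<lambda>v\<in>carrier T. v)"
  "f \<in> Bij (carrier T) \<Longrightarrow> g \<in> Bij (carrier T) \<Longrightarrow> f \<otimes>\<^bsub>Aut_Hopf H\<^esub> g = compose (carrier T) f g"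
  by (simp_all add: Aut_Hopf_def BijGroup_def)

lemma pair_auto_bij: "bij_betw pair_auto (carrier KS) (carrier (Aut_Hopf H))"
  unfolding bij_betw_def
proof
  show "inj_on pair_auto (carrier KS)"
  proof
    fix a b assume ab: "a \<in> carrier KS" "b \<in> carrier KS" "pair_auto a = pair_auto b"
    obtain c l s where a: "a = (c, int l, int s)" "l < m" "s < n" "\<omega> ^ s = \<omega> * q ^ l" using ab(1) by (rule KS_cases)
    obtain c' l' s' where b: "b = (c', int l', int s')" "l' < m" "s' < n" "\<omega> ^ s' = \<omega> * q ^ l'" using ab(2) by (rule KS_cases)
    have "T_auto c l s = T_auto c' l' s'" using ab(3) by (simp add: a b pair_auto_def)
    from T_auto_inj[OF a(4) b(4) this a(3) b(3) a(2) b(2)] show "a = b" by (simp add: a b)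
  qed
  show "pair_auto ` carrier KS = carrier (Aut_Hopf H)"
  proof
    show "pair_auto ` carrier KS \<subseteq> carrier (Aut_Hopf H)"
      unfolding Aut_simps using pair_auto_hopf pair_auto_Bij by blast
    show "carrier (Aut_Hopf H) \<subseteq> pair_auto ` carrier KS"
    proof
      fix f assume "f \<in> carrier (Aut_Hopf H)"
      then have "f \<in> hopf_hom H H" "f \<in> Bij (carrier T)" by (simp_all add: Aut_simps)
      then obtain c l s where cls: "c \<noteq> 0" "l < m" "s < n" "coprime s n" "\<omega> ^ s = \<omega> * q ^ l" "f = T_auto c l s"
        by (rule automorphism_is_T_auto)
      then have "(c, int l, int s) \<in> carrier KS" by (auto simp: units_ground S_carrier)
      moreover have "f = pair_auto (c, int l, int s)" by (simp add: pair_auto_def cls)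
      ultimately show "f \<in> pair_auto ` carrier KS" by blast
    qed
  qed
qed

text \<open>
  The assignment of automorphisms to triples reverses products, and so does inversion.
\<close>

lemma pair_auto_inv_iso: "(\<lambda>a. pair_auto (inv\<^bsub>KS\<^esub> a)) \<in> iso KS (Aut_Hopf H)"
proof -
  have "pair_auto (inv\<^bsub>KS\<^esub> (a \<otimes>\<^bsub>KS\<^esub> b)) = pair_auto (inv\<^bsub>KS\<^esub> a) \<otimes>\<^bsub>Aut_Hopf H\<^esub> pair_auto (inv\<^bsub>KS\<^esub> b)"
    if ab: "a \<in> carrier KS" "b \<in> carrier KS" for a b
  proof -
    have i: "inv\<^bsub>KS\<^esub> a \<in> carrier KS" "inv\<^bsub>KS\<^esub> b \<in> carrier KS" using ab by (blast intro: KS.inv_closed)+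
    have ext: "pair_auto z v = undefined" if "v \<notin> carrier T" for z v
      using that by (cases z) (simp add: pair_auto_def T_auto_def)
    show ?thesis
      unfolding KS.inv_mult_group[OF ab] Aut_simps(3)[OF pair_auto_Bij[OF i(1)] pair_auto_Bij[OF i(2)]]
      using pair_auto_comp[OF i] ext by (auto simp: compose_def fun_eq_iff restrict_def)
  qed
  moreover have "bij_betw (\<lambda>a. inv\<^bsub>KS\<^esub> a) (carrier KS) (carrier KS)"
    by (rule bij_betw_byWitness[where f' = "\<lambda>a. inv\<^bsub>KS\<^esub> a"])
      (auto simp del: carrier_DirProd simp: KS.inv_inv intro: KS.inv_closed)
  then have "bij_betw (\<lambda>a. pair_auto (inv\<^bsub>KS\<^esub> a)) (carrier KS) (carrier (Aut_Hopf H))"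
    using bij_betw_trans[OF _ pair_auto_bij] by (simp add: comp_def)
  moreover from this have "(\<lambda>a. pair_auto (inv\<^bsub>KS\<^esub> a)) \<in> carrier KS \<rightarrow> carrier (Aut_Hopf H)"
    by (rule bij_betw_imp_funcset)
  ultimately show ?thesis unfolding iso_def hom_def by blast
qed

text \<open>
  The image of a group under a homomorphism is a group; in particular inverses of Hopf automorphisms
  need no separate treatment.
\<close>

lemma Aut_group: "group (Aut_Hopf H)"
proof -
  let ?f = "\<lambda>a. pair_auto (inv\<^bsub>KS\<^esub> a)"
  have "?f \<in> hom KS (Aut_Hopf H)" "?f ` carrier KS = carrier (Aut_Hopf H)"
    using pair_auto_inv_iso by (auto simp: iso_def bij_betw_def)
  moreover have "?f \<one>\<^bsub>KS\<^esub> = \<one>\<^bsub>Aut_Hopf H\<^esub>"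
    unfolding KS.inv_one Aut_simps by (rule pair_auto_one)
  ultimately show ?thesis using KS.hom_imp_img_group[of ?f "Aut_Hopf H"] by simp
qed

lemma Aut_iso: "Aut_Hopf H \<cong> KS"
  by (rule KS.iso_sym[OF is_isoI[OF pair_auto_inv_iso]])

end

text \<open>
  If \<open>q\<^sup>k = 1\<close>, then \<open>q\<close> has at most \<open>k\<close> distinct powers, whereas the powers of \<open>q\<close> exhaust the \<open>m\<close> roots of
  unity.
\<close>

lemma primitive_root_unity_order:
  assumes "primitive_root_unity m (q :: 'k::field)" "2 \<le> m"
  shows "q ^ m = 1" and "0 < k \<Longrightarrow> k < m \<Longrightarrow> q ^ k \<noteq> 1"
proof -
  have card: "card (roots_unity m :: 'k set) = m" and gen: "roots_unity m = range (\<lambda>k::int. q powi k)"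
    using assms by (auto simp: primitive_root_unity_def generates_roots_unity_def)
  have "q powi 1 \<in> roots_unity m" unfolding gen by (rule rangeI)
  then show qm: "q ^ m = 1" by (simp add: roots_unity_def)
  then have q0: "q \<noteq> 0" using assms(2) by (metis not_numeral_le_zero power_0_left zero_neq_one)
  show "q ^ k \<noteq> 1" if k: "0 < k" "k < m"
  proof
    assume qk: "q ^ k = 1"
    have "q powi z = q ^ nat (z mod int k)" for z
    proof -
      have "q powi z = q powi (int k * (z div int k) + z mod int k)" by simp
      also have "\<dots> = (q powi int k) powi (z div int k) * q powi (z mod int k)"
        using q0 by (subst power_int_add) (simp_all only: power_int_mult, simp)
      also have "\<dots> = q ^ nat (z mod int k)" using qk k by (simp add: power_int_def)
      finally show ?thesis .
    qed
    moreover have "nat (z mod int k) \<in> {..<k}" for z using k by (simp add: nat_less_iff)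
    ultimately have "roots_unity m \<subseteq> (\<lambda>i. q ^ i) ` {..<k}" unfolding gen by auto
    then have "card (roots_unity m :: 'k set) \<le> k"
      by (metis card_image_le card_lessThan card_mono dual_order.trans finite_imageI finite_lessThan)
    then show False using card k by simp
  qed
qed

theorem theorem3p6:
  fixes m n t :: nat and q \<xi> :: "'k::field"
  assumes "m \<ge> 3" and "n \<ge> 2"
    and "primitive_root_unity m q"
    and "generates_roots_unity n \<xi>"
    and "t < card (roots_unity n :: 'k set)"
  shows "group (Aut_Hopf (T_hopf m n q (\<xi> ^ t))) \<and>
    group (S_group m n q \<xi> t) \<and>
    Aut_Hopf (T_hopf m n q (\<xi> ^ t)) \<cong>
      units_of (ground_algebra :: ('k, 'k) module) \<times>\<times> S_group m n q \<xi> t"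
proof -
  have "\<xi> powi 1 \<in> roots_unity n"
    using assms(4) unfolding generates_roots_unity_def by (metis rangeI)
  then have \<xi>: "\<xi> ^ n = 1" by (simp add: roots_unity_def)
  then have "\<xi> \<noteq> 0" using assms(2) by (metis not_numeral_le_zero power_0_left zero_neq_one)
  moreover have "(\<xi> ^ t) ^ n = 1" using \<xi> by (metis mult.commute power_mult power_one)
  ultimately interpret T_isomorphism m n q "\<xi> ^ t" \<xi> t
    using assms primitive_root_unity_order[OF assms(3)]
    by unfold_locales auto
  show ?thesis using Aut_group S_group Aut_iso by blast
qed

end
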